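(* Assume that $-\mathcal{L}_K+V$ is positive definite and let $2<p<2^*_s$. There exists a sign-changing solution $u^*$ of $$-\mathcal{L}_K u+V(x)u=|u|^{p-2}u \ \text{ in } \Omega,\qquad u=0\ \text{ in } \mathbb{R}^N\setminus\Omega \qquad (\ast)$$ with minimal energy $\mathcal{E}_p$ among all sign-changing solutions of $(\ast)$. In addition, $u^*\in\mathcal{M}_p$ and $u^*$ achieves the minimum of $\mathcal{E}_p$ on $\mathcal{M}_p$.
   Context: Let $N\ge 2$, $s\in(0,1)$, $2^*_s=\frac{2N}{N-2s}$; $\Omega\subset\mathbb{R}^N$ is an open bounded domain with Lipschitz boundary and $V\in L^\infty(\Omega)$. The kernel $K:\mathbb{R}^N\setminus\{0\}\to(0,+\infty)$ satisfies $K(x)=K(-x)$, $\min\{|x|^2,1\}K(x)\in L^1(\mathbb{R}^N)$, and there is $\theta>0$ with $K(x)\ge\theta|x|^{-(N+2s)}$ for all $x\neq0$. Put $\mathcal{L}_Ku(x)=\int_{\mathbb{R}^N}(u(x+y)-2u(x)+u(x-y))K(y)\,dy$. $H$ is the Hilbert space of measurable $g:\mathbb{R}^N\to\mathbb{R}$ with $g=0$ a.e. outside $\Omega$, $g|_\Omega\in L^2(\Omega)$ and $(x,y)\mapsto (g(x)-g(y))\sqrt{K(x-y)}\in L^2(Q)$, where $Q=\mathbb{R}^{2N}\setminus((\mathbb{R}^N\setminus\Omega)\times(\mathbb{R}^N\setminus\Omega))$, with inner product $\langle u,v\rangle_H=\int_Q(u(x)-u(y))(v(x)-v(y))K(x-y)\,dx\,dy$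 and norm $\|\cdot\|_H$. $|\cdot|_q$ is the $L^q$ norm. "$-\mathcal{L}_K+V$ is positive definite" means that $\|u\|_H^2+\int_\Omega Vu^2>0$ for all $u\in H\setminus\{0\}$. Let $\mathcal{E}_p(u)=\frac12\|u\|_H^2+\frac12\int_\Omega Vu^2-\frac1p|u|_p^p$ on $H$. Solutions of $(\ast)$ are weak solutions, i.e. critical points of $\mathcal{E}_p$: $u\in H$ and $\langle u,\phi\rangle_H+\int_\Omega Vu\phi=\int_\Omega|u|^{p-2}u\phi$ for all $\phi\in H$. Write $u^+=\max\{u,0\}$, $u^-=\min\{u,0\}$; $u$ is sign-changing if $u^+\ne0$ and $u^-\neq0$. The nodal Nehari set is $$\mathcal{M}_p=\Bigl\{u\in H\setminus\{0\}:u^\pm\neq0\text{ and }\mathcal{E}_p(u)=\max_{t^+,t^->0}\mathcal{E}_p(t^+u^++t^-u^-)\Bigr\}.$$ *)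

theory Defs
  imports "HOL-Analysis.Analysis"
begin

text \<open>
  Measurability and integration are with respect to Lebesgue (not just Borel) measurable sets.
  Elements of function spaces are represented by functions, so equality with \<open>0\<close> is always
  understood almost everywhere.
\<close>

definition ae_zero :: "('a::euclidean_space \<Rightarrow> real) \<Rightarrow> bool" where
  "ae_zero u \<longleftrightarrow> (AE x in lebesgue. u x = 0)"

definition L2_on :: "'a::euclidean_space set \<Rightarrow> ('a \<Rightarrow> real) \<Rightarrow> bool" where
  "L2_on S f \<longleftrightarrow> f \<in> borel_measurable (lebesgue_on S) \<and> integrable (lebesgue_on S) (\<lambda>x. (f x)\<^sup>2)"

definition Linf_on :: "'a::euclidean_space set \<Rightarrow> ('a \<Rightarrow> real) \<Rightarrow> bool" where
  "Linf_on S f \<longleftrightarrow> f \<in> borel_measurable (lebesgue_on S) \<and> (\<exists>C. AE x in lebesgue_on S. \<bar>f x\<bar> \<le> C)"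

definition Lq_norm :: "real \<Rightarrow> ('a::euclidean_space \<Rightarrow> real) \<Rightarrow> real" where
  "Lq_norm q u = (LINT x|lebesgue. \<bar>u x\<bar> powr q) powr (1 / q)"

text \<open>
  Near each boundary point the set is, in suitable Cartesian coordinates, the part of a ball lying
  above the graph of a Lipschitz function of the remaining variables: \<open>e\<close> is the vertical unit
  vector, and \<open>x - (x \<bullet> e) *\<^sub>R e\<close> is the projection of \<open>x\<close> onto the hyperplane orthogonal to \<open>e\<close>.
\<close>

definition lipschitz_boundary :: "'a::euclidean_space set \<Rightarrow> bool" where
  "lipschitz_boundary \<Omega> \<longleftrightarrow>
    (\<forall>x0 \<in> frontier \<Omega>. \<exists>r > 0. \<exists>e \<gamma> L. norm e = 1 \<and> L-lipschitz_on {y. y \<bullet> e = 0} \<gamma> \<and>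
       \<Omega> \<inter> ball x0 r = {x \<in> ball x0 r. x \<bullet> e > \<gamma> (x - (x \<bullet> e) *\<^sub>R e)})"

definition Q_set :: "'a set \<Rightarrow> ('a \<times> 'a) set" where
  "Q_set \<Omega> = UNIV - ((UNIV - \<Omega>) \<times> (UNIV - \<Omega>))"

definition H_space :: "'a::euclidean_space set \<Rightarrow> ('a \<Rightarrow> real) \<Rightarrow> ('a \<Rightarrow> real) set" where
  "H_space \<Omega> K = {g. g \<in> borel_measurable lebesgue \<and>
     (AE x in lebesgue. x \<notin> \<Omega> \<longrightarrow> g x = 0) \<and>
     L2_on \<Omega> g \<and>
     L2_on (Q_set \<Omega>) (\<lambda>(x, y). (g x - g y) * sqrt (K (x - y)))}"

definition H_inner :: "'a::euclidean_space set \<Rightarrow> ('a \<Rightarrow> real) \<Rightarrow> ('a \<Rightarrow> real) \<Rightarrow> ('a \<Rightarrow> real) \<Rightarrow> real" where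
  "H_inner \<Omega> K u v =
     (LINT (x, y)|lebesgue_on (Q_set \<Omega>). (u x - u y) * (v x - v y) * K (x - y))"

definition H_norm :: "'a::euclidean_space set \<Rightarrow> ('a \<Rightarrow> real) \<Rightarrow> ('a \<Rightarrow> real) \<Rightarrow> real" where
  "H_norm \<Omega> K u = sqrt (H_inner \<Omega> K u u)"

text \<open>Positive definiteness of \<open>- L\<^sub>K + V\<close>, in the sense of its quadratic form on \<open>H\<close>.\<close>

definition positive_definite_op ::
    "'a::euclidean_space set \<Rightarrow> ('a \<Rightarrow> real) \<Rightarrow> ('a \<Rightarrow> real) \<Rightarrow> bool" where
  "positive_definite_op \<Omega> K V \<longleftrightarrow>
     (\<forall>u \<in> H_space \<Omega> K. \<not> ae_zero u \<longrightarrow>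
        (H_norm \<Omega> K u)\<^sup>2 + (LINT x|lebesgue_on \<Omega>. V x * (u x)\<^sup>2) > 0)"

definition energy ::
    "'a::euclidean_space set \<Rightarrow> ('a \<Rightarrow> real) \<Rightarrow> ('a \<Rightarrow> real) \<Rightarrow> real \<Rightarrow> ('a \<Rightarrow> real) \<Rightarrow> real" where
  "energy \<Omega> K V p u = 1 / 2 * (H_norm \<Omega> K u)\<^sup>2
     + 1 / 2 * (LINT x|lebesgue_on \<Omega>. V x * (u x)\<^sup>2)
     - 1 / p * (Lq_norm p u) powr p"

text \<open>
  Weak solutions of \<open>- L\<^sub>K u + V u = |u|\<^bsup>p-2\<^esup> u\<close> in \<open>\<Omega>\<close> with exterior condition \<open>u = 0\<close>; the
  exterior condition is part of the membership in \<open>H\<close>.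
\<close>

definition weak_solution ::
    "'a::euclidean_space set \<Rightarrow> ('a \<Rightarrow> real) \<Rightarrow> ('a \<Rightarrow> real) \<Rightarrow> real \<Rightarrow> ('a \<Rightarrow> real) \<Rightarrow> bool" where
  "weak_solution \<Omega> K V p u \<longleftrightarrow> u \<in> H_space \<Omega> K \<and>
     (\<forall>\<phi> \<in> H_space \<Omega> K.
        H_inner \<Omega> K u \<phi> + (LINT x|lebesgue_on \<Omega>. V x * u x * \<phi> x)
        = (LINT x|lebesgue_on \<Omega>. \<bar>u x\<bar> powr (p - 2) * u x * \<phi> x))"

text \<open>The negative part is \<open>min u 0\<close>, hence nonpositive, so that \<open>u = u\<^sup>+ + u\<^sup>-\<close>.\<close>

definition pos_part :: "('a \<Rightarrow> real) \<Rightarrow> 'a \<Rightarrow> real" where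
  "pos_part u x = max (u x) 0"

definition neg_part :: "('a \<Rightarrow> real) \<Rightarrow> 'a \<Rightarrow> real" where
  "neg_part u x = min (u x) 0"

definition sign_changing :: "('a::euclidean_space \<Rightarrow> real) \<Rightarrow> bool" where
  "sign_changing u \<longleftrightarrow> \<not> ae_zero (pos_part u) \<and> \<not> ae_zero (neg_part u)"

definition is_maximum :: "real set \<Rightarrow> real \<Rightarrow> bool" where
  "is_maximum S m \<longleftrightarrow> m \<in> S \<and> (\<forall>y \<in> S. y \<le> m)"

definition nodal_Nehari ::
    "'a::euclidean_space set \<Rightarrow> ('a \<Rightarrow> real) \<Rightarrow> ('a \<Rightarrow> real) \<Rightarrow> real \<Rightarrow> ('a \<Rightarrow> real) set" where
  "nodal_Nehari \<Omega> K V p = {u \<in> H_space \<Omega> K. \<not> ae_zero u \<and>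
     \<not> ae_zero (pos_part u) \<and> \<not> ae_zero (neg_part u) \<and>
     is_maximum {energy \<Omega> K V p (\<lambda>x. t * pos_part u x + t' * neg_part u x) | t t'. t > 0 \<and> t' > 0}
       (energy \<Omega> K V p u)}"

end

theory Submission
  imports Defs "HOL-Complex_Analysis.Great_Picard"
begin

text \<open>
  Write \<open>a u u\<close> for the quadratic form \<open>\<parallel>u\<parallel>\<^sup>2 + \<integral> V u\<^sup>2\<close> and \<open>P u\<close> for \<open>\<integral> \<bar>u\<bar>\<^sup>p\<close>, and let \<open>u\<^sup>+\<close>, \<open>u\<^sup>-\<close> be the two
  parts of \<open>u\<close>. On the fibre \<open>t u\<^sup>+ + \<tau> u\<^sup>-\<close> with \<open>t, \<tau> > 0\<close> the energy is a quadratic form in \<open>(t, \<tau>)\<close> minus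
  \<open>(t\<^sup>p P u\<^sup>+ + \<tau>\<^sup>p P u\<^sup>-) / p\<close>. The coupling \<open>a u\<^sup>+ u\<^sup>-\<close> is nonnegative (\<open>a_pos_neg_nonneg\<close>), and with
  \<open>2 t \<tau> \<le> t\<^sup>2 + \<tau>\<^sup>2\<close> this makes every critical point of the fibre a global maximum (\<open>fibre_maximum\<close>). The
  nodal Nehari set is therefore cut out by the equations \<open>a u u\<^sup>+ = P u\<^sup>+\<close> and \<open>a u u\<^sup>- = P u\<^sup>-\<close>
  (\<open>nodal_Nehari_iff\<close>). It contains every sign-changing solution, so it suffices to minimize the energy on
  it and to show that a minimizer is a solution. Every sign-changing function has a point of the set on
  its fibre, by the Poincare-Miranda theorem (\<open>Nehari_projection\<close>).

  A minimizer exists by compactness (\<open>Nehari_minimizer\<close>). On the set the energy is \<open>(1/2 - 1/p) a u u\<close>, and \<open>a\<close>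
  controls the norm of \<open>H\<close> (\<open>coercive\<close>). The limit of a minimizing sequence keeps both signs since \<open>P\<close> of
  either part is bounded below (\<open>Lp_lower_bound\<close>), and projecting it to the set does not raise the energy
  above the infimum. Convergence almost everywhere under an integrable majorant (\<open>compactness\<close>) takes the
  place of weak convergence: Fatou's lemma then gives lower semicontinuity.

  The compact embedding rests on the lower bound for \<open>K\<close>, which compares the norm of \<open>H\<close> with a Gagliardo
  seminorm. One elementary estimate at a point \<open>x\<close>, in terms of the measure of a level set
  (\<open>level_set_inequality\<close>), gives the Poincare inequality and, iterated, the Sobolev inequality for all
  subcritical exponents. Comparison with averages over small cubes (\<open>grid_poincare\<close>) gives compactness in
  \<open>L\<^sup>2\<close>, and the Sobolev inequality transfers it to \<open>L\<^sup>p\<close>.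

  If a minimizer \<open>u\<close> were not a solution, some direction \<open>\<phi>\<close> would lower the energy, uniformly near \<open>(1, 1)\<close> on
  its fibre. The functions \<open>t u\<^sup>+ + \<tau> u\<^sup>- + \<epsilon> \<phi>\<close> depend continuously enough on the parameters for
  Poincare-Miranda to find one of them in the Nehari set, with energy below the minimum
  (\<open>Nehari_minimizer_no_descent\<close>). This argument never differentiates \<open>u\<^sup>+\<close> and \<open>u\<^sup>-\<close>.
\<close>

section \<open>Lebesgue measurability on pairs\<close>

text \<open>
  Elements of \<open>H\<close> are Lebesgue, not Borel, measurable, so composing them with a Borel map keeps
  measurability and almost everywhere statements only if the map pulls null sets back to null sets.
  The maps needed on pairs are the two projections and the difference.
\<close>

lemma AE_lebesgue_comp:
  fixes T :: "'b::euclidean_space \<Rightarrow> 'a::euclidean_space"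
  assumes T: "T \<in> borel_measurable borel"
    and null: "\<And>N. N \<in> null_sets lborel \<Longrightarrow> T -` N \<in> null_sets lborel"
    and P: "AE x in lebesgue. P x"
  shows "AE z in lebesgue. P (T z)"
proof -
  have "AE x in lborel. P x" using P by (simp add: AE_completion_iff)
  then obtain N where N: "{x\<in>space lborel. \<not> P x} \<subseteq> N" "N \<in> null_sets lborel"
    by (rule eventually_ae_filter[THEN iffD1, THEN bexE])
  have "AE z in lborel. P (T z)"
    by (rule AE_I'[OF null[OF N(2)]]) (use N(1) in auto)
  then show ?thesis by (simp add: AE_completion_iff)
qed

lemma borel_measurable_lebesgue_comp:
  fixes T :: "'b::euclidean_space \<Rightarrow> 'a::euclidean_space" and f :: "'a \<Rightarrow> real"
  assumes T: "T \<in> borel_measurable borel"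
    and null: "\<And>N. N \<in> null_sets lborel \<Longrightarrow> T -` N \<in> null_sets lborel"
    and f: "f \<in> borel_measurable lebesgue"
  shows "(\<lambda>z. f (T z)) \<in> borel_measurable lebesgue"
proof -
  obtain f' where f': "f' \<in> borel_measurable lborel" "AE x in lborel. f x = f' x"
    using completion_ex_borel_measurable_real[OF f] by blast
  have ae: "AE z in lebesgue. f (T z) = f' (T z)"
    by (rule AE_lebesgue_comp[OF T null]) (use f'(2) in \<open>auto simp: AE_completion_iff\<close>)
  have "(\<lambda>z. f' (T z)) \<in> borel_measurable lborel"
    using measurable_compose[OF T, of f' borel] f'(1) by simp
  then have "(\<lambda>z. f' (T z)) \<in> borel_measurable lebesgue"
    by (rule measurable_completion)
  then show ?thesis
    by (rule borel_measurable_AE) (use ae in auto)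
qed

lemma null_sets_vimage_fst:
  fixes N :: "'a::euclidean_space set"
  assumes "N \<in> null_sets lborel"
  shows "(fst :: 'a \<times> 'b::euclidean_space \<Rightarrow> 'a) -` N \<in> null_sets lborel"
proof -
  have N: "N \<in> sets lborel" "emeasure lborel N = 0" using assms by auto
  have "emeasure (lborel \<Otimes>\<^sub>M lborel) (N \<times> (UNIV :: 'b set)) = 0"
    using N by (subst lborel.emeasure_pair_measure_Times) auto
  moreover have "(fst :: 'a \<times> 'b \<Rightarrow> 'a) -` N = N \<times> UNIV" by auto
  moreover have "N \<times> (UNIV :: 'b set) \<in> sets lborel"
    using pair_measureI[of N lborel "UNIV :: 'b set" lborel] N unfolding lborel_prod by simp
  ultimately show ?thesis by (auto simp: lborel_prod null_sets_def)
qed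

lemma null_sets_vimage_snd:
  fixes N :: "'a::euclidean_space set"
  assumes "N \<in> null_sets lborel"
  shows "(snd :: 'b::euclidean_space \<times> 'a \<Rightarrow> 'a) -` N \<in> null_sets lborel"
proof -
  have N: "N \<in> sets lborel" "emeasure lborel N = 0" using assms by auto
  have "emeasure (lborel \<Otimes>\<^sub>M lborel) ((UNIV :: 'b set) \<times> N) = 0"
    using N by (subst lborel.emeasure_pair_measure_Times) auto
  moreover have "(snd :: 'b \<times> 'a \<Rightarrow> 'a) -` N = UNIV \<times> N" by auto
  moreover have "(UNIV :: 'b set) \<times> N \<in> sets lborel"
    using pair_measureI[of "UNIV :: 'b set" lborel N lborel] N unfolding lborel_prod by simp
  ultimately show ?thesis by (auto simp: lborel_prod null_sets_def)
qed

lemma lborel_distr_reflect: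
  fixes x :: "'a::euclidean_space"
  shows "distr lborel borel (\<lambda>y. x - y) = lborel"
  by (subst (2) lborel_affine[of "-1" x]) (auto simp: density_1 one_ennreal_def[symmetric])

lemma nn_integral_lborel_reflect:
  fixes x :: "'a::euclidean_space"
  assumes [measurable]: "f \<in> borel_measurable borel"
  shows "(\<integral>\<^sup>+ y. f (x - y) \<partial>lborel) = (\<integral>\<^sup>+ y. f y \<partial>lborel)"
  by (subst (2) lborel_distr_reflect[of x, symmetric]) (auto simp: nn_integral_distr)

lemma nn_integral_lborel_translate:
  fixes x :: "'a::euclidean_space"
  assumes [measurable]: "f \<in> borel_measurable borel"
  shows "(\<integral>\<^sup>+ y. f (y - x) \<partial>lborel) = (\<integral>\<^sup>+ y. f y \<partial>lborel)"
  by (subst (2) lborel_distr_plus[of "-x", symmetric]) (auto simp: nn_integral_distr)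

text \<open>
  By Tonelli: the section of the preimage at \<open>x\<close> is a reflected translate of \<open>N\<close>.
\<close>

lemma null_sets_vimage_diff:
  fixes N :: "'a::euclidean_space set"
  assumes "N \<in> null_sets lborel"
  shows "(\<lambda>z :: 'a \<times> 'a. fst z - snd z) -` N \<in> null_sets lborel"
proof -
  have N[measurable]: "N \<in> sets borel" and N0: "emeasure lborel N = 0" using assms by auto
  let ?f = "\<lambda>z :: 'a \<times> 'a. indicator N (fst z - snd z) :: ennreal"
  have f[measurable]: "?f \<in> borel_measurable (borel \<Otimes>\<^sub>M borel)" by measurable
  have "(\<integral>\<^sup>+ z. ?f z \<partial>lborel) = (\<integral>\<^sup>+ x. \<integral>\<^sup>+ y. ?f (x, y) \<partial>lborel \<partial>lborel)"
    using f by (subst lborel.nn_integral_fst) (auto simp: lborel_prod borel_prod)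
  also have "\<dots> = (\<integral>\<^sup>+ x. \<integral>\<^sup>+ y. indicator N y \<partial>lborel \<partial>(lborel :: 'a measure))"
    using nn_integral_lborel_reflect[of "indicator N"] by simp
  also have "\<dots> = 0" using N0 by simp
  finally have "(\<integral>\<^sup>+ z. indicator ((\<lambda>z :: 'a \<times> 'a. fst z - snd z) -` N) z \<partial>lborel) = (0::ennreal)"
    by (simp add: indicator_def of_bool_def vimage_def cong: if_cong)
  moreover have "(\<lambda>z :: 'a \<times> 'a. fst z - snd z) -` N \<in> sets lborel"
    using measurable_sets_borel[of "\<lambda>z :: 'a \<times> 'a. fst z - snd z" borel N] N
    by (simp add: borel_prod[symmetric])
  ultimately show ?thesis by (simp add: null_sets_def)
qed

lemma AE_lebesgue_fst:
  assumes "AE x in lebesgue. P x"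
  shows "AE z in (lebesgue :: ('a::euclidean_space \<times> 'b::euclidean_space) measure). P (fst z)"
  by (rule AE_lebesgue_comp[OF _ null_sets_vimage_fst assms])
    (auto intro!: borel_measurable_continuous_onI continuous_intros)

lemma AE_lebesgue_snd:
  assumes "AE x in lebesgue. P x"
  shows "AE z in (lebesgue :: ('b::euclidean_space \<times> 'a::euclidean_space) measure). P (snd z)"
  by (rule AE_lebesgue_comp[OF _ null_sets_vimage_snd assms])
    (auto intro!: borel_measurable_continuous_onI continuous_intros)

lemma AE_lebesgue_diff:
  assumes "AE x in lebesgue. P x"
  shows "AE z in (lebesgue :: ('a::euclidean_space \<times> 'a) measure). P (fst z - snd z)"
  by (rule AE_lebesgue_comp[OF _ null_sets_vimage_diff assms])
    (auto intro!: borel_measurable_continuous_onI continuous_intros)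

lemma borel_measurable_lebesgue_fst:
  fixes f :: "'a::euclidean_space \<Rightarrow> real"
  assumes "f \<in> borel_measurable lebesgue"
  shows "(\<lambda>z :: 'a \<times> 'b::euclidean_space. f (fst z)) \<in> borel_measurable lebesgue"
  by (rule borel_measurable_lebesgue_comp[OF _ null_sets_vimage_fst assms])
    (auto intro!: borel_measurable_continuous_onI continuous_intros)

lemma borel_measurable_lebesgue_snd:
  fixes f :: "'a::euclidean_space \<Rightarrow> real"
  assumes "f \<in> borel_measurable lebesgue"
  shows "(\<lambda>z :: 'b::euclidean_space \<times> 'a. f (snd z)) \<in> borel_measurable lebesgue"
  by (rule borel_measurable_lebesgue_comp[OF _ null_sets_vimage_snd assms])
    (auto intro!: borel_measurable_continuous_onI continuous_intros)

lemma borel_measurable_lebesgue_diff: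
  fixes f :: "'a::euclidean_space \<Rightarrow> real"
  assumes "f \<in> borel_measurable lebesgue"
  shows "(\<lambda>z :: 'a \<times> 'a. f (fst z - snd z)) \<in> borel_measurable lebesgue"
  by (rule borel_measurable_lebesgue_comp[OF _ null_sets_vimage_diff assms])
    (auto intro!: borel_measurable_continuous_onI continuous_intros)

section \<open>Poincare and Sobolev inequalities for the Gagliardo seminorm\<close>

abbreviation square_integral :: "'a measure \<Rightarrow> ('a \<Rightarrow> real) \<Rightarrow> ennreal" where
  "square_integral M u \<equiv> \<integral>\<^sup>+ x. ennreal ((u x)\<^sup>2) \<partial>M"

abbreviation power_integral :: "real \<Rightarrow> 'a measure \<Rightarrow> ('a \<Rightarrow> real) \<Rightarrow> ennreal" where
  "power_integral q M u \<equiv> \<integral>\<^sup>+ x. ennreal (\<bar>u x\<bar> powr q) \<partial>M"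

text \<open>
  The squared Gagliardo seminorm is kept as an iterated integral, because the estimates below are
  pointwise in the outer variable.
\<close>

definition gagliardo_density :: "real \<Rightarrow> ('a::euclidean_space \<Rightarrow> real) \<Rightarrow> 'a \<Rightarrow> ennreal" where
  "gagliardo_density s u x =
     (\<integral>\<^sup>+ y. ennreal ((u x - u y)\<^sup>2 * norm (x - y) powr (- (real DIM('a) + 2 * s))) \<partial>lborel)"

definition gagliardo :: "real \<Rightarrow> ('a::euclidean_space \<Rightarrow> real) \<Rightarrow> ennreal" where
  "gagliardo s u = (\<integral>\<^sup>+ x. gagliardo_density s u x \<partial>lborel)"

lemma borel_measurable_gagliardo_density [measurable]:
  assumes [measurable]: "u \<in> borel_measurable borel"
  shows "gagliardo_density s u \<in> borel_measurable borel"
  unfolding gagliardo_density_def by measurable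

text \<open>
  The constant produced in the level set inequality by a ball whose volume is \<open>2 * m\<close>.
\<close>

definition level_const :: "real \<Rightarrow> 'a::euclidean_space itself \<Rightarrow> real" where
  "level_const s _ = 4 * (2 / unit_ball_vol (real DIM('a))) powr (1 + 2 * s / real DIM('a))"

lemma level_const_pos: "level_const s TYPE('a::euclidean_space) > 0"
proof -
  have "unit_ball_vol (real DIM('a)) \<noteq> 0"
    using unit_ball_vol_pos[of "real DIM('a)"] by (metis less_irrefl of_nat_0_le_iff)
  then show ?thesis by (simp add: level_const_def)
qed

text \<open>
  A ball around \<open>x\<close> of volume \<open>2 * m\<close> contains a set of measure at least \<open>m\<close> on which \<open>\<bar>u\<bar>\<close> is at
  most half of \<open>\<bar>u x\<bar>\<close>. On that set the difference quotient is large, and its integral is part of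
  the Gagliardo density. This one inequality gives both the Poincare and the Sobolev inequality,
  according to how the measure of the level set is bounded.
\<close>

lemma level_set_inequality:
  fixes u :: "'a::euclidean_space \<Rightarrow> real"
  assumes [measurable]: "u \<in> borel_measurable borel" and s: "s > 0" and m: "m > 0"
    and level: "emeasure lborel {y. \<bar>u y\<bar> > \<bar>u x\<bar> / 2} \<le> ennreal m" and ux: "u x \<noteq> 0"
  shows "ennreal ((u x)\<^sup>2) \<le> ennreal (level_const s TYPE('a) * m powr (2 * s / real DIM('a))) * gagliardo_density s u x"
proof -
  define n where "n = real DIM('a)"
  define w where "w = unit_ball_vol n"
  \<comment> \<open>the ball of radius \<open>r\<close> has volume \<open>2 * m\<close>\<close>
  define r where "r = (2 * m / w) powr (1 / n)"
  have n: "n > 0" by (simp add: n_def)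
  have w: "w > 0" unfolding w_def by (simp add: n_def)
  have r: "r > 0" unfolding r_def using w m by simp
  have rn: "r ^ DIM('a) = 2 * m / w"
  proof -
    have "r ^ DIM('a) = r powr n" using r by (simp add: powr_realpow n_def)
    also have "\<dots> = 2 * m / w" unfolding r_def powr_powr using n w m by simp
    finally show ?thesis .
  qed
  define A where "A = {y. \<bar>u y\<bar> > \<bar>u x\<bar> / 2}"
  define E where "E = ball x r - A"
  have A[measurable]: "A \<in> sets borel" unfolding A_def by measurable
  have E[measurable]: "E \<in> sets borel" unfolding E_def by measurable
  have "ennreal (2 * m) = emeasure lborel (ball x r)"
    using r rn w by (simp add: emeasure_ball w_def[symmetric] n_def[symmetric])
  also have "\<dots> \<le> emeasure lborel (A \<union> E)"
    by (intro emeasure_mono) (auto simp: E_def)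
  also have "\<dots> \<le> emeasure lborel A + emeasure lborel E"
    by (intro emeasure_subadditive) auto
  also have "\<dots> \<le> ennreal m + emeasure lborel E"
    using level by (intro add_right_mono) (simp add: A_def)
  finally have "ennreal m + ennreal m \<le> ennreal m + emeasure lborel E"
    using m by (simp flip: ennreal_plus)
  then have Em: "ennreal m \<le> emeasure lborel E"
    by (simp add: ennreal_add_left_cancel_le)
  define c where "c = (u x)\<^sup>2 / 4 * r powr (- (n + 2 * s))"
  have c0: "c \<ge> 0" by (simp add: c_def)
  have pt: "ennreal c * indicator E y
      \<le> ennreal ((u x - u y)\<^sup>2 * norm (x - y) powr (- (real DIM('a) + 2 * s)))" for y
  proof (cases "y \<in> E")
    case True
    then have y: "norm (x - y) < r" "\<bar>u y\<bar> \<le> \<bar>u x\<bar> / 2" "y \<noteq> x"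
      using ux by (auto simp: E_def A_def dist_norm)
    have "\<bar>u x\<bar> / 2 \<le> \<bar>u x - u y\<bar>" using y(2) by linarith
    then have "(\<bar>u x\<bar> / 2)\<^sup>2 \<le> \<bar>u x - u y\<bar>\<^sup>2"
      by (intro power_mono) auto
    then have 1: "(u x)\<^sup>2 / 4 \<le> (u x - u y)\<^sup>2" by (simp add: power_divide)
    have 2: "r powr (- (n + 2 * s)) \<le> norm (x - y) powr (- (n + 2 * s))"
      using y n s by (intro powr_mono2') auto
    show ?thesis using True mult_mono[OF 1 2] by (simp add: c_def n_def ennreal_leI)
  qed simp
  have "ennreal c * ennreal m \<le> ennreal c * emeasure lborel E"
    using Em by (rule mult_left_mono) simp
  also have "\<dots> = (\<integral>\<^sup>+ y. ennreal c * indicator E y \<partial>lborel)"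
    by (simp add: nn_integral_cmult_indicator)
  also have "\<dots> \<le> gagliardo_density s u x"
    unfolding gagliardo_density_def by (intro nn_integral_mono pt)
  finally have main: "ennreal (c * m) \<le> gagliardo_density s u x"
    using c0 m by (simp add: ennreal_mult)
  have "r powr (- (n + 2 * s)) = (2 * m / w) powr (- (1 + 2 * s / n))"
  proof -
    have "1 / n * (- (n + 2 * s)) = - (1 + 2 * s / n)" using n by (simp add: field_simps)
    then show ?thesis unfolding r_def powr_powr by simp
  qed
  also have "\<dots> = (2 / w) powr (- (1 + 2 * s / n)) * m powr (- (1 + 2 * s / n))"
    using w m by (simp flip: powr_mult)
  finally have rp: "r powr (- (n + 2 * s)) = (2 / w) powr (- (1 + 2 * s / n)) * m powr (- (1 + 2 * s / n))" .
  have a: "(2 / w) powr (1 + 2 * s / n) * (2 / w) powr (- (1 + 2 * s / n)) = 1"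
    using w by (simp flip: powr_add)
  have b: "m powr (2 * s / n) * m powr (- (1 + 2 * s / n)) * m = 1"
  proof -
    have "m powr (2 * s / n) * m powr (- (1 + 2 * s / n)) * m powr 1 = 1"
      using m unfolding powr_add[symmetric] by simp
    then show ?thesis using m by simp
  qed
  have "level_const s TYPE('a) * m powr (2 * s / n) * (c * m)
    = (u x)\<^sup>2 * ((2 / w) powr (1 + 2 * s / n) * (2 / w) powr (- (1 + 2 * s / n)))
       * (m powr (2 * s / n) * m powr (- (1 + 2 * s / n)) * m)"
    unfolding c_def rp level_const_def by (simp add: w_def n_def)
  also have "\<dots> = (u x)\<^sup>2" unfolding a b by simp
  finally have eq: "(u x)\<^sup>2 = level_const s TYPE('a) * m powr (2 * s / n) * (c * m)" ..
  show ?thesis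
    unfolding eq using main level_const_pos[of s, where 'a='a] c0 m
    by (subst ennreal_mult) (auto simp: n_def intro!: mult_left_mono mult_nonneg_nonneg)
qed

text \<open>
  Here \<open>m\<close> bounds the measure of the support, so the level set inequality holds with the same
  constant at all points and can be integrated.
\<close>

lemma gagliardo_poincare:
  fixes u :: "'a::euclidean_space \<Rightarrow> real"
  assumes [measurable]: "u \<in> borel_measurable borel" and s: "s > 0" and m: "m > 0"
    and supp: "emeasure lborel {y. u y \<noteq> 0} \<le> ennreal m"
  shows "square_integral lborel u \<le> ennreal (level_const s TYPE('a) * m powr (2 * s / real DIM('a))) * gagliardo s u"
proof -
  have pt: "ennreal ((u x)\<^sup>2) \<le> ennreal (level_const s TYPE('a) * m powr (2 * s / real DIM('a))) * gagliardo_density s u x" for x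
  proof (cases "u x = 0")
    case False
    have "emeasure lborel {y. \<bar>u y\<bar> > \<bar>u x\<bar> / 2} \<le> emeasure lborel {y. u y \<noteq> 0}"
      by (intro emeasure_mono) auto
    then show ?thesis using level_set_inequality[of u s m x] s m False supp by force
  qed simp
  show ?thesis unfolding gagliardo_def
    by (subst nn_integral_cmult[symmetric]) (auto intro!: nn_integral_mono pt)
qed

text \<open>
  Chebyshev's inequality bounds the level set by \<open>Y * (2 / \<bar>u x\<bar>) powr q\<close>. The negative power of
  \<open>\<bar>u x\<bar>\<close>, moved to the other side of the level set inequality, is the gain in integrability.
\<close>

lemma gagliardo_sobolev_step:
  fixes u :: "'a::euclidean_space \<Rightarrow> real"
  assumes [measurable]: "u \<in> borel_measurable borel" and s: "s > 0" and Y: "Y > 0" and q: "q > 0"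
    and le: "power_integral q lborel u \<le> ennreal Y"
  shows "power_integral (2 + 2 * s / real DIM('a) * q) lborel u
    \<le> ennreal (level_const s TYPE('a) * 2 powr (2 * s / real DIM('a) * q) * Y powr (2 * s / real DIM('a))) * gagliardo s u"
proof -
  define e where "e = 2 * s / real DIM('a)"
  have e: "e > 0" using s by (simp add: e_def)
  have pt: "ennreal (\<bar>u x\<bar> powr (2 + e * q))
    \<le> ennreal (level_const s TYPE('a) * 2 powr (e * q) * Y powr e) * gagliardo_density s u x" for x
  proof (cases "u x = 0")
    case False
    define h where "h = \<bar>u x\<bar>"
    have h: "h > 0" using False by (simp add: h_def)
    define m where "m = Y * (2 / h) powr q"
    have m: "m > 0" using Y h by (simp add: m_def)
    have "emeasure lborel {y. \<bar>u y\<bar> > \<bar>u x\<bar> / 2}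
        \<le> emeasure lborel {y\<in>space lborel. 1 \<le> ennreal ((2 / h) powr q) * ennreal (\<bar>u y\<bar> powr q)}"
    proof (intro emeasure_mono subsetI)
      fix y assume "y \<in> {y. \<bar>u y\<bar> > \<bar>u x\<bar> / 2}"
      then have "1 \<le> 2 / h * \<bar>u y\<bar>" using h by (simp add: h_def field_simps)
      then have "1 powr q \<le> (2 / h * \<bar>u y\<bar>) powr q" using q by (intro powr_mono2) auto
      then have "1 \<le> (2 / h) powr q * \<bar>u y\<bar> powr q"
        using h powr_mult[of "2 / h" "\<bar>u y\<bar>" q] by (metis powr_one_eq_one)
      then show "y \<in> {y\<in>space lborel. 1 \<le> ennreal ((2 / h) powr q) * ennreal (\<bar>u y\<bar> powr q)}"
        by (simp flip: ennreal_mult)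
    qed measurable
    also have "\<dots> \<le> ennreal ((2 / h) powr q) * (\<integral>\<^sup>+ y. ennreal (\<bar>u y\<bar> powr q) * indicator (space lborel) y \<partial>lborel)"
      by (intro nn_integral_Markov_inequality) auto
    also have "\<dots> \<le> ennreal ((2 / h) powr q) * ennreal Y"
      using le by (intro mult_left_mono) auto
    also have "\<dots> = ennreal m" using Y by (simp add: m_def mult.commute flip: ennreal_mult)
    finally have "ennreal ((u x)\<^sup>2) \<le> ennreal (level_const s TYPE('a) * m powr e) * gagliardo_density s u x"
      unfolding e_def using s m False by (intro level_set_inequality) auto
    then have "ennreal (h powr (e * q)) * ennreal ((u x)\<^sup>2)
        \<le> ennreal (h powr (e * q)) * (ennreal (level_const s TYPE('a) * m powr e) * gagliardo_density s u x)"
      by (rule mult_left_mono) simp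
    also have "\<dots> = ennreal (level_const s TYPE('a) * 2 powr (e * q) * Y powr e) * gagliardo_density s u x"
    proof -
      have "m powr e = Y powr e * 2 powr (e * q) / h powr (e * q)"
        unfolding m_def using h Y by (simp add: powr_mult powr_divide powr_powr mult.commute)
      then have "h powr (e * q) * (level_const s TYPE('a) * m powr e) = level_const s TYPE('a) * 2 powr (e * q) * Y powr e"
        using h by simp
      then show ?thesis
        using level_const_pos[of s, where 'a='a] unfolding \<open>h powr (e * q) * _ = _\<close>[symmetric]
        by (subst ennreal_mult) (auto simp: mult.assoc intro!: mult_nonneg_nonneg)
    qed
    also have "ennreal (h powr (e * q)) * ennreal ((u x)\<^sup>2) = ennreal (\<bar>u x\<bar> powr (2 + e * q))"
    proof -
      have "h powr (e * q) * (u x)\<^sup>2 = \<bar>u x\<bar> powr (2 + e * q)"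
        using False by (simp add: h_def powr_add)
      then show ?thesis by (simp flip: ennreal_mult)
    qed
    finally show ?thesis .
  qed simp
  show ?thesis unfolding gagliardo_def e_def[symmetric]
    by (subst nn_integral_cmult[symmetric]) (auto intro!: nn_integral_mono pt)
qed

text \<open>
  The exponents reached from \<open>2\<close> by iterating the step, with \<open>\<rho> = 2 * s / DIM\<close>. The fixed point
  \<open>2 / (1 - \<rho>)\<close> of the recursion is the critical exponent, and it attracts since \<open>\<rho> < 1\<close>.
\<close>

primrec sobolev_exponent :: "real \<Rightarrow> nat \<Rightarrow> real" where
  "sobolev_exponent \<rho> 0 = 2"
| "sobolev_exponent \<rho> (Suc k) = 2 + \<rho> * sobolev_exponent \<rho> k"

lemma sobolev_exponent_pos: "\<rho> > 0 \<Longrightarrow> sobolev_exponent \<rho> k > 0"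
  by (induction k) (auto intro!: add_pos_nonneg)

lemma sobolev_exponent_eq:
  assumes "\<rho> < 1"
  shows "sobolev_exponent \<rho> k = 2 / (1 - \<rho>) - \<rho> ^ k * (2 / (1 - \<rho>) - 2)"
proof -
  define c where "c = 2 / (1 - \<rho>)"
  have "c * (1 - \<rho>) = 2" using assms by (simp add: c_def divide_eq_eq)
  then have c: "2 = c - \<rho> * c" by (simp add: algebra_simps)
  have "sobolev_exponent \<rho> k = c - \<rho> ^ k * (c - 2)"
  proof (induction k)
    case (Suc k)
    have "sobolev_exponent \<rho> (Suc k) = 2 + \<rho> * (c - \<rho> ^ k * (c - 2))" using Suc by simp
    also have "\<dots> = (2 + \<rho> * c) - \<rho> ^ Suc k * (c - 2)" by (simp add: algebra_simps)
    also have "2 + \<rho> * c = c" using c by linarith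
    finally show ?case .
  qed simp
  then show ?thesis by (simp add: c_def)
qed

lemma sobolev_exponent_exceeds:
  assumes "0 < \<rho>" "\<rho> < 1" "p < 2 / (1 - \<rho>)"
  shows "\<exists>k. p < sobolev_exponent \<rho> k"
proof -
  have "(\<lambda>k. 2 / (1 - \<rho>) - \<rho> ^ k * (2 / (1 - \<rho>) - 2)) \<longlonglongrightarrow> 2 / (1 - \<rho>) - 0 * (2 / (1 - \<rho>) - 2)"
    using assms by (intro tendsto_intros) auto
  then have "sobolev_exponent \<rho> \<longlonglongrightarrow> 2 / (1 - \<rho>)"
    unfolding sobolev_exponent_eq[OF assms(2), abs_def] by simp
  from order_tendstoD(1)[OF this assms(3)] show ?thesis
    by (auto simp: eventually_sequentially)
qed

text \<open>
  The bound is stated with a positive power of \<open>Y\<close> so that, on a set bounded in the Gagliardo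
  seminorm, smallness in \<open>L\<^sup>2\<close> passes to higher exponents.
\<close>

lemma gagliardo_sobolev_iterate:
  assumes s: "s > 0" and M: "M \<ge> 0"
  shows "\<exists>C e. C > 0 \<and> e > 0 \<and> (\<forall>u :: 'a::euclidean_space \<Rightarrow> real. \<forall>Y. u \<in> borel_measurable borel \<longrightarrow> Y > 0 \<longrightarrow>
    gagliardo s u \<le> ennreal M \<longrightarrow> square_integral lborel u \<le> ennreal Y \<longrightarrow>
    (\<integral>\<^sup>+ x. ennreal (\<bar>u x\<bar> powr sobolev_exponent (2 * s / real DIM('a)) k) \<partial>lborel) \<le> ennreal (C * Y powr e))"
proof (induction k)
  case 0
  have *: "\<bar>x\<bar> powr 2 = x\<^sup>2" for x :: real by (cases "x = 0") auto
  show ?case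
    by (rule exI[of _ 1], rule exI[of _ 1]) (simp add: *)
next
  case (Suc k)
  define \<rho> where "\<rho> = 2 * s / real DIM('a)"
  have \<rho>: "\<rho> > 0" using s by (simp add: \<rho>_def)
  define q where "q = sobolev_exponent \<rho> k"
  have q: "q > 0" unfolding q_def by (rule sobolev_exponent_pos[OF \<rho>])
  from Suc obtain C e where C: "C > 0" and e: "e > 0"
    and IH: "\<And>u :: 'a \<Rightarrow> real. \<And>Y. u \<in> borel_measurable borel \<Longrightarrow> Y > 0 \<Longrightarrow>
      gagliardo s u \<le> ennreal M \<Longrightarrow> square_integral lborel u \<le> ennreal Y \<Longrightarrow>
      power_integral q lborel u \<le> ennreal (C * Y powr e)"
    unfolding \<rho>_def q_def by blast
  define L where "L = level_const s TYPE('a) * 2 powr (\<rho> * q)"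
  have L: "L > 0" using level_const_pos[of s, where 'a='a] by (simp add: L_def)
  show ?case
  proof (rule exI[of _ "L * C powr \<rho> * (M + 1)"], rule exI[of _ "e * \<rho>"], intro conjI allI impI)
    show "0 < L * C powr \<rho> * (M + 1)" "0 < e * \<rho>" using L C M e \<rho> by auto
    fix u :: "'a \<Rightarrow> real" and Y :: real
    assume u: "u \<in> borel_measurable borel" "0 < Y" "gagliardo s u \<le> ennreal M" "square_integral lborel u \<le> ennreal Y"
    have "power_integral (2 + \<rho> * q) lborel u \<le> ennreal (L * (C * Y powr e) powr \<rho>) * gagliardo s u"
      using gagliardo_sobolev_step[OF u(1) s _ q IH[OF u]] C u(2) by (simp add: \<rho>_def L_def)
    also have "\<dots> \<le> ennreal (L * (C * Y powr e) powr \<rho>) * ennreal M"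
      using u(3) by (rule mult_left_mono) simp
    also have "\<dots> \<le> ennreal (L * (C * Y powr e) powr \<rho> * (M + 1))"
      using L M by (subst ennreal_mult[symmetric]) (auto intro!: ennreal_leI mult_left_mono)
    also have "L * (C * Y powr e) powr \<rho> * (M + 1) = L * C powr \<rho> * (M + 1) * Y powr (e * \<rho>)"
      using C u(2) by (simp add: powr_mult powr_powr)
    finally show "(\<integral>\<^sup>+ x. ennreal (\<bar>u x\<bar> powr sobolev_exponent (2 * s / real DIM('a)) (Suc k)) \<partial>lborel)
      \<le> ennreal (L * C powr \<rho> * (M + 1) * Y powr (e * \<rho>))"
      by (simp add: \<rho>_def q_def)
  qed
qed

text \<open>
  An exponent \<open>q > p\<close> is reached after finitely many steps, and then
  \<open>\<bar>t\<bar> powr p \<le> t\<^sup>2 + \<bar>t\<bar> powr q\<close> makes interpolation superfluous.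
\<close>

lemma gagliardo_sobolev:
  assumes s: "s > 0" "2 * s < real DIM('a)" and M: "M \<ge> 0"
    and p: "2 \<le> p" "p < 2 * real DIM('a) / (real DIM('a) - 2 * s)"
  shows "\<exists>C e. C > 0 \<and> e > 0 \<and> (\<forall>u :: 'a::euclidean_space \<Rightarrow> real. \<forall>Y. u \<in> borel_measurable borel \<longrightarrow> Y > 0 \<longrightarrow>
    gagliardo s u \<le> ennreal M \<longrightarrow> square_integral lborel u \<le> ennreal Y \<longrightarrow>
    power_integral p lborel u \<le> ennreal (Y + C * Y powr e))"
proof -
  define \<rho> where "\<rho> = 2 * s / real DIM('a)"
  have "2 / (1 - \<rho>) = 2 * real DIM('a) / (real DIM('a) - 2 * s)"
    using s by (simp add: \<rho>_def field_simps)
  then obtain k where k: "p < sobolev_exponent \<rho> k"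
    using sobolev_exponent_exceeds[of \<rho> p] s p by (auto simp: \<rho>_def)
  define q where "q = sobolev_exponent \<rho> k"
  obtain C e where C: "C > 0" and e: "e > 0"
    and *: "\<And>u :: 'a \<Rightarrow> real. \<And>Y. u \<in> borel_measurable borel \<Longrightarrow> Y > 0 \<Longrightarrow>
      gagliardo s u \<le> ennreal M \<Longrightarrow> square_integral lborel u \<le> ennreal Y \<Longrightarrow>
      power_integral q lborel u \<le> ennreal (C * Y powr e)"
    using gagliardo_sobolev_iterate[OF s(1) M, of k, where 'a='a] unfolding \<rho>_def q_def by blast
  have pt: "\<bar>x\<bar> powr p \<le> x\<^sup>2 + \<bar>x\<bar> powr q" for x :: real
  proof (cases "\<bar>x\<bar> \<le> 1")
    case True
    have "\<bar>x\<bar> powr p \<le> \<bar>x\<bar> powr 2" using True p by (intro powr_mono') auto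
    also have "\<dots> = x\<^sup>2" by (cases "x = 0") auto
    finally show ?thesis by (simp add: add_increasing2)
  next
    case False
    then show ?thesis using k powr_mono[of p q "\<bar>x\<bar>"] by (simp add: q_def add_increasing)
  qed
  show ?thesis
  proof (rule exI[of _ C], rule exI[of _ e], intro conjI allI impI)
    fix u :: "'a \<Rightarrow> real" and Y :: real
    assume u: "u \<in> borel_measurable borel" "0 < Y" "gagliardo s u \<le> ennreal M" "square_integral lborel u \<le> ennreal Y"
    note [measurable] = u(1)
    have "power_integral p lborel u \<le> (\<integral>\<^sup>+ x. ennreal ((u x)\<^sup>2) + ennreal (\<bar>u x\<bar> powr q) \<partial>lborel)"
      by (intro nn_integral_mono) (simp add: pt ennreal_leI flip: ennreal_plus)
    also have "\<dots> = square_integral lborel u + power_integral q lborel u"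
      by (rule nn_integral_add) auto
    also have "\<dots> \<le> ennreal Y + ennreal (C * Y powr e)"
      using u(4) *[OF u] by (rule add_mono)
    finally show "power_integral p lborel u \<le> ennreal (Y + C * Y powr e)"
      using u(2) C by simp
  qed (use C e in auto)
qed

section \<open>Approximation by cell averages\<close>

text \<open>
  Half-open cubes of side \<open>h\<close>, so that cells with different indices are disjoint. An index is
  required to be extensional in \<open>grid\<close>, since only its values on the basis matter.
\<close>

definition cell :: "real \<Rightarrow> ('a::euclidean_space \<Rightarrow> int) \<Rightarrow> 'a set" where
  "cell h f = {x. \<forall>b\<in>Basis. h * of_int (f b) \<le> x \<bullet> b \<and> x \<bullet> b < h * (of_int (f b) + 1)}"

definition grid :: "nat \<Rightarrow> ('a::euclidean_space \<Rightarrow> int) set" where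
  "grid M = Basis \<rightarrow>\<^sub>E {- int M..<int M}"

lemma finite_grid: "finite (grid M :: ('a::euclidean_space \<Rightarrow> int) set)"
  unfolding grid_def by (intro finite_PiE) auto

lemma borel_cell [measurable]: "cell h f \<in> sets borel"
proof -
  have "cell h f = (\<Inter>b\<in>Basis. {x. h * of_int (f b) \<le> x \<bullet> b \<and> x \<bullet> b < h * (of_int (f b) + 1)})"
    by (auto simp: cell_def)
  also have "\<dots> \<in> sets borel"
    by (intro sets.finite_INT) auto
  finally show ?thesis .
qed

lemma emeasure_cell:
  assumes "h > 0"
  shows "emeasure lborel (cell h (f :: 'a::euclidean_space \<Rightarrow> int)) = ennreal (h ^ DIM('a))"
proof -
  define l where "l = (\<Sum>b\<in>Basis. (h * of_int (f b)) *\<^sub>R b)"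
  define r where "r = (\<Sum>b\<in>Basis. (h * (of_int (f b) + 1)) *\<^sub>R b)"
  have lb: "l \<bullet> b = h * of_int (f b)" "r \<bullet> b = h * (of_int (f b) + 1)" if "b \<in> Basis" for b
    using that by (simp_all add: l_def r_def)
  have rl: "(\<Prod>b\<in>Basis. (r - l) \<bullet> b) = h ^ DIM('a)"
  proof -
    have "(\<Prod>b\<in>Basis. (r - l) \<bullet> b) = (\<Prod>b\<in>(Basis::'a set). h)"
      by (rule prod.cong) (auto simp: inner_diff_left lb algebra_simps)
    then show ?thesis by simp
  qed
  have le: "l \<bullet> b \<le> r \<bullet> b" if "b \<in> Basis" for b using assms that by (simp add: lb)
  have "emeasure lborel (box l r) \<le> emeasure lborel (cell h f)"
    by (intro emeasure_mono) (auto simp: cell_def box_def lb intro: less_imp_le)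
  moreover have "emeasure lborel (cell h f) \<le> emeasure lborel (cbox l r)"
    by (intro emeasure_mono) (auto simp: cell_def cbox_def lb intro: less_imp_le)
  ultimately show ?thesis
    using le by (simp add: emeasure_lborel_box emeasure_lborel_cbox rl)
qed

lemma cell_index:
  assumes "h > 0" "x \<in> cell h f" "b \<in> Basis"
  shows "f b = \<lfloor>x \<bullet> b / h\<rfloor>"
  using assms by (intro floor_unique[symmetric]) (auto simp: cell_def field_simps)

lemma disjoint_cells:
  assumes "h > 0"
  shows "disjoint_family_on (cell h) (grid M :: ('a::euclidean_space \<Rightarrow> int) set)"
  unfolding disjoint_family_on_def
proof (intro ballI impI)
  fix f g :: "'a \<Rightarrow> int" assume fg: "f \<in> grid M" "g \<in> grid M" "f \<noteq> g"
  have "f = g" if "x \<in> cell h f" "x \<in> cell h g" for x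
    using fg(1,2) cell_index[OF assms that(1)] cell_index[OF assms that(2)]
    unfolding grid_def by (intro PiE_ext) auto
  with fg show "cell h f \<inter> cell h g = {}" by auto
qed

lemma cells_cover:
  fixes x :: "'a::euclidean_space"
  assumes "h > 0" "norm x < h * real M"
  shows "\<exists>f\<in>grid M. x \<in> cell h f"
proof -
  define f where "f = restrict (\<lambda>b. \<lfloor>x \<bullet> b / h\<rfloor>) (Basis :: 'a set)"
  have "\<lfloor>x \<bullet> b / h\<rfloor> \<in> {- int M..<int M}" if b: "b \<in> Basis" for b
  proof -
    have "\<bar>x \<bullet> b\<bar> < h * real M" using Basis_le_norm[OF b, of x] assms by linarith
    then have "- real M < x \<bullet> b / h" "x \<bullet> b / h < real M" using assms by (auto simp: field_simps abs_less_iff)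
    then show ?thesis by (auto simp: le_floor_iff floor_less_iff)
  qed
  then have "f \<in> grid M" by (auto simp: grid_def f_def)
  moreover have "x \<in> cell h f"
    using assms(1) by (auto simp: cell_def f_def mult.commute[of h] pos_divide_less_eq[symmetric] pos_le_divide_eq[symmetric])
  ultimately show ?thesis by blast
qed

lemma norm_diff_cell:
  fixes x y :: "'a::euclidean_space"
  assumes "x \<in> cell h f" "y \<in> cell h f"
  shows "norm (x - y) \<le> real DIM('a) * h"
proof -
  have "norm (x - y) \<le> (\<Sum>b\<in>Basis. \<bar>(x - y) \<bullet> b\<bar>)" by (rule norm_le_l1)
  also have "\<dots> \<le> (\<Sum>b\<in>(Basis :: 'a set). h)"
  proof (rule sum_mono)
    fix b :: 'a assume b: "b \<in> Basis"
    show "\<bar>(x - y) \<bullet> b\<bar> \<le> h"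
      using assms b by (auto simp: cell_def inner_diff_left algebra_simps abs_le_iff dest!: bspec[where x=b])
  qed
  finally show ?thesis by simp
qed

text \<open>
  Expanding the square gives the exact variance formula, which compares a function with its mean
  without the Cauchy-Schwarz inequality.
\<close>

lemma (in finite_measure) variance_identity:
  fixes u :: "'a \<Rightarrow> real"
  assumes [measurable]: "u \<in> borel_measurable M" and u2: "integrable M (\<lambda>x. (u x)\<^sup>2)"
  shows "integrable M u"
    and "(\<integral>\<^sup>+ x. \<integral>\<^sup>+ y. ennreal ((u x - u y)\<^sup>2) \<partial>M \<partial>M)
      = ennreal (2 * (measure M (space M) * (\<integral>x. (u x)\<^sup>2 \<partial>M) - (\<integral>x. u x \<partial>M)\<^sup>2))"
proof -
  define v where "v = measure M (space M)"
  define S where "S = (\<integral>x. (u x)\<^sup>2 \<partial>M)"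
  define I where "I = (\<integral>x. u x \<partial>M)"
  show u1: "integrable M u"
  proof (rule Bochner_Integration.integrable_bound)
    show "integrable M (\<lambda>x. 1 + (u x)\<^sup>2)" using u2 by (intro Bochner_Integration.integrable_add) auto
    have "\<bar>t\<bar> \<le> 1 + t\<^sup>2" for t :: real
      using zero_le_power2[of "\<bar>t\<bar> - 1"] by (simp add: power2_diff)
    then show "AE x in M. norm (u x) \<le> norm (1 + (u x)\<^sup>2)" by (simp add: add_nonneg_nonneg)
  qed simp
  have exp: "(a - u y)\<^sup>2 = a\<^sup>2 - 2 * a * u y + (u y)\<^sup>2" for a y by (simp add: power2_eq_square algebra_simps)
  have int: "integrable M (\<lambda>y. (a - u y)\<^sup>2)" for a
    unfolding exp using u1 u2 by (intro Bochner_Integration.integrable_add Bochner_Integration.integrable_diff) auto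
  have val: "(\<integral>y. (a - u y)\<^sup>2 \<partial>M) = v * a\<^sup>2 - 2 * a * I + S" for a
    unfolding exp using u1 u2 by (simp add: v_def I_def S_def)
  have inner: "(\<integral>\<^sup>+ y. ennreal ((a - u y)\<^sup>2) \<partial>M) = ennreal (v * a\<^sup>2 - 2 * a * I + S)" for a
    using nn_integral_eq_integral[OF int[of a]] by (simp add: val)
  have nonneg: "0 \<le> v * a\<^sup>2 - 2 * a * I + S" for a
    unfolding val[symmetric] by (rule integral_nonneg_AE) simp
  have "(\<integral>\<^sup>+ x. \<integral>\<^sup>+ y. ennreal ((u x - u y)\<^sup>2) \<partial>M \<partial>M) = (\<integral>\<^sup>+ x. ennreal (v * (u x)\<^sup>2 - 2 * u x * I + S) \<partial>M)"
    by (simp add: inner)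
  also have "\<dots> = ennreal (\<integral>x. v * (u x)\<^sup>2 - 2 * u x * I + S \<partial>M)"
    using u1 u2 nonneg by (intro nn_integral_eq_integral Bochner_Integration.integrable_add Bochner_Integration.integrable_diff) auto
  also have "(\<integral>x. v * (u x)\<^sup>2 - 2 * u x * I + S \<partial>M) = v * S - 2 * I * I + v * S"
    using u1 u2 by (simp add: S_def[symmetric] I_def[symmetric] v_def[symmetric])
  also have "\<dots> = 2 * (v * S - I\<^sup>2)" by (simp add: power2_eq_square)
  finally show "(\<integral>\<^sup>+ x. \<integral>\<^sup>+ y. ennreal ((u x - u y)\<^sup>2) \<partial>M \<partial>M)
      = ennreal (2 * (measure M (space M) * (\<integral>x. (u x)\<^sup>2 \<partial>M) - (\<integral>x. u x \<partial>M)\<^sup>2))"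
    by (simp add: v_def S_def I_def)
qed

text \<open>
  In a cell \<open>norm (x - y)\<close> is at most \<open>DIM * h\<close>, so the kernel is bounded below there and the variance
  of \<open>u\<close> on the cell is controlled by the Gagliardo density.
\<close>

lemma cell_poincare:
  fixes u :: "'a::euclidean_space \<Rightarrow> real"
  assumes [measurable]: "u \<in> borel_measurable borel" and h: "h > 0" and s: "s > 0"
    and fin: "integrable lborel (\<lambda>x. (u x)\<^sup>2)"
  shows "(\<integral>\<^sup>+ x. ennreal ((u x)\<^sup>2) * indicator (cell h f) x \<partial>lborel)
    \<le> ennreal ((LINT x:cell h f|lborel. u x)\<^sup>2 / h ^ DIM('a))
      + ennreal (1 / 2 / h ^ DIM('a) * (real DIM('a) * h) powr (real DIM('a) + 2 * s))
        * (\<integral>\<^sup>+ x. gagliardo_density s u x * indicator (cell h f) x \<partial>lborel)"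
proof -
  let ?Q = "cell h f"
  define M where "M = restrict_space lborel ?Q"
  define v where "v = h ^ DIM('a)"
  have v: "v > 0" using h by (simp add: v_def)
  have [simp]: "space M = ?Q" by (simp add: M_def space_restrict_space)
  have sM: "emeasure M (space M) = ennreal v"
    unfolding M_def by (subst emeasure_restrict_space) (auto simp: space_restrict_space emeasure_cell[OF h] v_def)
  interpret finite_measure M
    by standard (simp add: sM del: \<open>space M = ?Q\<close>)
  have [measurable]: "u \<in> borel_measurable M"
    unfolding M_def by (intro measurable_restrict_space1) simp
  have mM: "measure M (space M) = v" using sM v by (simp add: measure_def)
  have u2: "integrable M (\<lambda>x. (u x)\<^sup>2)"
    unfolding M_def by (subst integrable_restrict_space) (use integrable_mult_indicator[OF _ fin, of "cell h f"] in auto)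
  define S where "S = (\<integral>x. (u x)\<^sup>2 \<partial>M)"
  define I where "I = (\<integral>x. u x \<partial>M)"
  have I: "I = (LINT x:?Q|lborel. u x)"
    unfolding I_def M_def set_lebesgue_integral_def by (subst integral_restrict_space) auto
  have S: "(\<integral>\<^sup>+ x. ennreal ((u x)\<^sup>2) * indicator ?Q x \<partial>lborel) = ennreal S"
    using nn_integral_eq_integral[OF u2] unfolding S_def M_def
    by (simp add: nn_integral_restrict_space)
  have S0: "S \<ge> 0" unfolding S_def by simp
  define D where "D = (real DIM('a) * h) powr (real DIM('a) + 2 * s)"
  have pt: "ennreal ((u x - u y)\<^sup>2) \<le> ennreal D * ennreal ((u x - u y)\<^sup>2 * norm (x - y) powr (- (real DIM('a) + 2 * s)))"
    if "x \<in> ?Q" "y \<in> ?Q" for x y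
  proof (cases "x = y")
    case False
    have "norm (x - y) powr (real DIM('a) + 2 * s) \<le> D"
      unfolding D_def using norm_diff_cell[OF that] s by (intro powr_mono2) auto
    then have "norm (x - y) powr (real DIM('a) + 2 * s) * norm (x - y) powr (- (real DIM('a) + 2 * s)) \<le> D * norm (x - y) powr (- (real DIM('a) + 2 * s))"
      by (rule mult_right_mono) simp
    then have 1: "1 \<le> D * norm (x - y) powr (- (real DIM('a) + 2 * s))"
      using False by (simp flip: powr_add)
    have "(u x - u y)\<^sup>2 \<le> D * ((u x - u y)\<^sup>2 * norm (x - y) powr (- (real DIM('a) + 2 * s)))"
      using mult_left_mono[OF 1, of "(u x - u y)\<^sup>2"] by (simp add: mult_ac)
    then show ?thesis by (simp add: D_def ennreal_leI flip: ennreal_mult)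
  qed simp
  have "ennreal (2 * (v * S - I\<^sup>2)) = (\<integral>\<^sup>+ x. \<integral>\<^sup>+ y. ennreal ((u x - u y)\<^sup>2) \<partial>M \<partial>M)"
    using variance_identity(2)[OF _ u2] by (simp only: mM S_def I_def) simp
  also have "\<dots> \<le> (\<integral>\<^sup>+ x. ennreal D * gagliardo_density s u x \<partial>M)"
  proof (rule nn_integral_mono)
    fix x assume x: "x \<in> space M"
    have "(\<integral>\<^sup>+ y. ennreal ((u x - u y)\<^sup>2) \<partial>M) = (\<integral>\<^sup>+ y. ennreal ((u x - u y)\<^sup>2) * indicator ?Q y \<partial>lborel)"
      unfolding M_def by (subst nn_integral_restrict_space) auto
    also have "\<dots> \<le> (\<integral>\<^sup>+ y. ennreal D * ennreal ((u x - u y)\<^sup>2 * norm (x - y) powr (- (real DIM('a) + 2 * s))) \<partial>lborel)"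
    proof (rule nn_integral_mono)
      fix y
      show "ennreal ((u x - u y)\<^sup>2) * indicator ?Q y
          \<le> ennreal D * ennreal ((u x - u y)\<^sup>2 * norm (x - y) powr (- (real DIM('a) + 2 * s)))"
        using pt[of x y] x by (cases "y \<in> ?Q") simp_all
    qed
    also have "\<dots> = ennreal D * gagliardo_density s u x"
      unfolding gagliardo_density_def by (rule nn_integral_cmult) simp
    finally show "(\<integral>\<^sup>+ y. ennreal ((u x - u y)\<^sup>2) \<partial>M) \<le> ennreal D * gagliardo_density s u x" .
  qed
  also have "\<dots> = ennreal D * (\<integral>\<^sup>+ x. gagliardo_density s u x \<partial>M)"
    by (rule nn_integral_cmult) (simp add: M_def measurable_restrict_space1)
  also have "(\<integral>\<^sup>+ x. gagliardo_density s u x \<partial>M) = (\<integral>\<^sup>+ x. gagliardo_density s u x * indicator ?Q x \<partial>lborel)"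
    unfolding M_def by (subst nn_integral_restrict_space) auto
  finally have main: "ennreal (2 * (v * S - I\<^sup>2)) \<le> ennreal D * (\<integral>\<^sup>+ x. gagliardo_density s u x * indicator ?Q x \<partial>lborel)" .
  have "ennreal S \<le> ennreal (I\<^sup>2 / v) + ennreal (1 / 2 / v) * ennreal (2 * (v * S - I\<^sup>2))"
  proof -
    have "S = I\<^sup>2 / v + 1 / 2 / v * (2 * (v * S - I\<^sup>2))" using v by (simp add: field_simps)
    also have "\<dots> \<le> I\<^sup>2 / v + 1 / 2 / v * max 0 (2 * (v * S - I\<^sup>2))"
      using v by (intro add_left_mono mult_left_mono) auto
    finally have "ennreal S \<le> ennreal (I\<^sup>2 / v + 1 / 2 / v * max 0 (2 * (v * S - I\<^sup>2)))"
      by (rule ennreal_leI)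
    also have "\<dots> = ennreal (I\<^sup>2 / v) + ennreal (1 / 2 / v) * ennreal (max 0 (2 * (v * S - I\<^sup>2)))"
      using v by (subst ennreal_plus) (auto intro!: mult_nonneg_nonneg simp: ennreal_mult[symmetric] simp del: ennreal_plus)
    finally show ?thesis by (simp only: ennreal_max_0)
  qed
  also have "\<dots> \<le> ennreal (I\<^sup>2 / v) + ennreal (1 / 2 / v) * (ennreal D * (\<integral>\<^sup>+ x. gagliardo_density s u x * indicator ?Q x \<partial>lborel))"
    using main by (intro add_left_mono mult_left_mono) auto
  also have "\<dots> = ennreal (I\<^sup>2 / v) + ennreal (1 / 2 / v * D) * (\<integral>\<^sup>+ x. gagliardo_density s u x * indicator ?Q x \<partial>lborel)"
    using v by (subst ennreal_mult) (auto simp: D_def mult.assoc)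
  finally show ?thesis unfolding S[symmetric] I v_def D_def .
qed

text \<open>
  Summation over disjoint cells costs no constant. The factor in front of \<open>gagliardo s u\<close> is of
  order \<open>h powr (2 * s)\<close>; hence up to a small error the \<open>L\<^sup>2\<close> norm depends only on finitely many
  cell integrals.
\<close>

lemma grid_poincare:
  fixes u :: "'a::euclidean_space \<Rightarrow> real"
  assumes [measurable]: "u \<in> borel_measurable borel" and h: "h > 0" and s: "s > 0"
    and fin: "integrable lborel (\<lambda>x. (u x)\<^sup>2)"
    and supp: "AE x in lborel. norm x \<ge> h * real M \<longrightarrow> u x = 0"
  shows "square_integral lborel u
    \<le> ennreal ((\<Sum>f\<in>grid M. (LINT x:cell h f|lborel. u x)\<^sup>2) / h ^ DIM('a))
      + ennreal (1 / 2 / h ^ DIM('a) * (real DIM('a) * h) powr (real DIM('a) + 2 * s)) * gagliardo s u"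
proof -
  let ?G = "grid M :: ('a \<Rightarrow> int) set"
  define c where "c = 1 / 2 / h ^ DIM('a) * (real DIM('a) * h) powr (real DIM('a) + 2 * s)"
  have ind: "indicator (\<Union>f\<in>?G. cell h f) x = (\<Sum>f\<in>?G. indicator (cell h f) x :: ennreal)" for x
    by (rule indicator_UN_disjoint[OF finite_grid disjoint_cells[OF h]])
  have "square_integral lborel u = (\<integral>\<^sup>+ x. (\<Sum>f\<in>?G. ennreal ((u x)\<^sup>2) * indicator (cell h f) x) \<partial>lborel)"
  proof (rule nn_integral_cong_AE, use supp in eventually_elim)
    case (elim x)
    show ?case
    proof (cases "norm x \<ge> h * real M")
      case False
      then have "indicator (\<Union>f\<in>?G. cell h f) x = (1::ennreal)"
        using cells_cover[OF h, of x M] by (auto simp: indicator_def)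
      then show ?thesis by (simp add: sum_distrib_left[symmetric] ind[symmetric])
    qed (use elim in auto)
  qed
  also have "\<dots> = (\<Sum>f\<in>?G. \<integral>\<^sup>+ x. ennreal ((u x)\<^sup>2) * indicator (cell h f) x \<partial>lborel)"
    by (rule nn_integral_sum) auto
  also have "\<dots> \<le> (\<Sum>f\<in>?G. ennreal ((LINT x:cell h f|lborel. u x)\<^sup>2 / h ^ DIM('a))
      + ennreal c * (\<integral>\<^sup>+ x. gagliardo_density s u x * indicator (cell h f) x \<partial>lborel))"
    unfolding c_def by (intro sum_mono cell_poincare assms)
  also have "\<dots> = ennreal ((\<Sum>f\<in>?G. (LINT x:cell h f|lborel. u x)\<^sup>2) / h ^ DIM('a))
      + ennreal c * (\<Sum>f\<in>?G. \<integral>\<^sup>+ x. gagliardo_density s u x * indicator (cell h f) x \<partial>lborel)"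
    using h by (simp add: sum.distrib sum_distrib_left sum_divide_distrib)
  also have "(\<Sum>f\<in>?G. \<integral>\<^sup>+ x. gagliardo_density s u x * indicator (cell h f) x \<partial>lborel)
     = (\<integral>\<^sup>+ x. (\<Sum>f\<in>?G. gagliardo_density s u x * indicator (cell h f) x) \<partial>lborel)"
    by (rule nn_integral_sum[symmetric]) auto
  also have "\<dots> \<le> gagliardo s u"
    unfolding gagliardo_def by (intro nn_integral_mono) (auto simp: sum_distrib_left[symmetric] ind[symmetric] split: split_indicator)
  finally show ?thesis unfolding c_def by (simp add: mult_left_mono)
qed

section \<open>Compactness\<close>

lemma tail_subsequence:
  fixes Q :: "nat \<Rightarrow> nat \<Rightarrow> bool"
  assumes "\<And>j. \<exists>N. \<forall>n\<ge>N. Q j n"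
  shows "\<exists>r. strict_mono r \<and> (\<forall>j. \<forall>n\<ge>r j. Q j n)"
proof -
  obtain N where N: "\<And>j n. n \<ge> N j \<Longrightarrow> Q j n" using assms by metis
  define r where "r j = j + (\<Sum>i\<le>j. N i)" for j
  have "strict_mono r" by (simp add: strict_mono_Suc_iff r_def)
  moreover have "r j \<ge> N j" for j
    unfolding r_def using member_le_sum[of j "{..j}" N] by simp
  ultimately show ?thesis using N order_trans by blast
qed

lemma gagliardo_diff_le:
  fixes u v :: "'a::euclidean_space \<Rightarrow> real"
  assumes [measurable]: "u \<in> borel_measurable borel" "v \<in> borel_measurable borel"
  shows "gagliardo s (\<lambda>x. u x - v x) \<le> 2 * gagliardo s u + 2 * gagliardo s v"
proof -
  have sq: "((u x - v x) - (u y - v y))\<^sup>2 \<le> 2 * (u x - u y)\<^sup>2 + 2 * (v x - v y)\<^sup>2" for x y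
    using zero_le_power2[of "(u x - u y) + (v x - v y)"] by (simp add: power2_eq_square algebra_simps)
  have d: "gagliardo_density s (\<lambda>x. u x - v x) x \<le> 2 * gagliardo_density s u x + 2 * gagliardo_density s v x" for x
  proof -
    let ?k = "\<lambda>y. norm (x - y) powr (- (real DIM('a) + 2 * s))"
    have "gagliardo_density s (\<lambda>x. u x - v x) x
      \<le> (\<integral>\<^sup>+ y. 2 * ennreal ((u x - u y)\<^sup>2 * ?k y) + 2 * ennreal ((v x - v y)\<^sup>2 * ?k y) \<partial>lborel)"
      unfolding gagliardo_density_def
    proof (rule nn_integral_mono)
      fix y
      have "ennreal (((u x - v x) - (u y - v y))\<^sup>2 * ?k y) \<le> ennreal ((2 * (u x - u y)\<^sup>2 + 2 * (v x - v y)\<^sup>2) * ?k y)"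
        by (intro ennreal_leI mult_right_mono sq) simp
      also have "\<dots> = 2 * ennreal ((u x - u y)\<^sup>2 * ?k y) + 2 * ennreal ((v x - v y)\<^sup>2 * ?k y)"
        by (simp add: distrib_right mult.assoc ennreal_mult)
      finally show "ennreal (((u x - v x) - (u y - v y))\<^sup>2 * ?k y) \<le> 2 * ennreal ((u x - u y)\<^sup>2 * ?k y) + 2 * ennreal ((v x - v y)\<^sup>2 * ?k y)" .
    qed
    also have "\<dots> = 2 * gagliardo_density s u x + 2 * gagliardo_density s v x"
      unfolding gagliardo_density_def by (simp add: nn_integral_add nn_integral_cmult)
    finally show ?thesis .
  qed
  have "gagliardo s (\<lambda>x. u x - v x) \<le> (\<integral>\<^sup>+ x. 2 * gagliardo_density s u x + 2 * gagliardo_density s v x \<partial>lborel)"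
    unfolding gagliardo_def by (intro nn_integral_mono d)
  also have "\<dots> = 2 * gagliardo s u + 2 * gagliardo s v"
    unfolding gagliardo_def by (simp add: nn_integral_add nn_integral_cmult)
  finally show ?thesis .
qed

lemma nn_integral_square_diff_le:
  fixes u v :: "'a \<Rightarrow> real"
  assumes [measurable]: "u \<in> borel_measurable M" "v \<in> borel_measurable M"
  shows "square_integral M (\<lambda>x. u x - v x) \<le> 2 * square_integral M u + 2 * square_integral M v"
proof -
  have sq: "(u x - v x)\<^sup>2 \<le> 2 * (u x)\<^sup>2 + 2 * (v x)\<^sup>2" for x
    using zero_le_power2[of "u x + v x"] by (simp add: power2_eq_square algebra_simps)
  have "square_integral M (\<lambda>x. u x - v x) \<le> (\<integral>\<^sup>+ x. 2 * ennreal ((u x)\<^sup>2) + 2 * ennreal ((v x)\<^sup>2) \<partial>M)"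
  proof (rule nn_integral_mono)
    fix x
    show "ennreal ((u x - v x)\<^sup>2) \<le> 2 * ennreal ((u x)\<^sup>2) + 2 * ennreal ((v x)\<^sup>2)"
      using ennreal_leI[OF sq[of x]] by (simp add: ennreal_mult)
  qed
  also have "\<dots> = 2 * square_integral M u + 2 * square_integral M v"
    by (simp add: nn_integral_add nn_integral_cmult)
  finally show ?thesis .
qed

lemma L2_bounded_support_integrable:
  fixes u :: "'a::euclidean_space \<Rightarrow> real"
  assumes [measurable]: "u \<in> borel_measurable borel"
    and supp: "AE x in lborel. norm x \<ge> R \<longrightarrow> u x = 0"
    and B: "square_integral lborel u \<le> ennreal B" "B \<ge> 0"
  shows "integrable lborel (\<lambda>x. (u x)\<^sup>2)" "integrable lborel u"
    "(\<integral>x. \<bar>u x\<bar> \<partial>lborel) \<le> measure lborel (cball 0 R :: 'a set) + B"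
proof -
  show i2: "integrable lborel (\<lambda>x. (u x)\<^sup>2)"
    using B by (intro integrableI_bounded) (auto simp: order_le_less_trans)
  have i2v: "(\<integral>x. (u x)\<^sup>2 \<partial>lborel) \<le> B"
    using nn_integral_eq_integral[OF i2] B by simp
  have ic: "integrable lborel (indicator (cball 0 R :: 'a set) :: 'a \<Rightarrow> real)"
    using emeasure_bounded_finite[OF bounded_cball[of "0::'a" R]] by (intro integrable_real_indicator) auto
  have le: "AE x in lborel. \<bar>u x\<bar> \<le> indicator (cball 0 R) x + (u x)\<^sup>2"
    using supp
  proof eventually_elim
    case (elim x)
    have "\<bar>u x\<bar> \<le> 1 + (u x)\<^sup>2"
      using zero_le_power2[of "\<bar>u x\<bar> - 1"] by (simp add: power2_diff)
    then show ?case using elim by (cases "norm x \<ge> R") (auto simp: indicator_def)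
  qed
  show i1: "integrable lborel u"
  proof (rule Bochner_Integration.integrable_bound)
    show "integrable lborel (\<lambda>x. indicator (cball 0 R) x + (u x)\<^sup>2)"
      using ic i2 by (rule Bochner_Integration.integrable_add)
    show "AE x in lborel. norm (u x) \<le> norm (indicator (cball 0 R) x + (u x)\<^sup>2)"
      using le by eventually_elim auto
  qed simp
  have "(\<integral>x. \<bar>u x\<bar> \<partial>lborel) \<le> (\<integral>x. indicator (cball 0 R) x + (u x)\<^sup>2 \<partial>lborel)"
    using i1 ic i2 le by (intro integral_mono_AE Bochner_Integration.integrable_add) auto
  also have "\<dots> = measure lborel (cball 0 R :: 'a set) + (\<integral>x. (u x)\<^sup>2 \<partial>lborel)"
    using ic i2 by (subst Bochner_Integration.integral_add) auto
  finally show "(\<integral>x. \<bar>u x\<bar> \<partial>lborel) \<le> measure lborel (cball 0 R :: 'a set) + B" using i2v by linarith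
qed

text \<open>
  The integrals over the cells of the countably many grids with sides \<open>1 / Suc k\<close> are bounded, so
  some subsequence makes all of them converge. By the grid inequality, applied to differences, that
  subsequence is Cauchy in \<open>L\<^sup>2\<close>.
\<close>

lemma gagliardo_rellich_Cauchy:
  fixes u :: "nat \<Rightarrow> 'a::euclidean_space \<Rightarrow> real"
  assumes u[measurable]: "\<And>n. u n \<in> borel_measurable borel" and s: "s > 0"
    and supp: "\<And>n. AE x in lborel. norm x \<ge> R \<longrightarrow> u n x = 0"
    and M: "\<And>n. gagliardo s (u n) \<le> ennreal M" "M \<ge> 0"
    and B: "\<And>n. square_integral lborel (u n) \<le> ennreal B" "B \<ge> 0"
  shows "\<exists>r :: nat \<Rightarrow> nat. strict_mono r \<and> (\<forall>\<epsilon>>0. \<exists>N. \<forall>m\<ge>N. \<forall>n\<ge>N.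
    square_integral lborel (\<lambda>x. u (r m) x - u (r n) x) \<le> ennreal \<epsilon>)"
proof -
  define h where "h k = 1 / real (Suc k)" for k
  have h: "h k > 0" for k by (simp add: h_def)
  define avg where "avg n z = (LINT x:cell (h (fst z)) (snd z)|lborel. u n x)" for n and z :: "nat \<times> ('a \<Rightarrow> int)"
  define Z :: "(nat \<times> ('a \<Rightarrow> int)) set" where "Z = UNIV \<times> (\<Union>M. grid M)"
  have i1: "integrable lborel (u n)" for n
    by (rule L2_bounded_support_integrable[OF u supp B])
  have avg_bound: "norm (avg n z) \<le> measure lborel (cball 0 R :: 'a set) + B" for n z
  proof -
    have "norm (avg n z) \<le> (\<integral>x. norm (indicator (cell (h (fst z)) (snd z)) x *\<^sub>R u n x) \<partial>lborel)"
      unfolding avg_def set_lebesgue_integral_def by (rule integral_norm_bound)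
    also have "\<dots> \<le> (\<integral>x. \<bar>u n x\<bar> \<partial>lborel)"
      using i1 by (intro integral_mono integrable_norm integrable_mult_indicator integrable_abs)
         (auto simp: indicator_def)
    also have "\<dots> \<le> measure lborel (cball 0 R :: 'a set) + B"
      by (rule L2_bounded_support_integrable[OF u supp B])
    finally show ?thesis .
  qed
  have "countable Z" unfolding Z_def
    by (intro countable_SIGMA countable_UN) (auto intro: countable_finite finite_grid)
  then obtain r where r: "strict_mono r" "\<And>z. z \<in> Z \<Longrightarrow> \<exists>l. (\<lambda>n. avg (r n) z) \<longlonglongrightarrow> l"
    using function_convergent_subsequence[of Z avg, OF _ avg_bound] by blast
  define L where "L z = lim (\<lambda>n. avg (r n) z)" for z
  have L: "(\<lambda>n. avg (r n) z) \<longlonglongrightarrow> L z" if "z \<in> Z" for z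
    using r(2)[OF that] unfolding L_def by (metis limI)
  define c where "c k = 1 / 2 / h k ^ DIM('a) * (real DIM('a) * h k) powr (real DIM('a) + 2 * s)" for k
  have c_eq: "c k = 1 / 2 * real DIM('a) powr (real DIM('a) + 2 * s) * h k powr (2 * s)" for k
    unfolding c_def using h[of k] by (simp add: powr_mult powr_add powr_realpow)
  have c0: "c k \<ge> 0" for k by (simp add: c_eq)
  have c_lim: "c \<longlonglongrightarrow> 0"
  proof -
    have "h \<longlonglongrightarrow> 0" unfolding h_def by (rule LIMSEQ_Suc[OF lim_1_over_n])
    then have "(\<lambda>k. h k powr (2 * s)) \<longlonglongrightarrow> 0 powr (2 * s)"
      using s by (intro tendsto_powr') (auto simp: less_imp_le[OF h])
    then have "(\<lambda>k. 1 / 2 * real DIM('a) powr (real DIM('a) + 2 * s) * h k powr (2 * s)) \<longlonglongrightarrow> 1 / 2 * real DIM('a) powr (real DIM('a) + 2 * s) * 0"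
      by (intro tendsto_mult_left) simp
    then show ?thesis unfolding c_eq[abs_def] by simp
  qed
  show ?thesis
  proof (rule exI[of _ r], intro conjI allI impI r(1))
    fix \<epsilon> :: real assume \<epsilon>: "\<epsilon> > 0"
    have "(\<lambda>k. c k * (4 * M)) \<longlonglongrightarrow> 0 * (4 * M)" by (intro tendsto_intros c_lim)
    then have "eventually (\<lambda>k. c k * (4 * M) < \<epsilon> / 2) sequentially"
      using \<epsilon> by (intro order_tendstoD) auto
    then obtain k where k: "c k * (4 * M) < \<epsilon> / 2" by (auto simp: eventually_sequentially)
    obtain P :: nat where P: "R / h k \<le> real P" using real_arch_simple by blast
    then have RP: "R \<le> h k * real P" using h[of k] by (simp add: field_simps)
    define T where "T n = (\<Sum>f\<in>grid P. (avg (r n) (k, f) - L (k, f))\<^sup>2)" for n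
    have "T \<longlonglongrightarrow> (\<Sum>f\<in>(grid P :: ('a \<Rightarrow> int) set). (L (k, f) - L (k, f))\<^sup>2)"
      unfolding T_def by (intro tendsto_intros L) (auto simp: Z_def)
    then have "(\<lambda>n. T n / h k ^ DIM('a)) \<longlonglongrightarrow> 0 / h k ^ DIM('a)" using h[of k] by (intro tendsto_intros) auto
    then have "eventually (\<lambda>n. T n / h k ^ DIM('a) < \<epsilon> / 8) sequentially"
      using \<epsilon> by (intro order_tendstoD) auto
    then obtain N where N: "\<And>n. n \<ge> N \<Longrightarrow> T n / h k ^ DIM('a) < \<epsilon> / 8" by (auto simp: eventually_sequentially)
    show "\<exists>N. \<forall>m\<ge>N. \<forall>n\<ge>N. square_integral lborel (\<lambda>x. u (r m) x - u (r n) x) \<le> ennreal \<epsilon>"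
    proof (intro exI[of _ N] allI impI)
      fix m n assume mn: "N \<le> m" "N \<le> n"
      define w where "w x = u (r m) x - u (r n) x" for x
      have [measurable]: "w \<in> borel_measurable borel" unfolding w_def by measurable
      have w_supp: "AE x in lborel. norm x \<ge> R \<longrightarrow> w x = 0"
        using supp[of "r m"] supp[of "r n"] by eventually_elim (auto simp: w_def)
      then have w_supp': "AE x in lborel. norm x \<ge> h k * real P \<longrightarrow> w x = 0"
        by eventually_elim (use RP in auto)
      have "square_integral lborel w \<le> 2 * ennreal B + 2 * ennreal B"
        unfolding w_def by (rule order_trans[OF nn_integral_square_diff_le]) (auto intro!: add_mono mult_left_mono B)
      also have "\<dots> = ennreal (4 * B)" using B(2) by (simp add: ennreal_mult flip: distrib_right)
      finally have w2: "integrable lborel (\<lambda>x. (w x)\<^sup>2)"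
        by (intro L2_bounded_support_integrable[OF _ w_supp, where B="4 * B"]) (use B(2) in auto)
      have "gagliardo s w \<le> 2 * gagliardo s (u (r m)) + 2 * gagliardo s (u (r n))"
        unfolding w_def by (rule gagliardo_diff_le) auto
      also have "\<dots> \<le> 2 * ennreal M + 2 * ennreal M" by (intro add_mono mult_left_mono M) auto
      also have "\<dots> = ennreal (4 * M)" using M(2) by (simp add: ennreal_mult flip: distrib_right)
      finally have gw: "gagliardo s w \<le> ennreal (4 * M)" .
      have avg_w: "(LINT x:cell (h k) f|lborel. w x) = avg (r m) (k, f) - avg (r n) (k, f)" for f
        unfolding avg_def w_def fst_conv snd_conv
        by (rule set_integral_diff(2)) (unfold set_integrable_def, (rule integrable_mult_indicator[OF _ i1]; simp)+)
      have "(\<Sum>f\<in>(grid P :: ('a \<Rightarrow> int) set). (LINT x:cell (h k) f|lborel. w x)\<^sup>2)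
        \<le> (\<Sum>f\<in>grid P. 2 * (avg (r m) (k, f) - L (k, f))\<^sup>2 + 2 * (avg (r n) (k, f) - L (k, f))\<^sup>2)"
      proof (rule sum_mono)
        fix f :: "'a \<Rightarrow> int"
        have "(a - b)\<^sup>2 \<le> 2 * (a - l)\<^sup>2 + 2 * (b - l)\<^sup>2" for a b l :: real
          using zero_le_power2[of "(a - l) + (b - l)"] by (simp add: power2_eq_square algebra_simps)
        then show "(LINT x:cell (h k) f|lborel. w x)\<^sup>2 \<le> 2 * (avg (r m) (k, f) - L (k, f))\<^sup>2 + 2 * (avg (r n) (k, f) - L (k, f))\<^sup>2"
          unfolding avg_w .
      qed
      also have "\<dots> = 2 * T m + 2 * T n" by (simp add: T_def sum.distrib sum_distrib_left)
      finally have "(\<Sum>f\<in>(grid P :: ('a \<Rightarrow> int) set). (LINT x:cell (h k) f|lborel. w x)\<^sup>2) / h k ^ DIM('a) \<le> (2 * T m + 2 * T n) / h k ^ DIM('a)"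
        using h[of k] by (intro divide_right_mono) auto
      also have "\<dots> = 2 * (T m / h k ^ DIM('a)) + 2 * (T n / h k ^ DIM('a))" by (simp add: add_divide_distrib)
      also have "\<dots> \<le> \<epsilon> / 2" using N[OF mn(1)] N[OF mn(2)] by linarith
      finally have A: "(\<Sum>f\<in>(grid P :: ('a \<Rightarrow> int) set). (LINT x:cell (h k) f|lborel. w x)\<^sup>2) / h k ^ DIM('a) \<le> \<epsilon> / 2" .
      have "square_integral lborel w
        \<le> ennreal ((\<Sum>f\<in>(grid P :: ('a \<Rightarrow> int) set). (LINT x:cell (h k) f|lborel. w x)\<^sup>2) / h k ^ DIM('a)) + ennreal (c k) * gagliardo s w"
        unfolding c_def by (rule grid_poincare[OF _ h s w2 w_supp']) simp
      also have "\<dots> \<le> ennreal (\<epsilon> / 2) + ennreal (c k) * ennreal (4 * M)"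
        using A gw by (intro add_mono mult_left_mono ennreal_leI) auto
      also have "\<dots> = ennreal (\<epsilon> / 2 + c k * (4 * M))"
        using c0[of k] M(2) \<epsilon> by (simp add: ennreal_mult)
      also have "\<dots> \<le> ennreal \<epsilon>" using k by (intro ennreal_leI) auto
      finally show "square_integral lborel (\<lambda>x. u (r m) x - u (r n) x) \<le> ennreal \<epsilon>"
        by (simp add: w_def)
    qed
  qed
qed

text \<open>
  The Riesz-Fischer argument: along a fast subsequence the increments are summable almost everywhere,
  and Fatou's lemma identifies the pointwise limit as the limit in \<open>L\<^sup>2\<close>.
\<close>

lemma L2_Cauchy_limit:
  fixes u :: "nat \<Rightarrow> 'a::euclidean_space \<Rightarrow> real"
  assumes u[measurable]: "\<And>n. u n \<in> borel_measurable borel"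
    and supp: "\<And>n. AE x in lborel. norm x \<ge> R \<longrightarrow> u n x = 0"
    and Cauchy: "\<And>\<epsilon>. \<epsilon> > 0 \<Longrightarrow> \<exists>N. \<forall>m\<ge>N. \<forall>n\<ge>N. square_integral lborel (\<lambda>x. u m x - u n x) \<le> ennreal \<epsilon>"
  shows "\<exists>v. v \<in> borel_measurable borel \<and>
    (\<forall>\<epsilon>>0. \<exists>N. \<forall>n\<ge>N. square_integral lborel (\<lambda>x. u n x - v x) \<le> ennreal \<epsilon>)"
proof -
  \<comment> \<open>the rate \<open>1 / 8\<close> leaves room for the weight \<open>2 ^ j\<close> used below to pass from \<open>L\<^sup>2\<close> to \<open>L\<^sup>1\<close>\<close>
  have "\<exists>N. \<forall>n\<ge>N. \<forall>m\<ge>n. square_integral lborel (\<lambda>x. u m x - u n x) \<le> ennreal ((1/8) ^ j)" for j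
  proof -
    obtain N where N: "\<forall>m\<ge>N. \<forall>n\<ge>N. square_integral lborel (\<lambda>x. u m x - u n x) \<le> ennreal ((1/8) ^ j)"
      using Cauchy[of "(1/8) ^ j"] by auto
    then show ?thesis by (intro exI[of _ N]) auto
  qed
  then obtain k where k: "strict_mono k"
    "\<And>j n m. n \<ge> k j \<Longrightarrow> m \<ge> n \<Longrightarrow> square_integral lborel (\<lambda>x. u m x - u n x) \<le> ennreal ((1/8) ^ j)"
    using tail_subsequence[of "\<lambda>j n. \<forall>m\<ge>n. square_integral lborel (\<lambda>x. u m x - u n x) \<le> ennreal ((1/8) ^ j)"] by blast
  define d where "d j x = u (k (Suc j)) x - u (k j) x" for j x
  have d[measurable]: "d j \<in> borel_measurable borel" for j unfolding d_def by measurable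
  have d_supp: "AE x in lborel. norm x \<ge> R \<longrightarrow> d j x = 0" for j
    using supp[of "k (Suc j)"] supp[of "k j"] by eventually_elim (auto simp: d_def)
  define vol where "vol = measure lborel (cball 0 R :: 'a set)"
  have vol: "emeasure lborel (cball 0 R :: 'a set) = ennreal vol"
    unfolding vol_def using emeasure_bounded_finite[OF bounded_cball[of "0::'a" R]]
    by (intro emeasure_eq_ennreal_measure) auto
  have d_int: "(\<integral>\<^sup>+ x. ennreal \<bar>d j x\<bar> \<partial>lborel) \<le> ennreal ((1 + vol) * (1/2) ^ j)" for j
  proof -
    have "(\<integral>\<^sup>+ x. ennreal \<bar>d j x\<bar> \<partial>lborel)
      \<le> (\<integral>\<^sup>+ x. ennreal (2 ^ j) * ennreal ((d j x)\<^sup>2) + ennreal ((1/2) ^ j) * indicator (cball 0 R) x \<partial>lborel)"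
    proof (rule nn_integral_mono_AE, use d_supp[of j] in eventually_elim)
      case (elim x)
      show ?case
      proof (cases "norm x \<ge> R")
        case True then show ?thesis using elim by simp
      next
        case False
        \<comment> \<open>this weighted inequality replaces Cauchy-Schwarz on the bounded support\<close>
        have "\<bar>t\<bar> \<le> a * t\<^sup>2 + 1 / a" if "a > 0" for a t :: real
        proof -
          have "0 \<le> (a * \<bar>t\<bar> - 1)\<^sup>2" by simp
          then have "2 * a * \<bar>t\<bar> \<le> a * (a * t\<^sup>2) + 1" by (simp add: power2_diff power_mult_distrib power2_eq_square algebra_simps)
          moreover have "0 \<le> a * \<bar>t\<bar>" using that by simp
          ultimately have "a * \<bar>t\<bar> \<le> a * (a * t\<^sup>2) + 1" by linarith
          then show ?thesis using that by (simp add: field_simps)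
        qed
        from this[of "2 ^ j" "d j x"] have "ennreal \<bar>d j x\<bar> \<le> ennreal (2 ^ j * (d j x)\<^sup>2 + (1/2) ^ j)"
          by (intro ennreal_leI) (simp add: power_one_over)
        then show ?thesis using False by (simp add: ennreal_mult)
      qed
    qed
    also have "\<dots> = ennreal (2 ^ j) * square_integral lborel (d j) + ennreal ((1/2) ^ j) * emeasure lborel (cball 0 R :: 'a set)"
    proof -
      have "(\<lambda>x :: 'a. ennreal ((1/2) ^ j) * indicator (cball 0 R) x) \<in> borel_measurable lborel"
        by (intro borel_measurable_times_ennreal borel_measurable_const borel_measurable_indicator) simp
      then show ?thesis
        by (subst nn_integral_add) (simp_all add: nn_integral_cmult nn_integral_cmult_indicator)
    qed
    also have "\<dots> \<le> ennreal (2 ^ j) * ennreal ((1/8) ^ j) + ennreal ((1/2) ^ j) * ennreal vol"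
      unfolding vol d_def by (intro add_mono mult_left_mono k(2) order_refl) (auto intro: strict_monoD[OF k(1)] less_imp_le)
    also have "\<dots> = ennreal (2 ^ j * (1/8) ^ j + (1/2) ^ j * vol)"
      by (simp add: vol_def flip: ennreal_mult)
    also have "\<dots> \<le> ennreal ((1 + vol) * (1/2) ^ j)"
    proof (intro ennreal_leI)
      have "(2::real) ^ j * (1/8) ^ j = (1/4) ^ j" by (simp flip: power_mult_distrib)
      also have "\<dots> \<le> (1/2) ^ j" by (intro power_mono) auto
      finally show "2 ^ j * (1/8) ^ j + (1/2) ^ j * vol \<le> (1 + vol) * (1/2) ^ j" by (simp add: algebra_simps)
    qed
    finally show ?thesis .
  qed
  have "(\<integral>\<^sup>+ x. (\<Sum>j. ennreal \<bar>d j x\<bar>) \<partial>lborel) = (\<Sum>j. \<integral>\<^sup>+ x. ennreal \<bar>d j x\<bar> \<partial>lborel)"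
    by (rule nn_integral_suminf) simp
  also have "\<dots> \<le> (\<Sum>j. ennreal ((1 + vol) * (1/2) ^ j))"
    by (intro suminf_le d_int) auto
  also have "\<dots> < \<infinity>"
    by (subst suminf_ennreal2) (auto simp: vol_def intro!: summable_mult summable_geometric)
  finally have "AE x in lborel. (\<Sum>j. ennreal \<bar>d j x\<bar>) \<noteq> \<infinity>"
    by (intro nn_integral_PInf_AE) auto
  then have conv: "AE x in lborel. convergent (\<lambda>j. u (k j) x)"
  proof eventually_elim
    case (elim x)
    then have "summable (\<lambda>j. \<bar>d j x\<bar>)" by (intro summable_suminf_not_top) auto
    then have "summable (\<lambda>j. d j x)" by (rule summable_rabs_cancel)
    then have "convergent (\<lambda>n. \<Sum>j<n. d j x)" by (simp add: summable_iff_convergent)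
    moreover have "(\<Sum>j<n. d j x) = u (k n) x - u (k 0) x" for n
      unfolding d_def by (rule sum_lessThan_telescope)
    ultimately have "convergent (\<lambda>n. u (k n) x - u (k 0) x)" by simp
    then have "convergent (\<lambda>n. u (k n) x - u (k 0) x + u (k 0) x)"
      by (intro convergent_add convergent_const)
    then show ?case by simp
  qed
  define v where "v x = lim (\<lambda>j. u (k j) x)" for x
  have v[measurable]: "v \<in> borel_measurable borel"
    unfolding v_def by (rule borel_measurable_lim_metric) simp
  have lim: "AE x in lborel. (\<lambda>j. u (k j) x) \<longlonglongrightarrow> v x"
    using conv by eventually_elim (simp add: v_def convergent_LIMSEQ_iff)
  show ?thesis
  proof (intro exI[of _ v] conjI v allI impI)
    fix \<epsilon> :: real assume "\<epsilon> > 0"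
    from Cauchy[OF this] obtain N where N: "\<And>m n. m \<ge> N \<Longrightarrow> n \<ge> N \<Longrightarrow> square_integral lborel (\<lambda>x. u m x - u n x) \<le> ennreal \<epsilon>"
      by blast
    show "\<exists>N. \<forall>n\<ge>N. square_integral lborel (\<lambda>x. u n x - v x) \<le> ennreal \<epsilon>"
    proof (intro exI[of _ N] allI impI)
      fix n assume n: "N \<le> n"
      have "square_integral lborel (\<lambda>x. u n x - v x) = (\<integral>\<^sup>+ x. liminf (\<lambda>j. ennreal ((u n x - u (k j) x)\<^sup>2)) \<partial>lborel)"
      proof (rule nn_integral_cong_AE, use lim in eventually_elim)
        case (elim x)
        then have "(\<lambda>j. ennreal ((u n x - u (k j) x)\<^sup>2)) \<longlonglongrightarrow> ennreal ((u n x - v x)\<^sup>2)"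
          by (intro tendsto_ennrealI tendsto_intros)
        then show ?case by (intro lim_imp_Liminf[symmetric]) auto
      qed
      also have "\<dots> \<le> liminf (\<lambda>j. \<integral>\<^sup>+ x. ennreal ((u n x - u (k j) x)\<^sup>2) \<partial>lborel)"
        by (rule nn_integral_liminf) simp
      also have "\<dots> \<le> ennreal \<epsilon>"
      proof (rule Liminf_le)
        show "\<forall>\<^sub>F j in sequentially. square_integral lborel (\<lambda>x. u n x - u (k j) x) \<le> ennreal \<epsilon>"
          using eventually_ge_at_top[of N]
        proof eventually_elim
          case (elim j)
          then have "k j \<ge> N" using seq_suble[OF k(1), of j] by linarith
          then show ?case by (rule N[OF n])
        qed
      qed simp
      finally show "square_integral lborel (\<lambda>x. u n x - v x) \<le> ennreal \<epsilon>" .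
    qed
  qed
qed

text \<open>
  Along a fast subsequence the series of the errors \<open>\<bar>u n - v\<bar> powr p\<close> is integrable. It yields
  convergence almost everywhere and, up to a factor, an integrable majorant, so that later limits
  need only dominated convergence.
\<close>

lemma dominated_subsequence:
  fixes u :: "nat \<Rightarrow> 'a \<Rightarrow> real" and v :: "'a \<Rightarrow> real"
  assumes [measurable]: "\<And>n. u n \<in> borel_measurable M" "v \<in> borel_measurable M"
    and p: "p > 0"
    and conv: "\<And>\<epsilon>. \<epsilon> > 0 \<Longrightarrow> \<exists>N. \<forall>n\<ge>N. power_integral p M (\<lambda>x. u n x - v x) \<le> ennreal \<epsilon>"
    and v: "integrable M (\<lambda>x. \<bar>v x\<bar> powr p)"
  shows "\<exists>(r :: nat \<Rightarrow> nat) g. strict_mono r \<and> integrable M g \<and> (AE x in M. (\<lambda>n. u (r n) x) \<longlonglongrightarrow> v x)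
    \<and> (AE x in M. \<forall>n. \<bar>u (r n) x\<bar> powr p \<le> g x)"
proof -
  define e where "e n x = \<bar>u n x - v x\<bar> powr p" for n x
  have e[measurable]: "e n \<in> borel_measurable M" for n unfolding e_def by measurable
  have e0: "e n x \<ge> 0" for n x by (simp add: e_def)
  from tail_subsequence[of "\<lambda>j n. (\<integral>\<^sup>+ x. ennreal (e n x) \<partial>M) \<le> ennreal ((1/2) ^ j)"]
  obtain r where r: "strict_mono r" and rj: "\<And>j. (\<integral>\<^sup>+ x. ennreal (e (r j) x) \<partial>M) \<le> ennreal ((1/2) ^ j)"
    using conv[of "(1/2) ^ _"] unfolding e_def by auto
  have "(\<integral>\<^sup>+ x. (\<Sum>j. ennreal (e (r j) x)) \<partial>M) = (\<Sum>j. \<integral>\<^sup>+ x. ennreal (e (r j) x) \<partial>M)"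
    by (rule nn_integral_suminf) simp
  also have "\<dots> \<le> (\<Sum>j. ennreal ((1/2) ^ j))"
    by (intro suminf_le rj) auto
  also have "\<dots> < \<infinity>"
    by (subst suminf_ennreal2) (auto intro!: summable_geometric)
  finally have fin: "(\<integral>\<^sup>+ x. (\<Sum>j. ennreal (e (r j) x)) \<partial>M) < \<infinity>" .
  then have "AE x in M. (\<Sum>j. ennreal (e (r j) x)) \<noteq> \<infinity>"
    by (intro nn_integral_PInf_AE) auto
  then have ae: "AE x in M. summable (\<lambda>j. e (r j) x)"
    by eventually_elim (auto intro!: summable_suminf_not_top e0)
  define E where "E x = (\<Sum>j. e (r j) x)" for x
  have E[measurable]: "E \<in> borel_measurable M" unfolding E_def by measurable
  have iE: "integrable M E"
  proof (rule integrableI_bounded)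
    have "(\<integral>\<^sup>+ x. ennreal (norm (E x)) \<partial>M) = (\<integral>\<^sup>+ x. (\<Sum>j. ennreal (e (r j) x)) \<partial>M)"
      by (rule nn_integral_cong_AE, use ae in eventually_elim) (simp add: E_def suminf_ennreal2 e0 suminf_nonneg)
    with fin show "(\<integral>\<^sup>+ x. ennreal (norm (E x)) \<partial>M) < \<infinity>" by simp
  qed simp
  have pt: "\<bar>a\<bar> powr p \<le> 2 powr p * (\<bar>a - b\<bar> powr p + \<bar>b\<bar> powr p)" for a b :: real
  proof -
    have "\<bar>a\<bar> \<le> \<bar>a - b\<bar> + \<bar>b\<bar>" by linarith
    also have "\<dots> \<le> 2 * max \<bar>a - b\<bar> \<bar>b\<bar>" by (simp add: max_def)
    finally have "\<bar>a\<bar> powr p \<le> (2 * max \<bar>a - b\<bar> \<bar>b\<bar>) powr p" using p by (intro powr_mono2) auto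
    also have "\<dots> = 2 powr p * max \<bar>a - b\<bar> \<bar>b\<bar> powr p" by (simp add: powr_mult)
    also have "\<dots> \<le> 2 powr p * (\<bar>a - b\<bar> powr p + \<bar>b\<bar> powr p)"
      by (intro mult_left_mono) (auto simp: max_def)
    finally show ?thesis .
  qed
  define g where "g x = 2 powr p * (E x + \<bar>v x\<bar> powr p)" for x
  have "integrable M g" unfolding g_def using iE v by (intro integrable_mult_right Bochner_Integration.integrable_add) auto
  moreover have "AE x in M. (\<lambda>n. u (r n) x) \<longlonglongrightarrow> v x"
    using ae
  proof eventually_elim
    case (elim x)
    then have "(\<lambda>n. e (r n) x) \<longlonglongrightarrow> 0" by (rule summable_LIMSEQ_zero)
    then have "(\<lambda>n. e (r n) x powr (1 / p)) \<longlonglongrightarrow> 0 powr (1 / p)"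
      using p by (intro tendsto_powr') (auto simp: e0)
    then have "(\<lambda>n. \<bar>u (r n) x - v x\<bar>) \<longlonglongrightarrow> 0" using p by (simp add: e_def powr_powr)
    then have "(\<lambda>n. u (r n) x - v x) \<longlonglongrightarrow> 0" by (rule tendsto_rabs_zero_cancel)
    then show ?case by (rule LIM_zero_cancel)
  qed
  moreover have "AE x in M. \<forall>n. \<bar>u (r n) x\<bar> powr p \<le> g x"
    using ae
  proof eventually_elim
    case (elim x)
    show ?case
    proof
      fix n
      have "e (r n) x \<le> E x"
        unfolding E_def using sum_le_suminf[OF elim, of "{n}"] e0 by simp
      then show "\<bar>u (r n) x\<bar> powr p \<le> g x"
        unfolding g_def e_def by (intro order_trans[OF pt[of "u (r n) x" "v x"]] mult_left_mono) auto
    qed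
  qed
  ultimately show ?thesis using r by blast
qed

section \<open>The function space and the energy\<close>

lemma abs_mult_le_squares: "\<bar>a * b\<bar> \<le> a\<^sup>2 + (b::real)\<^sup>2"
proof -
  have "2 * \<bar>a * b\<bar> \<le> a\<^sup>2 + b\<^sup>2"
    using sum_squares_bound[of "\<bar>a\<bar>" "\<bar>b\<bar>"] by (simp add: abs_mult)
  moreover have "0 \<le> \<bar>a * b\<bar>" by simp
  ultimately show ?thesis by linarith
qed

lemma contraction_isCont:
  fixes F :: "real \<Rightarrow> real"
  assumes "\<And>a b. \<bar>F a - F b\<bar> \<le> \<bar>a - b\<bar>"
  shows "isCont F x"
proof -
  have "continuous_on UNIV F"
    by (rule lipschitz_on_continuous_on[of 1], rule lipschitz_onI) (simp_all add: dist_real_def assms)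
  then show ?thesis by (simp add: continuous_on_eq_continuous_at)
qed

text \<open>
  The condition \<open>2 * s < DIM\<close>, which makes the critical exponent finite, holds as soon as the dimension
  is at least \<open>2\<close> and \<open>s < 1\<close>.
\<close>

locale nonlocal_problem =
  fixes \<Omega> :: "'a::euclidean_space set" and V K :: "'a \<Rightarrow> real" and s p :: real
  assumes s_pos: "0 < s" and s_dim: "2 * s < real DIM('a)"
    and open_dom: "open \<Omega>" and dom_ne: "\<Omega> \<noteq> {}" and bounded_dom: "bounded \<Omega>"
    and V_Linf: "Linf_on \<Omega> V"
    and K_pos: "\<And>x. x \<noteq> 0 \<Longrightarrow> K x > 0"
    and K_int: "integrable lebesgue (\<lambda>x. min ((norm x)\<^sup>2) 1 * K x)"
    and K_lower: "\<exists>\<theta> > 0. \<forall>x. x \<noteq> 0 \<longrightarrow> K x \<ge> \<theta> * norm x powr (- (real DIM('a) + 2 * s))"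
    and pos_def: "positive_definite_op \<Omega> K V"
    and p_gt: "2 < p" and p_lt: "p < 2 * real DIM('a) / (real DIM('a) - 2 * s)"
begin

abbreviation X :: "('a \<Rightarrow> real) set" where "X \<equiv> H_space \<Omega> K"

text \<open>
  The integrand of the inner product of \<open>H\<close>. All integrals are taken over the whole space: off
  \<open>Q_set \<Omega>\<close> the differences vanish almost everywhere, and \<open>W\<close> extends \<open>V\<close> by zero.
\<close>

definition kin :: "('a \<Rightarrow> real) \<Rightarrow> ('a \<Rightarrow> real) \<Rightarrow> 'a \<times> 'a \<Rightarrow> real" where
  "kin u v z = (u (fst z) - u (snd z)) * (v (fst z) - v (snd z)) * K (fst z - snd z)"

definition W :: "'a \<Rightarrow> real" where "W x = indicator \<Omega> x * V x"

definition B :: "('a \<Rightarrow> real) \<Rightarrow> ('a \<Rightarrow> real) \<Rightarrow> real" where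
  "B u v = (\<integral>z. kin u v z \<partial>lebesgue)"

lemma K_measurable [measurable]: "K \<in> borel_measurable lebesgue"
proof (rule borel_measurable_AE)
  have [measurable]: "(\<lambda>x. min ((norm x)\<^sup>2) 1 * K x) \<in> borel_measurable lebesgue"
    using K_int by (rule borel_measurable_integrable)
  have [measurable]: "(\<lambda>x :: 'a. min ((norm x)\<^sup>2) 1) \<in> borel_measurable lebesgue"
    by (intro measurable_completion borel_measurable_continuous_onI) (auto intro!: continuous_intros)
  show "(\<lambda>x. (min ((norm x)\<^sup>2) 1 * K x) / min ((norm x)\<^sup>2) 1) \<in> borel_measurable lebesgue"
    by measurable
  have "AE x in lebesgue. (x::'a) \<noteq> 0" by (simp add: AE_completion_iff AE_lborel_singleton)
  then show "AE x in lebesgue. (min ((norm x)\<^sup>2) 1 * K x) / min ((norm x)\<^sup>2) 1 = K x"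
    by eventually_elim (auto simp: min_def)
qed

lemma K_diff_measurable [measurable]: "(\<lambda>z. K (fst z - snd z)) \<in> borel_measurable lebesgue"
  by (rule borel_measurable_lebesgue_diff) simp

lemma kin_measurable:
  assumes u: "u \<in> borel_measurable lebesgue" and v: "v \<in> borel_measurable lebesgue"
  shows "kin u v \<in> borel_measurable lebesgue"
proof -
  note [measurable] = borel_measurable_lebesgue_fst[OF u] borel_measurable_lebesgue_snd[OF u]
    borel_measurable_lebesgue_fst[OF v] borel_measurable_lebesgue_snd[OF v]
  show ?thesis unfolding kin_def[abs_def] by measurable
qed

lemma kin_nonneg: "0 \<le> kin u u z"
  using K_pos[of "fst z - snd z"] by (cases "fst z = snd z") (auto simp: kin_def)

lemma kin_abs_le: "\<bar>kin u v z\<bar> \<le> kin u u z + kin v v z"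
proof (cases "fst z = snd z")
  case False
  have "\<bar>a * b\<bar> \<le> a * a + b * b" for a b :: real
    using abs_mult_le_squares[of a b] by (simp add: power2_eq_square)
  from mult_right_mono[OF this, of "K (fst z - snd z)"] show ?thesis
    using K_pos[of "fst z - snd z"] False by (simp add: kin_def abs_mult distrib_right)
qed (simp add: kin_def)

lemma Q_set_lebesgue: "Q_set \<Omega> \<in> sets lebesgue"
proof -
  have "Q_set \<Omega> = - ((- \<Omega>) \<times> (- \<Omega>))" by (auto simp: Q_set_def)
  moreover have "closed ((- \<Omega>) \<times> (- \<Omega>))"
    using open_dom by (intro closed_Times) (auto simp: closed_def)
  ultimately have "open (Q_set \<Omega>)" by (simp add: open_Compl)
  then show ?thesis by (intro sets_completionI_sets) simp
qed

lemma dom_lebesgue [measurable]: "\<Omega> \<in> sets lebesgue"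
  using open_dom by (intro sets_completionI_sets) simp

lemma AE_kin_outside:
  fixes u :: "'a \<Rightarrow> real"
  assumes "AE x in lebesgue. x \<notin> \<Omega> \<longrightarrow> u x = 0"
  shows "AE z in lebesgue. z \<notin> Q_set \<Omega> \<longrightarrow> u (fst z) - u (snd z) = 0"
  using AE_lebesgue_fst[OF assms, where 'b='a] AE_lebesgue_snd[OF assms, where 'b='a]
  by eventually_elim (auto simp: Q_set_def mem_Times_iff)

text \<open>
  On the diagonal \<open>K 0\<close> is arbitrary, possibly negative, but the difference factor vanishes there;
  off the diagonal the square of \<open>sqrt K\<close> is \<open>K\<close>.
\<close>

lemma X_iff:
  "g \<in> X \<longleftrightarrow> g \<in> borel_measurable lebesgue \<and> (AE x in lebesgue. x \<notin> \<Omega> \<longrightarrow> g x = 0) \<and>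
     integrable lebesgue (\<lambda>x. (g x)\<^sup>2) \<and> integrable lebesgue (kin g g)"
proof (cases "g \<in> borel_measurable lebesgue \<and> (AE x in lebesgue. x \<notin> \<Omega> \<longrightarrow> g x = 0)")
  case True
  then have g[measurable]: "g \<in> borel_measurable lebesgue" and out: "AE x in lebesgue. x \<notin> \<Omega> \<longrightarrow> g x = 0" by auto
  note [measurable] = borel_measurable_lebesgue_fst[OF g] borel_measurable_lebesgue_snd[OF g] kin_measurable[OF g g]
  have 1: "L2_on \<Omega> g \<longleftrightarrow> integrable lebesgue (\<lambda>x. (g x)\<^sup>2)"
  proof -
    have "integrable (lebesgue_on \<Omega>) (\<lambda>x. (g x)\<^sup>2) \<longleftrightarrow> integrable lebesgue (\<lambda>x. indicator \<Omega> x *\<^sub>R (g x)\<^sup>2)"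
      by (rule integrable_restrict_space) simp
    also have "\<dots> \<longleftrightarrow> integrable lebesgue (\<lambda>x. (g x)\<^sup>2)"
      by (rule integrable_cong_AE, measurable, use out in eventually_elim) (auto simp: indicator_def)
    finally show ?thesis unfolding L2_on_def by (simp add: measurable_restrict_space1)
  qed
  have sq: "((g (fst z) - g (snd z)) * sqrt (K (fst z - snd z)))\<^sup>2 = kin g g z" for z
    using K_pos[of "fst z - snd z"]
    by (cases "fst z = snd z") (auto simp: kin_def power_mult_distrib power2_eq_square[of "g _ - g _"])
  have 2: "L2_on (Q_set \<Omega>) (\<lambda>(x, y). (g x - g y) * sqrt (K (x - y))) \<longleftrightarrow> integrable lebesgue (kin g g)"
  proof -
    have "(\<lambda>z. (g (fst z) - g (snd z)) * sqrt (K (fst z - snd z))) \<in> borel_measurable lebesgue" by measurable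
    then have m: "(\<lambda>z. (g (fst z) - g (snd z)) * sqrt (K (fst z - snd z))) \<in> borel_measurable (lebesgue_on (Q_set \<Omega>))"
      by (rule measurable_restrict_space1)
    have "integrable (lebesgue_on (Q_set \<Omega>)) (kin g g) \<longleftrightarrow> integrable lebesgue (\<lambda>z. indicator (Q_set \<Omega>) z *\<^sub>R kin g g z)"
      by (rule integrable_restrict_space) (simp add: Q_set_lebesgue)
    also have "\<dots> \<longleftrightarrow> integrable lebesgue (kin g g)"
    proof (rule integrable_cong_AE)
      show "AE z in lebesgue. indicator (Q_set \<Omega>) z *\<^sub>R kin g g z = kin g g z"
        using AE_kin_outside[OF out] by eventually_elim (auto simp: indicator_def kin_def)
    qed (use Q_set_lebesgue in measurable)
    finally show ?thesis unfolding L2_on_def using m by (simp add: case_prod_unfold sq)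
  qed
  show ?thesis using True 1 2 by (auto simp: H_space_def)
qed (auto simp: H_space_def)

lemma X_measurable: "u \<in> X \<Longrightarrow> u \<in> borel_measurable lebesgue"
  and X_outside: "u \<in> X \<Longrightarrow> AE x in lebesgue. x \<notin> \<Omega> \<longrightarrow> u x = 0"
  and X_L2: "u \<in> X \<Longrightarrow> integrable lebesgue (\<lambda>x. (u x)\<^sup>2)"
  and X_kin: "u \<in> X \<Longrightarrow> integrable lebesgue (kin u u)"
  by (auto simp: X_iff)

lemma integrable_kin:
  assumes "u \<in> X" "v \<in> X"
  shows "integrable lebesgue (kin u v)"
proof (rule Bochner_Integration.integrable_bound)
  show "integrable lebesgue (\<lambda>z. kin u u z + kin v v z)" using assms by (intro Bochner_Integration.integrable_add X_kin)
  show "kin u v \<in> borel_measurable lebesgue" using assms by (intro kin_measurable X_measurable)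
  show "AE z in lebesgue. norm (kin u v z) \<le> norm (kin u u z + kin v v z)"
    using kin_abs_le[of u v] kin_nonneg[of u] kin_nonneg[of v] by (auto simp: abs_of_nonneg)
qed

lemma integrable_mult_X:
  assumes "u \<in> X" "v \<in> X"
  shows "integrable lebesgue (\<lambda>x. u x * v x)"
proof (rule Bochner_Integration.integrable_bound)
  note [measurable] = X_measurable[OF assms(1)] X_measurable[OF assms(2)]
  show "integrable lebesgue (\<lambda>x. (u x)\<^sup>2 + (v x)\<^sup>2)" using assms by (intro Bochner_Integration.integrable_add X_L2)
  show "(\<lambda>x. u x * v x) \<in> borel_measurable lebesgue" by measurable
  show "AE x in lebesgue. norm (u x * v x) \<le> norm ((u x)\<^sup>2 + (v x)\<^sup>2)"
    using abs_mult_le_squares by (simp add: abs_of_nonneg)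
qed

lemma X_scale_add:
  assumes u: "u \<in> X" and v: "v \<in> X"
  shows "(\<lambda>x. c * u x + d * v x) \<in> X"
proof -
  let ?w = "\<lambda>x. c * u x + d * v x"
  note [measurable] = X_measurable[OF u] X_measurable[OF v]
  have m: "?w \<in> borel_measurable lebesgue" by measurable
  have out: "AE x in lebesgue. x \<notin> \<Omega> \<longrightarrow> ?w x = 0"
    using X_outside[OF u] X_outside[OF v] by eventually_elim auto
  have "(\<lambda>x. (?w x)\<^sup>2) = (\<lambda>x. c\<^sup>2 * (u x)\<^sup>2 + 2 * c * d * (u x * v x) + d\<^sup>2 * (v x)\<^sup>2)"
    by (auto simp: power2_eq_square algebra_simps)
  then have L2: "integrable lebesgue (\<lambda>x. (?w x)\<^sup>2)"
    using X_L2[OF u] X_L2[OF v] integrable_mult_X[OF u v]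
    by (simp add: Bochner_Integration.integrable_add)
  have "kin ?w ?w = (\<lambda>z. c\<^sup>2 * kin u u z + 2 * c * d * kin u v z + d\<^sup>2 * kin v v z)"
    by (auto simp: kin_def power2_eq_square algebra_simps)
  then have "integrable lebesgue (kin ?w ?w)"
    using integrable_kin[OF u u] integrable_kin[OF u v] integrable_kin[OF v v]
    by (simp add: Bochner_Integration.integrable_add)
  with m out L2 show ?thesis by (simp add: X_iff)
qed

lemma kin_contraction_le:
  assumes F: "\<And>a b :: real. \<bar>F a - F b\<bar> \<le> \<bar>a - b\<bar>"
  shows "kin (\<lambda>x. F (w x)) (\<lambda>x. F (w x)) z \<le> kin w w z"
proof (cases "fst z = snd z")
  case False
  have "(F a - F b) * (F a - F b) \<le> (a - b) * (a - b)" for a b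
    using F[of a b] abs_le_square_iff[of "F a - F b" "a - b"] by (simp add: power2_eq_square)
  from mult_right_mono[OF this] show ?thesis
    using K_pos[of "fst z - snd z"] False by (simp add: kin_def)
qed (simp add: kin_def)

text \<open>
  Positive part, negative part and absolute value are contractions fixing zero, and therefore act
  on \<open>H\<close>.
\<close>

lemma X_contraction:
  assumes u: "u \<in> X" and F: "F 0 = 0" "\<And>a b :: real. \<bar>F a - F b\<bar> \<le> \<bar>a - b\<bar>"
  shows "(\<lambda>x. F (u x)) \<in> X"
proof -
  let ?w = "\<lambda>x. F (u x)"
  note [measurable] = X_measurable[OF u]
  have [measurable]: "F \<in> borel_measurable borel"
    by (intro borel_measurable_continuous_onI) (simp add: continuous_on_eq_continuous_at contraction_isCont[OF F(2)])
  have m: "?w \<in> borel_measurable lebesgue" by measurable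
  have out: "AE x in lebesgue. x \<notin> \<Omega> \<longrightarrow> ?w x = 0"
    using X_outside[OF u] by eventually_elim (auto simp: F)
  have L2: "integrable lebesgue (\<lambda>x. (?w x)\<^sup>2)"
  proof (rule Bochner_Integration.integrable_bound[OF X_L2[OF u]])
    have "(F a)\<^sup>2 \<le> a\<^sup>2" for a using F(2)[of a 0] F(1) by (simp add: abs_le_square_iff)
    then show "AE x in lebesgue. norm ((F (u x))\<^sup>2) \<le> norm ((u x)\<^sup>2)" by simp
  qed measurable
  have kin: "integrable lebesgue (kin ?w ?w)"
  proof (rule Bochner_Integration.integrable_bound[OF X_kin[OF u]])
    show "kin ?w ?w \<in> borel_measurable lebesgue" by (intro kin_measurable m)
    show "AE z in lebesgue. norm (kin ?w ?w z) \<le> norm (kin u u z)"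
      using kin_contraction_le[OF F(2)] kin_nonneg by (auto simp: abs_of_nonneg)
  qed
  from m out L2 kin show ?thesis by (simp add: X_iff)
qed

lemma pos_part_X: "u \<in> X \<Longrightarrow> pos_part u \<in> X"
  unfolding pos_part_def[abs_def] by (rule X_contraction[of u "\<lambda>a. max a 0"]) (auto simp: max_def)

lemma neg_part_X: "u \<in> X \<Longrightarrow> neg_part u \<in> X"
  unfolding neg_part_def[abs_def] by (rule X_contraction[of u "\<lambda>a. min a 0"]) (auto simp: min_def)

lemma scale_X: "u \<in> X \<Longrightarrow> (\<lambda>x. c * u x) \<in> X"
  using X_scale_add[of u u c 0] by simp

lemma diff_X: "u \<in> X \<Longrightarrow> v \<in> X \<Longrightarrow> (\<lambda>x. u x - v x) \<in> X"
  using X_scale_add[of u v 1 "-1"] by simp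

lemma B_nonneg: "0 \<le> B u u"
  unfolding B_def by (intro integral_nonneg_AE) (simp add: kin_nonneg)

lemma B_sym: "B u v = B v u"
  unfolding B_def kin_def by (simp add: mult.commute)

lemma B_linear:
  assumes "u \<in> X" "v \<in> X" "w \<in> X"
  shows "B (\<lambda>x. c * u x + d * v x) w = c * B u w + d * B v w"
proof -
  have "kin (\<lambda>x. c * u x + d * v x) w = (\<lambda>z. c * kin u w z + d * kin v w z)"
    by (auto simp: kin_def algebra_simps)
  then show ?thesis unfolding B_def
    using integrable_kin[OF assms(1,3)] integrable_kin[OF assms(2,3)] by simp
qed

lemma H_inner_eq:
  assumes u: "u \<in> X" and v: "v \<in> X"
  shows "H_inner \<Omega> K u v = B u v"
proof -
  have "H_inner \<Omega> K u v = (\<integral>z. kin u v z \<partial>lebesgue_on (Q_set \<Omega>))"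
    by (simp add: H_inner_def kin_def[abs_def] case_prod_unfold)
  also have "\<dots> = (\<integral>z. indicator (Q_set \<Omega>) z *\<^sub>R kin u v z \<partial>lebesgue)"
    by (rule integral_restrict_space) (simp add: Q_set_lebesgue)
  also have "\<dots> = B u v"
    unfolding B_def
  proof (rule integral_cong_AE)
    show "AE z in lebesgue. indicator (Q_set \<Omega>) z *\<^sub>R kin u v z = kin u v z"
      using AE_kin_outside[OF X_outside[OF u]] by eventually_elim (auto simp: indicator_def kin_def)
    show "kin u v \<in> borel_measurable lebesgue" by (intro kin_measurable X_measurable u v)
    then show "(\<lambda>z. indicator (Q_set \<Omega>) z *\<^sub>R kin u v z) \<in> borel_measurable lebesgue"
      using Q_set_lebesgue by measurable
  qed
  finally show ?thesis .
qed

lemma W_measurable [measurable]: "W \<in> borel_measurable lebesgue"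
proof -
  have "V \<in> borel_measurable (lebesgue_on \<Omega>)" using V_Linf by (simp add: Linf_on_def)
  then have "(\<lambda>x. indicator \<Omega> x *\<^sub>R V x) \<in> borel_measurable lebesgue"
    using borel_measurable_restrict_space_iff[of \<Omega> lebesgue V] by simp
  then show ?thesis by (simp add: W_def[abs_def])
qed

lemma W_bounded: "\<exists>C>0. AE x in lebesgue. \<bar>W x\<bar> \<le> C"
proof -
  obtain C where "AE x in lebesgue_on \<Omega>. \<bar>V x\<bar> \<le> C" using V_Linf by (auto simp: Linf_on_def)
  then have "AE x in lebesgue. x \<in> \<Omega> \<longrightarrow> \<bar>V x\<bar> \<le> C"
    by (subst (asm) AE_restrict_space_iff) simp_all
  then have "AE x in lebesgue. \<bar>W x\<bar> \<le> max C 1"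
    by eventually_elim (auto simp: W_def indicator_def)
  then show ?thesis by (intro exI[of _ "max C 1"]) auto
qed

lemma integral_dom:
  fixes f :: "'a \<Rightarrow> real"
  shows "(LINT x|lebesgue_on \<Omega>. f x) = (\<integral>x. indicator \<Omega> x * f x \<partial>lebesgue)"
  by (subst integral_restrict_space) auto

lemma integral_V: "(LINT x|lebesgue_on \<Omega>. V x * f x) = (\<integral>x. W x * f x \<partial>lebesgue)"
  by (simp add: integral_dom W_def mult.assoc)

lemma integrable_W_mult:
  assumes "integrable lebesgue f"
  shows "integrable lebesgue (\<lambda>x. W x * f x)"
proof -
  obtain C where C: "AE x in lebesgue. \<bar>W x\<bar> \<le> C" "C > 0" using W_bounded by blast
  have [measurable]: "f \<in> borel_measurable lebesgue" using assms by simp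
  show ?thesis
  proof (rule Bochner_Integration.integrable_bound)
    show "integrable lebesgue (\<lambda>x. C * \<bar>f x\<bar>)" using assms by simp
    show "AE x in lebesgue. norm (W x * f x) \<le> norm (C * \<bar>f x\<bar>)"
      using C(1) by eventually_elim (use C(2) in \<open>auto simp: abs_mult intro!: mult_right_mono\<close>)
  qed measurable
qed

text \<open>
  The quadratic part of the energy and its \<open>L\<^sup>p\<close> part; \<open>N u\<close> is the derivative of \<open>P / p\<close> at \<open>u\<close>, so
  that the weak equation reads \<open>a u \<phi> = N u \<phi>\<close>.
\<close>

definition a :: "('a \<Rightarrow> real) \<Rightarrow> ('a \<Rightarrow> real) \<Rightarrow> real" where
  "a u v = B u v + (\<integral>x. W x * (u x * v x) \<partial>lebesgue)"

definition P :: "('a \<Rightarrow> real) \<Rightarrow> real" where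
  "P u = (\<integral>x. \<bar>u x\<bar> powr p \<partial>lebesgue)"

definition E :: "('a \<Rightarrow> real) \<Rightarrow> real" where
  "E u = a u u / 2 - P u / p"

definition N :: "('a \<Rightarrow> real) \<Rightarrow> ('a \<Rightarrow> real) \<Rightarrow> real" where
  "N u \<phi> = (\<integral>x. \<bar>u x\<bar> powr (p - 2) * u x * \<phi> x \<partial>lebesgue)"

lemma a_sym: "a u v = a v u"
  unfolding a_def by (simp add: B_sym[of u v] mult.commute)

lemma a_linear:
  assumes "u \<in> X" "v \<in> X" "w \<in> X"
  shows "a (\<lambda>x. c * u x + d * v x) w = c * a u w + d * a v w"
proof -
  have i: "integrable lebesgue (\<lambda>x. W x * (u x * w x))" "integrable lebesgue (\<lambda>x. W x * (v x * w x))"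
    using assms by (auto intro!: integrable_W_mult integrable_mult_X)
  have "(\<integral>x. W x * ((c * u x + d * v x) * w x) \<partial>lebesgue)
    = (\<integral>x. c * (W x * (u x * w x)) + d * (W x * (v x * w x)) \<partial>lebesgue)"
    by (simp add: algebra_simps)
  also have "\<dots> = c * (\<integral>x. W x * (u x * w x) \<partial>lebesgue) + d * (\<integral>x. W x * (v x * w x) \<partial>lebesgue)"
    using i by simp
  finally show ?thesis unfolding a_def B_linear[OF assms] by (simp add: algebra_simps)
qed

lemma a_linear_right:
  assumes "u \<in> X" "v \<in> X" "w \<in> X"
  shows "a w (\<lambda>x. c * u x + d * v x) = c * a w u + d * a w v"
  unfolding a_sym[of w] by (rule a_linear[OF assms])

lemma a_scale: "u \<in> X \<Longrightarrow> w \<in> X \<Longrightarrow> a (\<lambda>x. c * u x) w = c * a u w"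
  using a_linear[of u u w c 0] by simp

lemma B_scale: "u \<in> X \<Longrightarrow> B (\<lambda>x. c * u x) (\<lambda>x. c * u x) = c\<^sup>2 * B u u"
  using B_linear[of u u "\<lambda>x. c * u x" c 0] B_linear[of u u u c 0] B_sym[of u "\<lambda>x. c * u x"]
  by (simp add: scale_X power2_eq_square)

lemma a_square:
  assumes "u \<in> X" "v \<in> X"
  shows "a (\<lambda>x. c * u x + d * v x) (\<lambda>x. c * u x + d * v x) = c\<^sup>2 * a u u + 2 * c * d * a u v + d\<^sup>2 * a v v"
  unfolding a_linear[OF assms X_scale_add[OF assms]] a_linear_right[OF assms assms(1)] a_linear_right[OF assms assms(2)]
  by (simp add: a_sym[of v u] power2_eq_square algebra_simps)

lemma energy_eq:
  assumes "u \<in> X"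
  shows "energy \<Omega> K V p u = E u"
proof -
  have "(H_norm \<Omega> K u)\<^sup>2 = B u u"
    by (simp add: H_norm_def H_inner_eq[OF assms assms] B_nonneg)
  moreover have "(Lq_norm p u) powr p = P u"
  proof -
    have "P u \<ge> 0" unfolding P_def by simp
    then show ?thesis using p_gt by (simp add: Lq_norm_def powr_powr flip: P_def)
  qed
  moreover have "(LINT x|lebesgue_on \<Omega>. V x * (u x)\<^sup>2) = (\<integral>x. W x * (u x * u x) \<partial>lebesgue)"
    by (simp add: integral_V power2_eq_square)
  ultimately show ?thesis by (simp add: energy_def E_def a_def add_divide_distrib)
qed

lemma weak_solution_iff:
  "weak_solution \<Omega> K V p u \<longleftrightarrow> u \<in> X \<and> (\<forall>\<phi>\<in>X. a u \<phi> = N u \<phi>)"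
proof -
  have "(LINT x|lebesgue_on \<Omega>. \<bar>u x\<bar> powr (p - 2) * u x * \<phi> x) = N u \<phi>" if u: "u \<in> X" and "\<phi> \<in> X" for \<phi>
  proof -
    note [measurable] = X_measurable[OF u] X_measurable[OF \<open>\<phi> \<in> X\<close>]
    show ?thesis unfolding integral_dom N_def
      by (rule integral_cong_AE, measurable, use X_outside[OF u] in eventually_elim) (auto simp: indicator_def)
  qed
  moreover have "(LINT x|lebesgue_on \<Omega>. V x * u x * \<phi> x) = (\<integral>x. W x * (u x * \<phi> x) \<partial>lebesgue)" for \<phi>
    using integral_V[of "\<lambda>x. u x * \<phi> x"] by (simp add: mult.assoc)
  ultimately show ?thesis by (auto simp: weak_solution_def a_def H_inner_eq)
qed

lemma a_pos:
  assumes "u \<in> X" "\<not> ae_zero u"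
  shows "a u u > 0"
proof -
  have "(H_norm \<Omega> K u)\<^sup>2 = B u u"
    by (simp add: H_norm_def H_inner_eq[OF assms(1) assms(1)] B_nonneg)
  moreover have "(LINT x|lebesgue_on \<Omega>. V x * (u x)\<^sup>2) = (\<integral>x. W x * (u x * u x) \<partial>lebesgue)"
    by (simp add: integral_V power2_eq_square)
  ultimately show ?thesis using pos_def assms by (auto simp: positive_definite_op_def a_def)
qed

lemma ae_zero_kin:
  assumes "ae_zero u"
  shows "AE z in lebesgue. kin u v z = 0"
  using AE_lebesgue_fst[OF assms[unfolded ae_zero_def], where 'b='a] AE_lebesgue_snd[OF assms[unfolded ae_zero_def], where 'b='a]
  by eventually_elim (simp add: kin_def)

lemma a_ae_zero:
  assumes "ae_zero u"
  shows "a u v = 0"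
proof -
  have "B u v = 0" unfolding B_def by (rule integral_eq_zero_AE[OF ae_zero_kin[OF assms]])
  moreover have "(\<integral>x. W x * (u x * v x) \<partial>lebesgue) = 0"
    using assms unfolding ae_zero_def by (intro integral_eq_zero_AE) (auto elim: eventually_mono)
  ultimately show ?thesis by (simp add: a_def)
qed

lemma a_nonneg: "u \<in> X \<Longrightarrow> a u u \<ge> 0"
  using a_pos[of u] a_ae_zero[of u u] by (cases "ae_zero u") auto

end

section \<open>Compact embedding and coercivity\<close>

context nonlocal_problem
begin

lemma dom_in_ball: "\<exists>R>0. \<forall>x\<in>\<Omega>. norm x < R"
proof -
  obtain R where "R > 0" "\<And>x. x \<in> \<Omega> \<Longrightarrow> norm x \<le> R"
    using bounded_dom bounded_pos by blast
  then show ?thesis by (intro exI[of _ "R + 1"]) force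
qed

text \<open>
  The iterated integrals above are defined for Borel functions. A representative can be chosen to
  vanish everywhere outside \<open>\<Omega>\<close> because \<open>\<Omega>\<close> is open, hence Borel.
\<close>

lemma borel_representative:
  assumes u: "u \<in> X"
  shows "\<exists>w. w \<in> borel_measurable borel \<and> (AE x in lebesgue. u x = w x) \<and> (\<forall>x. x \<notin> \<Omega> \<longrightarrow> w x = 0)"
proof -
  obtain w where w[measurable]: "w \<in> borel_measurable lborel" and ae: "AE x in lborel. u x = w x"
    using completion_ex_borel_measurable_real[OF X_measurable[OF u]] by blast
  have [measurable]: "\<Omega> \<in> sets borel" using open_dom by simp
  have "(\<lambda>x. indicator \<Omega> x * w x) \<in> borel_measurable borel" using w by simp
  moreover have "AE x in lebesgue. u x = w x" using ae by (simp add: AE_completion_iff)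
  then have "AE x in lebesgue. u x = indicator \<Omega> x * w x"
    using X_outside[OF u] by eventually_elim (auto simp: indicator_def)
  ultimately show ?thesis by (intro exI[of _ "\<lambda>x. indicator \<Omega> x * w x"]) auto
qed

lemma nn_integral_representative:
  fixes f :: "real \<Rightarrow> real"
  assumes "AE x in lebesgue. u x = w x"
  shows "(\<integral>\<^sup>+ x. ennreal (f (w x)) \<partial>lborel) = (\<integral>\<^sup>+ x. ennreal (f (u x)) \<partial>lebesgue)"
proof -
  have "(\<integral>\<^sup>+ x. ennreal (f (u x)) \<partial>lebesgue) = (\<integral>\<^sup>+ x. ennreal (f (w x)) \<partial>lebesgue)"
    by (rule nn_integral_cong_AE, use assms in eventually_elim) simp
  then show ?thesis by (simp add: nn_integral_completion)
qed

text \<open>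
  The lower bound on \<open>K\<close> embeds \<open>H\<close> into the fractional Sobolev space, so that the inequalities for
  the Gagliardo seminorm become inequalities for the norm of \<open>H\<close>.
\<close>

lemma gagliardo_le_B:
  "\<exists>c>0. \<forall>u w. u \<in> X \<longrightarrow> w \<in> borel_measurable borel \<longrightarrow> (AE x in lebesgue. u x = w x) \<longrightarrow>
     gagliardo s w \<le> ennreal (c * B u u)"
proof -
  obtain \<theta> where \<theta>: "\<theta> > 0" "\<And>x. x \<noteq> 0 \<Longrightarrow> K x \<ge> \<theta> * norm x powr (- (real DIM('a) + 2 * s))"
    using K_lower by blast
  show ?thesis
  proof (intro exI[of _ "1 / \<theta>"] conjI allI impI)
    fix u w assume u: "u \<in> X" and w[measurable]: "w \<in> borel_measurable borel" and ae: "AE x in lebesgue. u x = w x"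
    define f where "f = (\<lambda>z :: 'a \<times> 'a. ennreal ((w (fst z) - w (snd z))\<^sup>2 * norm (fst z - snd z) powr (- (real DIM('a) + 2 * s))))"
    have f: "f \<in> borel_measurable (lborel \<Otimes>\<^sub>M lborel)" unfolding f_def by measurable
    have "gagliardo s w = (\<integral>\<^sup>+ x. \<integral>\<^sup>+ y. f (x, y) \<partial>lborel \<partial>lborel)"
      by (simp add: gagliardo_def gagliardo_density_def f_def)
    also have "\<dots> = (\<integral>\<^sup>+ z. f z \<partial>(lborel \<Otimes>\<^sub>M lborel))" by (rule lborel.nn_integral_fst[OF f])
    also have "\<dots> = (\<integral>\<^sup>+ z. f z \<partial>lebesgue)" by (simp add: lborel_prod nn_integral_completion)
    also have "\<dots> \<le> (\<integral>\<^sup>+ z. ennreal (1 / \<theta> * kin u u z) \<partial>lebesgue)"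
    proof (rule nn_integral_mono_AE)
      show "AE z in lebesgue. f z \<le> ennreal (1 / \<theta> * kin u u z)"
        using AE_lebesgue_fst[OF ae, where 'b='a] AE_lebesgue_snd[OF ae, where 'b='a]
      proof eventually_elim
        case (elim z)
        show ?case
        proof (cases "fst z = snd z")
          case False
          then have "norm (fst z - snd z) powr (- (real DIM('a) + 2 * s)) \<le> 1 / \<theta> * K (fst z - snd z)"
            using \<theta>(2)[of "fst z - snd z"] \<theta>(1) by (simp add: field_simps)
          from mult_left_mono[OF this, of "(w (fst z) - w (snd z))\<^sup>2"] show ?thesis
            unfolding f_def using elim by (intro ennreal_leI) (simp add: kin_def power2_eq_square mult_ac)
        qed (simp add: f_def kin_def)
      qed
    qed
    also have "\<dots> = ennreal (\<integral>z. 1 / \<theta> * kin u u z \<partial>lebesgue)"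
      using X_kin[OF u] kin_nonneg[of u] \<theta>(1) by (intro nn_integral_eq_integral) auto
    also have "(\<integral>z. 1 / \<theta> * kin u u z \<partial>lebesgue) = 1 / \<theta> * B u u" by (simp add: B_def)
    finally show "gagliardo s w \<le> ennreal (1 / \<theta> * B u u)" .
  qed (use \<theta> in auto)
qed

lemma L2_norm_nn:
  assumes "u \<in> X"
  shows "square_integral lebesgue u = ennreal (\<integral>x. (u x)\<^sup>2 \<partial>lebesgue)"
  by (rule nn_integral_eq_integral[OF X_L2[OF assms]]) simp

lemma poincare: "\<exists>C>0. \<forall>u\<in>X. (\<integral>x. (u x)\<^sup>2 \<partial>lebesgue) \<le> C * B u u"
proof -
  obtain c where c: "c > 0" "\<And>u w. u \<in> X \<Longrightarrow> w \<in> borel_measurable borel \<Longrightarrow> AE x in lebesgue. u x = w x \<Longrightarrow>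
     gagliardo s w \<le> ennreal (c * B u u)"
    using gagliardo_le_B by blast
  define m where "m = measure lborel \<Omega> + 1"
  have m: "m > 0" by (simp add: m_def add_nonneg_pos)
  have vol: "emeasure lborel \<Omega> \<le> ennreal m"
  proof -
    have "emeasure lborel \<Omega> \<noteq> \<infinity>"
      using emeasure_bounded_finite[OF bounded_dom] by auto
    then have "emeasure lborel \<Omega> = ennreal (measure lborel \<Omega>)"
      by (intro emeasure_eq_ennreal_measure) auto
    then show ?thesis by (simp add: m_def ennreal_leI)
  qed
  define L where "L = level_const s TYPE('a) * m powr (2 * s / real DIM('a))"
  have L: "L > 0" using level_const_pos[of s, where 'a='a] m by (simp add: L_def)
  show ?thesis
  proof (intro exI[of _ "L * c"] conjI ballI)
    fix u assume u: "u \<in> X"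
    obtain w where w: "w \<in> borel_measurable borel" "AE x in lebesgue. u x = w x" "\<And>x. x \<notin> \<Omega> \<Longrightarrow> w x = 0"
      using borel_representative[OF u] by blast
    have supp: "emeasure lborel {y. w y \<noteq> 0} \<le> ennreal m"
      using open_dom w(3) by (intro order_trans[OF emeasure_mono vol]) auto
    have "ennreal (\<integral>x. (u x)\<^sup>2 \<partial>lebesgue) = square_integral lborel w"
      using nn_integral_representative[OF w(2), of "\<lambda>t. t\<^sup>2"] L2_norm_nn[OF u] by simp
    also have "\<dots> \<le> ennreal L * gagliardo s w"
      unfolding L_def by (rule gagliardo_poincare[OF w(1) s_pos m supp])
    also have "\<dots> \<le> ennreal L * ennreal (c * B u u)"
      by (intro mult_left_mono c u w) auto
    also have "\<dots> = ennreal (L * c * B u u)"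
      using L c(1) B_nonneg[of u] by (simp add: mult.assoc flip: ennreal_mult)
    finally show "(\<integral>x. (u x)\<^sup>2 \<partial>lebesgue) \<le> L * c * B u u"
      using L c(1) B_nonneg[of u] by (simp add: ennreal_le_iff)
  qed (use L c in auto)
qed

lemma sobolev:
  assumes M: "M \<ge> 0"
  shows "\<exists>C e. C > 0 \<and> e > 0 \<and> (\<forall>u\<in>X. \<forall>Y>0. B u u \<le> M \<longrightarrow> (\<integral>x. (u x)\<^sup>2 \<partial>lebesgue) \<le> Y \<longrightarrow>
    power_integral p lebesgue u \<le> ennreal (Y + C * Y powr e))"
proof -
  obtain c where c: "c > 0" "\<And>u w. u \<in> X \<Longrightarrow> w \<in> borel_measurable borel \<Longrightarrow> AE x in lebesgue. u x = w x \<Longrightarrow>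
     gagliardo s w \<le> ennreal (c * B u u)"
    using gagliardo_le_B by blast
  have "c * M \<ge> 0" using c M by simp
  then obtain C e where C: "C > 0" "e > 0"
    and *: "\<And>u :: 'a \<Rightarrow> real. \<And>Y. u \<in> borel_measurable borel \<Longrightarrow> Y > 0 \<Longrightarrow>
      gagliardo s u \<le> ennreal (c * M) \<Longrightarrow> square_integral lborel u \<le> ennreal Y \<Longrightarrow>
      power_integral p lborel u \<le> ennreal (Y + C * Y powr e)"
    using gagliardo_sobolev[OF s_pos s_dim _ _ p_lt, of "c * M"] p_gt by auto
  show ?thesis
  proof (rule exI[of _ C], rule exI[of _ e], intro conjI ballI allI impI C)
    fix u and Y :: real assume u: "u \<in> X" and Y: "0 < Y" "B u u \<le> M" "(\<integral>x. (u x)\<^sup>2 \<partial>lebesgue) \<le> Y"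
    obtain w where w: "w \<in> borel_measurable borel" "AE x in lebesgue. u x = w x" "\<And>x. x \<notin> \<Omega> \<Longrightarrow> w x = 0"
      using borel_representative[OF u] by blast
    have "gagliardo s w \<le> ennreal (c * B u u)" by (rule c(2)[OF u w(1,2)])
    also have "\<dots> \<le> ennreal (c * M)" using c(1) Y(2) by (intro ennreal_leI mult_left_mono) auto
    finally have g: "gagliardo s w \<le> ennreal (c * M)" .
    have "square_integral lborel w \<le> ennreal Y"
      using nn_integral_representative[OF w(2), of "\<lambda>t. t\<^sup>2"] L2_norm_nn[OF u] Y(3) by (simp add: ennreal_leI)
    from *[OF w(1) Y(1) g this] show "power_integral p lebesgue u \<le> ennreal (Y + C * Y powr e)"
      using nn_integral_representative[OF w(2), of "\<lambda>t. \<bar>t\<bar> powr p"] by simp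
  qed
qed

lemma X_Lp:
  assumes u: "u \<in> X"
  shows "integrable lebesgue (\<lambda>x. \<bar>u x\<bar> powr p)"
proof (rule integrableI_bounded)
  note [measurable] = X_measurable[OF u]
  show "(\<lambda>x. \<bar>u x\<bar> powr p) \<in> borel_measurable lebesgue" by measurable
  obtain C e where *: "\<And>v Y. v \<in> X \<Longrightarrow> Y > 0 \<Longrightarrow> B v v \<le> B u u \<Longrightarrow> (\<integral>x. (v x)\<^sup>2 \<partial>lebesgue) \<le> Y \<Longrightarrow>
    power_integral p lebesgue v \<le> ennreal (Y + C * Y powr e)"
    using sobolev[OF B_nonneg[of u]] by blast
  have "(\<integral>x. (u x)\<^sup>2 \<partial>lebesgue) + 1 > 0" by (intro add_nonneg_pos) auto
  from *[OF u this] show "(\<integral>\<^sup>+ x. ennreal (norm (\<bar>u x\<bar> powr p)) \<partial>lebesgue) < \<infinity>"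
    by (auto simp: order_le_less_trans)
qed

lemma P_nn: "u \<in> X \<Longrightarrow> power_integral p lebesgue u = ennreal (P u)"
  unfolding P_def by (rule nn_integral_eq_integral[OF X_Lp]) auto

lemma P_nonneg: "P u \<ge> 0"
  unfolding P_def by simp

lemma P_ae_zero: "ae_zero u \<Longrightarrow> P u = 0"
  unfolding P_def ae_zero_def by (intro integral_eq_zero_AE) (auto elim: eventually_mono)

lemma P_bounded: "\<exists>C>0. \<forall>u\<in>X. B u u \<le> 1 \<longrightarrow> P u \<le> C"
proof -
  obtain D where D: "D > 0" "\<And>u. u \<in> X \<Longrightarrow> (\<integral>x. (u x)\<^sup>2 \<partial>lebesgue) \<le> D * B u u" using poincare by blast
  obtain C e where C: "C > 0" and *: "\<And>v Y. v \<in> X \<Longrightarrow> Y > 0 \<Longrightarrow> B v v \<le> 1 \<Longrightarrow> (\<integral>x. (v x)\<^sup>2 \<partial>lebesgue) \<le> Y \<Longrightarrow>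
    power_integral p lebesgue v \<le> ennreal (Y + C * Y powr e)"
    using sobolev[OF zero_le_one] by blast
  have pos: "D + C * D powr e > 0" using C D(1) by (intro add_pos_nonneg) auto
  show ?thesis
  proof (intro exI[of _ "D + C * D powr e"] conjI ballI impI pos)
    fix u assume u: "u \<in> X" "B u u \<le> 1"
    have "(\<integral>x. (u x)\<^sup>2 \<partial>lebesgue) \<le> D"
      using D(2)[OF u(1)] mult_left_mono[OF u(2), of D] D(1) by linarith
    from *[OF u(1) D(1) u(2) this] show "P u \<le> D + C * D powr e"
      using pos by (simp add: P_nn[OF u(1)] ennreal_le_iff)
  qed
qed

lemma kin_tendsto:
  assumes "AE x in lebesgue. (\<lambda>n. u n x) \<longlonglongrightarrow> (v x :: real)"
  shows "AE z in lebesgue. (\<lambda>n. kin (u n) (u n) z) \<longlonglongrightarrow> kin v v z"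
  using AE_lebesgue_fst[OF assms, where 'b='a] AE_lebesgue_snd[OF assms, where 'b='a]
  unfolding kin_def by eventually_elim (intro tendsto_intros)

lemma kin_fatou:
  assumes u: "\<And>n. u n \<in> borel_measurable lebesgue"
    and lim: "AE x in lebesgue. (\<lambda>n. u n x) \<longlonglongrightarrow> v x"
  shows "(\<integral>\<^sup>+ z. ennreal (kin v v z) \<partial>lebesgue) \<le> liminf (\<lambda>n. \<integral>\<^sup>+ z. ennreal (kin (u n) (u n) z) \<partial>lebesgue)"
proof -
  have "(\<integral>\<^sup>+ z. ennreal (kin v v z) \<partial>lebesgue) = (\<integral>\<^sup>+ z. liminf (\<lambda>n. ennreal (kin (u n) (u n) z)) \<partial>lebesgue)"
  proof (rule nn_integral_cong_AE, use kin_tendsto[OF lim] in eventually_elim)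
    case (elim z)
    then show ?case by (intro lim_imp_Liminf[symmetric] tendsto_ennrealI) auto
  qed
  also have "\<dots> \<le> liminf (\<lambda>n. \<integral>\<^sup>+ z. ennreal (kin (u n) (u n) z) \<partial>lebesgue)"
    using kin_measurable[OF u u] by (intro nn_integral_liminf) auto
  finally show ?thesis .
qed

lemma kin_nn: "u \<in> X \<Longrightarrow> (\<integral>\<^sup>+ z. ennreal (kin u u z) \<partial>lebesgue) = ennreal (B u u)"
  unfolding B_def by (rule nn_integral_eq_integral[OF X_kin]) (auto simp: kin_nonneg)

lemma X_limit:
  assumes u: "\<And>n. u n \<in> X" and M: "\<And>n. B (u n) (u n) \<le> M"
    and v: "v \<in> borel_measurable lebesgue" "integrable lebesgue (\<lambda>x. (v x)\<^sup>2)"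
    and lim: "AE x in lebesgue. (\<lambda>n. u n x) \<longlonglongrightarrow> v x"
  shows "v \<in> X"
proof -
  have "AE x in lebesgue. \<forall>n. x \<notin> \<Omega> \<longrightarrow> u n x = 0"
    unfolding AE_all_countable using X_outside[OF u] by blast
  then have out: "AE x in lebesgue. x \<notin> \<Omega> \<longrightarrow> v x = 0"
    using lim by eventually_elim (auto simp: LIMSEQ_const_iff)
  have "(\<integral>\<^sup>+ z. ennreal (kin v v z) \<partial>lebesgue) \<le> liminf (\<lambda>n. \<integral>\<^sup>+ z. ennreal (kin (u n) (u n) z) \<partial>lebesgue)"
    by (rule kin_fatou[OF X_measurable[OF u] lim])
  also have "\<dots> \<le> ennreal M"
    by (rule Liminf_le) (auto simp: kin_nn[OF u] intro!: always_eventually ennreal_leI M)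
  finally have "integrable lebesgue (kin v v)"
    using kin_measurable[OF v(1) v(1)] kin_nonneg[of v]
    by (intro integrableI_bounded) (auto simp: order_le_less_trans)
  with v out show ?thesis by (simp add: X_iff)
qed

text \<open>
  The compact embedding of \<open>H\<close>, in the form that the variational argument consumes: no weak
  topology, but a subsequence converging almost everywhere under one majorant for both powers.
\<close>

lemma compactness:
  assumes u: "\<And>n. u n \<in> X" and M: "\<And>n. B (u n) (u n) \<le> M"
  shows "\<exists>(r :: nat \<Rightarrow> nat) v g. strict_mono r \<and> v \<in> X \<and> integrable lebesgue g \<and>
    (AE x in lebesgue. (\<lambda>n. u (r n) x) \<longlonglongrightarrow> v x) \<and>
    (AE x in lebesgue. \<forall>n. (u (r n) x)\<^sup>2 \<le> g x \<and> \<bar>u (r n) x\<bar> powr p \<le> g x)"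
proof -
  have M0: "M \<ge> 0" using B_nonneg[of "u 0"] M[of 0] by linarith
  obtain c where c: "c > 0" "\<And>u w. u \<in> X \<Longrightarrow> w \<in> borel_measurable borel \<Longrightarrow> AE x in lebesgue. u x = w x \<Longrightarrow>
     gagliardo s w \<le> ennreal (c * B u u)"
    using gagliardo_le_B by blast
  obtain D where D: "D > 0" "\<And>u. u \<in> X \<Longrightarrow> (\<integral>x. (u x)\<^sup>2 \<partial>lebesgue) \<le> D * B u u" using poincare by blast
  obtain R where R: "\<And>x. x \<in> \<Omega> \<Longrightarrow> norm x < R" using dom_in_ball by blast
  have "\<forall>n. \<exists>w. w \<in> borel_measurable borel \<and> (AE x in lebesgue. u n x = w x) \<and> (\<forall>x. x \<notin> \<Omega> \<longrightarrow> w x = 0)"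
    using borel_representative[OF u] by blast
  from choice[OF this] obtain w where w: "\<And>n. w n \<in> borel_measurable borel" "\<And>n. AE x in lebesgue. u n x = w n x"
    "\<And>n x. x \<notin> \<Omega> \<Longrightarrow> w n x = 0" by blast
  have supp: "AE x in lborel. norm x \<ge> R \<longrightarrow> w n x = 0" for n
  proof (intro AE_I2 impI)
    fix x :: 'a assume "R \<le> norm x"
    then have "x \<notin> \<Omega>" using R[of x] by auto
    then show "w n x = 0" by (rule w(3))
  qed
  have gM: "gagliardo s (w n) \<le> ennreal (c * M)" for n
    using mult_left_mono[OF M, of c n] c(1)
    by (intro order_trans[OF c(2)[OF u w(1,2), of n]] ennreal_leI) simp
  have L2u: "(\<integral>x. (u n x)\<^sup>2 \<partial>lebesgue) \<le> D * M" for n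
    using D(2)[OF u, of n] mult_left_mono[OF M, of D n] D(1) by linarith
  have L2M: "square_integral lborel (w n) \<le> ennreal (D * M)" for n
    using nn_integral_representative[OF w(2), of "\<lambda>t. t\<^sup>2"] L2_norm_nn[OF u] L2u by (simp add: ennreal_leI)
  have cM: "c * M \<ge> 0" "D * M \<ge> 0" using c D M0 by auto
  obtain r0 :: "nat \<Rightarrow> nat" where r0: "strict_mono r0"
    "\<forall>\<epsilon>>0. \<exists>N. \<forall>m\<ge>N. \<forall>n\<ge>N. square_integral lborel (\<lambda>x. w (r0 m) x - w (r0 n) x) \<le> ennreal \<epsilon>"
    using gagliardo_rellich_Cauchy[of w, OF w(1) s_pos supp gM cM(1) L2M cM(2)]
    by (elim exE conjE) (rule that; assumption)
  have "\<exists>v. v \<in> borel_measurable borel \<and>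
    (\<forall>\<epsilon>>0. \<exists>N. \<forall>n\<ge>N. square_integral lborel (\<lambda>x. w (r0 n) x - v x) \<le> ennreal \<epsilon>)"
    by (rule L2_Cauchy_limit[of "\<lambda>n. w (r0 n)", OF w(1) supp]) (rule r0(2)[rule_format])
  then obtain v where v: "v \<in> borel_measurable borel"
    "\<forall>\<epsilon>>0. \<exists>N. \<forall>n\<ge>N. square_integral lborel (\<lambda>x. w (r0 n) x - v x) \<le> ennreal \<epsilon>"

    by (elim exE conjE) (rule that; assumption)
  note [measurable] = v(1) w(1) X_measurable[OF u]
  have vl[measurable]: "v \<in> borel_measurable lebesgue" using v(1) by (intro measurable_completion) simp
  have L2conv: "\<exists>N. \<forall>n\<ge>N. square_integral lebesgue (\<lambda>x. u (r0 n) x - v x) \<le> ennreal \<epsilon>" if "\<epsilon> > 0" for \<epsilon>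
  proof -
    have "square_integral lebesgue (\<lambda>x. u (r0 n) x - v x) = square_integral lborel (\<lambda>x. w (r0 n) x - v x)" for n
    proof -
      have "square_integral lebesgue (\<lambda>x. u (r0 n) x - v x) = square_integral lebesgue (\<lambda>x. w (r0 n) x - v x)"
        by (rule nn_integral_cong_AE, use w(2)[of "r0 n"] in eventually_elim) simp
      then show ?thesis by (simp add: nn_integral_completion)
    qed
    then show ?thesis using v(2)[rule_format, OF that] by simp
  qed
  have v2: "integrable lebesgue (\<lambda>x. (v x)\<^sup>2)"
  proof (rule integrableI_bounded)
    \<comment> \<open>\<open>v\<close> differs from some member of the sequence by a square integrable function\<close>
    obtain n where n: "square_integral lebesgue (\<lambda>x. u (r0 n) x - v x) \<le> ennreal 1"
      using L2conv[of 1] by auto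
    have "square_integral lebesgue v = square_integral lebesgue (\<lambda>x. u (r0 n) x - (u (r0 n) x - v x))"
      by simp
    also have "\<dots> \<le> 2 * square_integral lebesgue (u (r0 n)) + 2 * square_integral lebesgue (\<lambda>x. u (r0 n) x - v x)"
      by (rule nn_integral_square_diff_le) auto
    also have "\<dots> \<le> 2 * ennreal (D * M) + 2 * ennreal 1"
      using n L2u[of "r0 n"] by (intro add_mono mult_left_mono) (auto simp: L2_norm_nn[OF u] ennreal_leI)
    also have "\<dots> < \<infinity>" by (simp add: ennreal_mult_less_top)
    finally show "(\<integral>\<^sup>+ x. ennreal (norm ((v x)\<^sup>2)) \<partial>lebesgue) < \<infinity>" by simp
  qed measurable
  have abs2: "\<bar>t\<bar> powr 2 = t\<^sup>2" for t :: real by (cases "t = 0") auto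
  have "\<exists>(r :: nat \<Rightarrow> nat) g. strict_mono r \<and> integrable lebesgue g \<and> (AE x in lebesgue. (\<lambda>n. u (r0 (r n)) x) \<longlonglongrightarrow> v x)
    \<and> (AE x in lebesgue. \<forall>n. \<bar>u (r0 (r n)) x\<bar> powr 2 \<le> g x)"
    by (rule dominated_subsequence) (use L2conv v2 in \<open>simp_all add: abs2\<close>)
  then obtain r1 :: "nat \<Rightarrow> nat" and g1 where r1: "strict_mono r1" "integrable lebesgue g1"
    "AE x in lebesgue. (\<lambda>n. u (r0 (r1 n)) x) \<longlonglongrightarrow> v x"
    "AE x in lebesgue. \<forall>n. (u (r0 (r1 n)) x)\<^sup>2 \<le> g1 x"
    unfolding abs2 by blast
  have vX: "v \<in> X"
    by (rule X_limit[of "\<lambda>n. u (r0 (r1 n))", OF u M vl v2 r1(3)])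
  \<comment> \<open>a bound for the differences, by the parallelogram law, allows Sobolev to turn \<open>L\<^sup>2\<close> into \<open>L\<^sup>p\<close> convergence\<close>
  define M2 where "M2 = 2 * M + 2 * B v v"
  have M2: "M2 \<ge> 0" using M0 B_nonneg[of v] by (simp add: M2_def)
  have BM2: "B (\<lambda>x. u n x - v x) (\<lambda>x. u n x - v x) \<le> M2" for n
  proof -
    have "B (\<lambda>x. u n x - v x) (\<lambda>x. u n x - v x) \<le> (\<integral>z. 2 * kin (u n) (u n) z + 2 * kin v v z \<partial>lebesgue)"
      unfolding B_def
    proof (rule integral_mono)
      show "integrable lebesgue (kin (\<lambda>x. u n x - v x) (\<lambda>x. u n x - v x))" by (intro X_kin diff_X u vX)
      show "integrable lebesgue (\<lambda>z. 2 * kin (u n) (u n) z + 2 * kin v v z)"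
        using X_kin[OF u] X_kin[OF vX] by (intro Bochner_Integration.integrable_add) auto
      fix z
      have "kin (\<lambda>x. u n x - v x) (\<lambda>x. u n x - v x) z + kin (\<lambda>x. u n x + v x) (\<lambda>x. u n x + v x) z = 2 * kin (u n) (u n) z + 2 * kin v v z"
        by (simp add: kin_def algebra_simps)
      then show "kin (\<lambda>x. u n x - v x) (\<lambda>x. u n x - v x) z \<le> 2 * kin (u n) (u n) z + 2 * kin v v z"
        using kin_nonneg[of "\<lambda>x. u n x + v x" z] by linarith
    qed
    also have "\<dots> = 2 * B (u n) (u n) + 2 * B v v"
      unfolding B_def using X_kin[OF u] X_kin[OF vX] by simp
    finally show ?thesis using M[of n] by (simp add: M2_def)
  qed
  obtain C e where C: "C > 0" "e > 0" and sob: "\<And>v Y. v \<in> X \<Longrightarrow> Y > 0 \<Longrightarrow> B v v \<le> M2 \<Longrightarrow> (\<integral>x. (v x)\<^sup>2 \<partial>lebesgue) \<le> Y \<Longrightarrow>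
    power_integral p lebesgue v \<le> ennreal (Y + C * Y powr e)"
    using sobolev[OF M2] by (elim exE conjE) (rule that; blast)
  have Lpconv: "\<exists>N. \<forall>n\<ge>N. power_integral p lebesgue (\<lambda>x. u (r0 (r1 n)) x - v x) \<le> ennreal \<epsilon>" if "\<epsilon> > 0" for \<epsilon>
  proof -
    \<comment> \<open>the Sobolev bound \<open>Y + C * Y powr e\<close> is below the given error for some \<open>Y = 1 / Suc k\<close>\<close>
    have l0: "(\<lambda>k. 1 / real (Suc k)) \<longlonglongrightarrow> 0" by (rule LIMSEQ_Suc[OF lim_1_over_n])
    have "(\<lambda>k. 1 / real (Suc k) + C * (1 / real (Suc k)) powr e) \<longlonglongrightarrow> 0 + C * 0 powr e"
      using C by (intro tendsto_intros tendsto_powr' l0) auto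
    then have "eventually (\<lambda>k. 1 / real (Suc k) + C * (1 / real (Suc k)) powr e < \<epsilon>) sequentially"
      using that by (intro order_tendstoD) auto
    then obtain k where k: "1 / real (Suc k) + C * (1 / real (Suc k)) powr e < \<epsilon>" by (auto simp: eventually_sequentially)
    define Y where "Y = 1 / real (Suc k)"
    have Y: "Y > 0" by (simp add: Y_def)
    obtain N where N: "\<And>n. n \<ge> N \<Longrightarrow> square_integral lebesgue (\<lambda>x. u (r0 n) x - v x) \<le> ennreal Y"
      using L2conv[OF Y] by blast
    show ?thesis
    proof (intro exI[of _ N] allI impI)
      fix n assume "N \<le> n"
      then have "N \<le> r1 n" using seq_suble[OF r1(1), of n] by linarith
      then have "ennreal (\<integral>x. (u (r0 (r1 n)) x - v x)\<^sup>2 \<partial>lebesgue) \<le> ennreal Y"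
        using N[of "r1 n"] L2_norm_nn[OF diff_X[OF u vX], of "r0 (r1 n)"] by simp
      then have "(\<integral>x. (u (r0 (r1 n)) x - v x)\<^sup>2 \<partial>lebesgue) \<le> Y" using Y by (simp add: ennreal_le_iff)
      from sob[OF diff_X[OF u vX] Y BM2 this]
      have "power_integral p lebesgue (\<lambda>x. u (r0 (r1 n)) x - v x) \<le> ennreal (Y + C * Y powr e)" .
      also have "\<dots> \<le> ennreal \<epsilon>" using k by (intro ennreal_leI) (simp add: Y_def)
      finally show "power_integral p lebesgue (\<lambda>x. u (r0 (r1 n)) x - v x) \<le> ennreal \<epsilon>" .
    qed
  qed
  have "\<exists>(r :: nat \<Rightarrow> nat) g. strict_mono r \<and> integrable lebesgue g \<and> (AE x in lebesgue. (\<lambda>n. u (r0 (r1 (r n))) x) \<longlonglongrightarrow> v x)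
    \<and> (AE x in lebesgue. \<forall>n. \<bar>u (r0 (r1 (r n))) x\<bar> powr p \<le> g x)"
    by (rule dominated_subsequence) (use Lpconv p_gt X_Lp[OF vX] in simp_all)
  then obtain r2 :: "nat \<Rightarrow> nat" and g2 where r2: "strict_mono r2" "integrable lebesgue g2"
    "AE x in lebesgue. (\<lambda>n. u (r0 (r1 (r2 n))) x) \<longlonglongrightarrow> v x"
    "AE x in lebesgue. \<forall>n. \<bar>u (r0 (r1 (r2 n))) x\<bar> powr p \<le> g2 x"
    by blast
  define r where "r n = r0 (r1 (r2 n))" for n
  have "strict_mono r" using strict_mono_compose[OF r0(1) strict_mono_compose[OF r1(1) r2(1)]] by (simp add: r_def[abs_def])
  moreover have "integrable lebesgue (\<lambda>x. \<bar>g1 x\<bar> + \<bar>g2 x\<bar>)" using r1(2) r2(2) by auto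
  moreover have "AE x in lebesgue. \<forall>n. (u (r n) x)\<^sup>2 \<le> \<bar>g1 x\<bar> + \<bar>g2 x\<bar> \<and> \<bar>u (r n) x\<bar> powr p \<le> \<bar>g1 x\<bar> + \<bar>g2 x\<bar>"
    using r1(4) r2(4)
  proof eventually_elim
    case (elim x)
    show ?case
    proof
      fix n
      have "(u (r n) x)\<^sup>2 \<le> g1 x" "\<bar>u (r n) x\<bar> powr p \<le> g2 x" using elim by (auto simp: r_def)
      then show "(u (r n) x)\<^sup>2 \<le> \<bar>g1 x\<bar> + \<bar>g2 x\<bar> \<and> \<bar>u (r n) x\<bar> powr p \<le> \<bar>g1 x\<bar> + \<bar>g2 x\<bar>" by linarith
    qed
  qed
  moreover have "AE x in lebesgue. (\<lambda>n. u (r n) x) \<longlonglongrightarrow> v x" using r2(3) by (simp add: r_def)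
  ultimately show ?thesis using vX by (intro exI[of _ r] exI[of _ v] exI[of _ "\<lambda>x. \<bar>g1 x\<bar> + \<bar>g2 x\<bar>"]) auto
qed

lemma W_integral_tendsto:
  assumes u: "\<And>n. u n \<in> X" and v: "v \<in> X" and g: "integrable lebesgue g"
    and lim: "AE x in lebesgue. (\<lambda>n. u n x) \<longlonglongrightarrow> v x"
    and dom: "AE x in lebesgue. \<forall>n. (u n x)\<^sup>2 \<le> g x"
  shows "(\<lambda>n. \<integral>x. W x * (u n x * u n x) \<partial>lebesgue) \<longlonglongrightarrow> (\<integral>x. W x * (v x * v x) \<partial>lebesgue)"
proof -
  obtain C where C: "AE x in lebesgue. \<bar>W x\<bar> \<le> C" "C > 0" using W_bounded by blast
  note [measurable] = X_measurable[OF u] X_measurable[OF v]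
  show ?thesis
  proof (rule integral_dominated_convergence)
    show "integrable lebesgue (\<lambda>x. C * g x)" using g by simp
    show "AE x in lebesgue. (\<lambda>n. W x * (u n x * u n x)) \<longlonglongrightarrow> W x * (v x * v x)"
      using lim by eventually_elim (intro tendsto_intros)
    show "AE x in lebesgue. norm (W x * (u n x * u n x)) \<le> C * g x" for n
      using C(1) dom
    proof eventually_elim
      case (elim x)
      have "\<bar>W x\<bar> * (u n x)\<^sup>2 \<le> C * g x" using elim C(2) by (intro mult_mono) auto
      then show ?case by (simp add: abs_mult power2_eq_square)
    qed
  qed measurable
qed

text \<open>
  Fatou's lemma for the kinetic part and dominated convergence for the potential together replace
  weak lower semicontinuity.
\<close>

lemma a_lsc:
  assumes u: "\<And>n. u n \<in> X" and v: "v \<in> X" and g: "integrable lebesgue g"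
    and lim: "AE x in lebesgue. (\<lambda>n. u n x) \<longlonglongrightarrow> v x"
    and dom: "AE x in lebesgue. \<forall>n. (u n x)\<^sup>2 \<le> g x"
    and c: "\<And>n. a (u n) (u n) \<le> c n" "c \<longlonglongrightarrow> l"
  shows "a v v \<le> l"
proof -
  let ?w = "\<lambda>u. \<integral>x. W x * (u x * u x) \<partial>lebesgue"
  have Blec: "B (u n) (u n) \<le> c n - ?w (u n)" for n using c(1)[of n] by (simp add: a_def)
  have lim': "(\<lambda>n. c n - ?w (u n)) \<longlonglongrightarrow> l - ?w v"
    by (intro tendsto_diff c(2) W_integral_tendsto[OF u v g lim dom])
  have "ennreal (B v v) \<le> liminf (\<lambda>n. \<integral>\<^sup>+ z. ennreal (kin (u n) (u n) z) \<partial>lebesgue)"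
    using kin_fatou[OF X_measurable[OF u] lim] by (simp add: kin_nn[OF v])
  also have "\<dots> \<le> liminf (\<lambda>n. ennreal (c n - ?w (u n)))"
    by (intro Liminf_mono always_eventually) (auto simp: kin_nn[OF u] intro!: ennreal_leI Blec)
  also have "\<dots> = ennreal (l - ?w v)"
    using lim' by (intro lim_imp_Liminf tendsto_ennrealI) auto
  finally have "ennreal (B v v) \<le> ennreal (l - ?w v)" .
  moreover have "l - ?w v \<ge> 0"
    using Blec order_trans[OF B_nonneg Blec] by (intro LIMSEQ_le_const[OF lim']) auto
  ultimately have "B v v \<le> l - ?w v" by (simp add: ennreal_le_iff)
  then show ?thesis by (simp add: a_def)
qed

text \<open>
  Otherwise there are functions of norm one in \<open>H\<close> on which the form tends to zero. Their limit \<open>v\<close>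
  satisfies \<open>a v v \<le> 0\<close>, hence is zero by positive definiteness. Then the potential energies tend to
  zero, and so do the norms.
\<close>

lemma coercive: "\<exists>c>0. \<forall>u\<in>X. B u u \<le> c * a u u"
proof (rule ccontr)
  assume *: "\<not> ?thesis"
  have "\<forall>n. \<exists>u. u \<in> X \<and> B u u > real (Suc n) * a u u"
  proof
    fix n
    have "real (Suc n) > 0" by simp
    then show "\<exists>u. u \<in> X \<and> B u u > real (Suc n) * a u u" using * not_le by blast
  qed
  from choice[OF this] obtain u where u: "\<And>n. u n \<in> X" "\<And>n. B (u n) (u n) > real (Suc n) * a (u n) (u n)"
    by blast
  have Bpos: "B (u n) (u n) > 0" for n
    using u(2)[of n] a_nonneg[OF u(1)[of n]] mult_nonneg_nonneg[of "real (Suc n)" "a (u n) (u n)"] by linarith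
  define t where "t n = 1 / sqrt (B (u n) (u n))" for n
  have t2: "(t n)\<^sup>2 = 1 / B (u n) (u n)" for n using Bpos[of n] by (simp add: t_def power_divide)
  define w where "w n = (\<lambda>x. t n * u n x)" for n
  have wX: "w n \<in> X" for n unfolding w_def by (rule scale_X[OF u(1)])
  have Bw: "B (w n) (w n) = 1" for n
    unfolding w_def B_scale[OF u(1)] t2 using Bpos[of n] by simp
  have aw: "a (w n) (w n) \<le> 1 / real (Suc n)" for n
  proof -
    have "a (w n) (w n) = a (u n) (u n) / B (u n) (u n)"
      using a_square[OF u(1)[of n] u(1)[of n], of "t n" 0] by (simp add: w_def t2)
    also have "\<dots> \<le> 1 / real (Suc n)"
      using u(2)[of n] Bpos[of n] by (simp add: field_simps)
    finally show ?thesis .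
  qed
  have "B (w n) (w n) \<le> 1" for n using Bw[of n] by simp
  then obtain r v g where r: "strict_mono (r :: nat \<Rightarrow> nat)" "v \<in> X" "integrable lebesgue g"
    "AE x in lebesgue. (\<lambda>n. w (r n) x) \<longlonglongrightarrow> v x"
    "AE x in lebesgue. \<forall>n. (w (r n) x)\<^sup>2 \<le> g x \<and> \<bar>w (r n) x\<bar> powr p \<le> g x"
    using compactness[of w 1, OF wX] by blast
  have dom: "AE x in lebesgue. \<forall>n. (w (r n) x)\<^sup>2 \<le> g x" using r(5) by eventually_elim blast
  have l0: "(\<lambda>n. 1 / real (Suc (r n))) \<longlonglongrightarrow> 0"
    using LIMSEQ_subseq_LIMSEQ[OF LIMSEQ_Suc[OF lim_1_over_n] r(1)] by (simp add: o_def)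
  have "a v v \<le> 0"
    by (rule a_lsc[of "\<lambda>n. w (r n)", OF wX r(2,3,4) dom aw l0])
  then have v0: "ae_zero v" using a_pos[OF r(2)] by force
  have lim: "(\<lambda>n. \<integral>x. W x * (w (r n) x * w (r n) x) \<partial>lebesgue) \<longlonglongrightarrow> (\<integral>x. W x * (v x * v x) \<partial>lebesgue)"
    by (rule W_integral_tendsto[of "\<lambda>n. w (r n)", OF wX r(2,3,4) dom])
  have "(\<integral>x. W x * (v x * v x) \<partial>lebesgue) = 0"
    using v0 unfolding ae_zero_def by (intro integral_eq_zero_AE) (auto elim: eventually_mono)
  with tendsto_diff[OF l0 lim] have "(\<lambda>n. 1 / real (Suc (r n)) - (\<integral>x. W x * (w (r n) x * w (r n) x) \<partial>lebesgue)) \<longlonglongrightarrow> 0"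
    by simp
  moreover have "1 \<le> 1 / real (Suc (r n)) - (\<integral>x. W x * (w (r n) x * w (r n) x) \<partial>lebesgue)" for n
    using aw[of "r n"] Bw[of "r n"] by (simp add: a_def)
  ultimately have "(1::real) \<le> 0" by (intro LIMSEQ_le_const[of _ 0 1]) auto
  then show False by simp
qed

lemma P_tendsto:
  assumes u: "\<And>n. u n \<in> borel_measurable lebesgue" and v: "v \<in> borel_measurable lebesgue" and g: "integrable lebesgue g"
    and lim: "AE x in lebesgue. (\<lambda>n. u n x) \<longlonglongrightarrow> v x"
    and dom: "AE x in lebesgue. \<forall>n. \<bar>u n x\<bar> powr p \<le> g x"
  shows "(\<lambda>n. P (u n)) \<longlonglongrightarrow> P v"
  unfolding P_def
proof (rule integral_dominated_convergence[OF _ _ g])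
  note [measurable] = u v
  show "AE x in lebesgue. (\<lambda>n. \<bar>u n x\<bar> powr p) \<longlonglongrightarrow> \<bar>v x\<bar> powr p"
    using lim by eventually_elim (use p_gt in \<open>auto intro!: tendsto_powr' tendsto_rabs\<close>)
  show "AE x in lebesgue. norm (\<bar>u n x\<bar> powr p) \<le> g x" for n
    using dom by eventually_elim simp
qed (use u v in measurable)

end

section \<open>Fibres and the Nehari equations\<close>

text \<open>
  The Poincare-Miranda theorem on a square: add the vector field to the identity, clamp the
  coordinates to the square, and take a fixed point by Brouwer. Where clamping acts at the fixed point,
  the field points out of the square or vanishes, and the signs on the faces leave only the latter.
\<close>

lemma miranda_square:
  fixes F G :: "real \<times> real \<Rightarrow> real"
  assumes rR: "r \<le> R"
    and cont: "continuous_on ({r..R} \<times> {r..R}) F" "continuous_on ({r..R} \<times> {r..R}) G"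
    and F: "\<And>y. y \<in> {r..R} \<Longrightarrow> F (r, y) \<ge> 0" "\<And>y. y \<in> {r..R} \<Longrightarrow> F (R, y) \<le> 0"
    and G: "\<And>x. x \<in> {r..R} \<Longrightarrow> G (x, r) \<ge> 0" "\<And>x. x \<in> {r..R} \<Longrightarrow> G (x, R) \<le> 0"
  shows "\<exists>x\<in>{r..R}. \<exists>y\<in>{r..R}. F (x, y) = 0 \<and> G (x, y) = 0"
proof -
  define S where "S = {r..R} \<times> {r..R}"
  define clamp where "clamp x = max r (min R x)" for x :: real
  define \<Phi> where "\<Phi> z = (clamp (fst z + F z), clamp (snd z + G z))" for z
  have S: "compact S" "convex S" "S \<noteq> {}"
    using rR by (auto simp: S_def intro!: compact_Times convex_Times)
  have "continuous_on S \<Phi>"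
    unfolding \<Phi>_def clamp_def using cont by (fold S_def) (intro continuous_intros)
  moreover have "\<Phi> \<in> S \<rightarrow> S"
    using rR by (auto simp: \<Phi>_def S_def clamp_def)
  ultimately obtain z where z: "z \<in> S" "\<Phi> z = z"
    using brouwer[OF S] by blast
  obtain x y where xy: "z = (x, y)" by (cases z)
  have x: "x \<in> {r..R}" and y: "y \<in> {r..R}" using z(1) by (auto simp: xy S_def)
  have ex: "clamp (x + F (x, y)) = x" and ey: "clamp (y + G (x, y)) = y"
    using z(2) by (auto simp: \<Phi>_def xy)
  have "F (x, y) = 0"
    using ex F(1)[OF y] F(2)[OF y] x by (auto simp: clamp_def max_def min_def split: if_splits)
  moreover have "G (x, y) = 0"
    using ey G(1)[OF x] G(2)[OF x] y by (auto simp: clamp_def max_def min_def split: if_splits)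
  ultimately show ?thesis using x y by blast
qed

text \<open>
  The two equations say that \<open>(t, \<tau>)\<close> is critical for
  \<open>(\<alpha> t\<^sup>2 + 2 \<gamma> t \<tau> + \<beta> \<tau>\<^sup>2) / 2 - (A t\<^sup>p + B \<tau>\<^sup>p) / p\<close>. Because \<open>\<gamma> \<ge> 0\<close>, on the left face of a square
  the smallest value of the coupling term \<open>\<gamma> * \<tau>\<close> is attained at the corner \<open>\<tau> = t\<close>, and on the
  right face the largest; this reduces the sign conditions to one variable.
\<close>

lemma fibre_critical_point:
  fixes \<alpha> \<beta> \<gamma> A B p :: real
  assumes pos: "\<alpha> > 0" "\<beta> > 0" "\<gamma> \<ge> 0" "A > 0" "B > 0" and p: "p > 2"
  shows "\<exists>t>0. \<exists>\<tau>>0. \<alpha> * t + \<gamma> * \<tau> = A * t powr (p - 1) \<and> \<beta> * \<tau> + \<gamma> * t = B * \<tau> powr (p - 1)"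
proof -
  \<comment> \<open>the sides at which the one-variable functions \<open>\<alpha> - A * t powr (p - 2)\<close> and
    \<open>\<alpha> + \<gamma> - A * t powr (p - 2)\<close>, and their analogues for \<open>\<beta>\<close>, have the required signs\<close>
  define r where "r = (min (\<alpha> / A) (\<beta> / B)) powr (1 / (p - 2))"
  define R where "R = (max ((\<alpha> + \<gamma>) / A) ((\<beta> + \<gamma>) / B)) powr (1 / (p - 2))"
  have r: "r > 0" using pos by (auto simp: r_def min_def)
  have rp: "r powr (p - 2) = min (\<alpha> / A) (\<beta> / B)" using pos p by (simp add: r_def powr_powr)
  have Rp: "R powr (p - 2) = max ((\<alpha> + \<gamma>) / A) ((\<beta> + \<gamma>) / B)"
    using pos p by (simp add: R_def powr_powr max_def)
  have rR: "r \<le> R"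
  proof -
    have "\<alpha> / A \<le> (\<alpha> + \<gamma>) / A" using pos by (simp add: divide_right_mono)
    then have "min (\<alpha> / A) (\<beta> / B) \<le> max ((\<alpha> + \<gamma>) / A) ((\<beta> + \<gamma>) / B)" by linarith
    then show ?thesis unfolding r_def R_def using pos p by (intro powr_mono2) auto
  qed
  have split: "t powr (p - 1) = t * t powr (p - 2)" if "t > 0" for t
    using that powr_add[of t 1 "p - 2"] by simp
  have low: "A * r powr (p - 2) \<le> \<alpha>" "B * r powr (p - 2) \<le> \<beta>"
    using pos unfolding rp by (auto simp: min_def field_simps)
  have high: "\<alpha> + \<gamma> \<le> A * R powr (p - 2)" "\<beta> + \<gamma> \<le> B * R powr (p - 2)"
    using pos unfolding Rp by (auto simp: max_def field_simps)
  have L: "0 \<le> c * r + \<gamma> * y - D * r powr (p - 1)"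
    if "D * r powr (p - 2) \<le> c" "r \<le> y" for c D y
  proof -
    have "D * r powr (p - 1) = r * (D * r powr (p - 2))" by (simp add: split[OF r])
    also have "\<dots> \<le> r * c" using that r by (intro mult_left_mono) auto
    finally have "D * r powr (p - 1) \<le> c * r" by (simp add: mult.commute)
    moreover have "0 \<le> \<gamma> * y" using pos(3) that(2) r by (intro mult_nonneg_nonneg) auto
    ultimately show ?thesis by linarith
  qed
  have H: "c * R + \<gamma> * y - D * R powr (p - 1) \<le> 0"
    if "c + \<gamma> \<le> D * R powr (p - 2)" "y \<le> R" for c D y
  proof -
    have "c * R + \<gamma> * y \<le> R * (c + \<gamma>)" using mult_left_mono[OF that(2) pos(3)] by (simp add: algebra_simps)
    also have "\<dots> \<le> R * (D * R powr (p - 2))" using that r rR by (intro mult_left_mono) auto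
    also have "\<dots> = D * R powr (p - 1)" using r rR by (simp add: split)
    finally show ?thesis by simp
  qed
  define F where "F z = \<alpha> * fst z + \<gamma> * snd z - A * fst z powr (p - 1)" for z
  define G where "G z = \<beta> * snd z + \<gamma> * fst z - B * snd z powr (p - 1)" for z
  have "\<exists>x\<in>{r..R}. \<exists>y\<in>{r..R}. F (x, y) = 0 \<and> G (x, y) = 0"
  proof (rule miranda_square[OF rR])
    show "continuous_on ({r..R} \<times> {r..R}) F" "continuous_on ({r..R} \<times> {r..R}) G"
      unfolding F_def G_def using r by (auto intro!: continuous_intros)
  qed (use L[OF low(1)] L[OF low(2)] H[OF high(1)] H[OF high(2)] in \<open>auto simp: F_def G_def\<close>)
  then obtain x y where "r \<le> x" "r \<le> y" "F (x, y) = 0" "G (x, y) = 0" by auto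
  then show ?thesis using r by (intro exI[of _ x] exI[of _ y] conjI) (auto simp: F_def G_def)
qed

text \<open>
  Young's inequality for the product \<open>t\<^sup>2 * 1\<close> with exponent \<open>p / 2\<close>.
\<close>

lemma half_square_minus_powr_le:
  fixes t p :: real
  assumes t: "t \<ge> 0" and p: "p > 2"
  shows "t\<^sup>2 / 2 - t powr p / p \<le> 1 / 2 - 1 / p"
proof -
  define q where "q = (p / 2) / (p / 2 - 1)"
  have "t\<^sup>2 * 1 \<le> (t\<^sup>2) powr (p / 2) / (p / 2) + 1 powr q / q"
    using p t by (intro Youngs_inequality) (auto simp: q_def field_simps)
  moreover have "(t\<^sup>2) powr (p / 2) = t powr p"
  proof (cases "t = 0")
    case False
    then have "t\<^sup>2 = t powr 2" using t by simp
    then show ?thesis by (simp add: powr_powr)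
  qed (use p in auto)
  moreover have "1 / q = 1 - 2 / p" using p by (simp add: q_def field_simps)
  ultimately show ?thesis by simp
qed

text \<open>
  Estimating the coupling by \<open>2 * t * \<tau> \<le> t\<^sup>2 + \<tau>\<^sup>2\<close> decouples the two variables, with equality at
  \<open>t = \<tau> = 1\<close>. So a critical point with positive coordinates is a global maximum.
\<close>

lemma fibre_maximum:
  fixes \<alpha> \<beta> \<gamma> t \<tau> p :: real
  assumes g: "\<gamma> \<ge> 0" and nonneg: "\<alpha> + \<gamma> \<ge> 0" "\<beta> + \<gamma> \<ge> 0" and t: "t \<ge> 0" "\<tau> \<ge> 0" and p: "p > 2"
  shows "(t\<^sup>2 * \<alpha> + 2 * t * \<tau> * \<gamma> + \<tau>\<^sup>2 * \<beta>) / 2 - (t powr p * (\<alpha> + \<gamma>) + \<tau> powr p * (\<beta> + \<gamma>)) / p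
    \<le> (\<alpha> + 2 * \<gamma> + \<beta>) / 2 - ((\<alpha> + \<gamma>) + (\<beta> + \<gamma>)) / p"
proof -
  have "2 * t * \<tau> * \<gamma> \<le> (t\<^sup>2 + \<tau>\<^sup>2) * \<gamma>"
    using g by (intro mult_right_mono sum_squares_bound) auto
  then have "(t\<^sup>2 * \<alpha> + 2 * t * \<tau> * \<gamma> + \<tau>\<^sup>2 * \<beta>) / 2 - (t powr p * (\<alpha> + \<gamma>) + \<tau> powr p * (\<beta> + \<gamma>)) / p
    \<le> (\<alpha> + \<gamma>) * (t\<^sup>2 / 2 - t powr p / p) + (\<beta> + \<gamma>) * (\<tau>\<^sup>2 / 2 - \<tau> powr p / p)"
    by (simp add: add_divide_distrib diff_divide_distrib algebra_simps)
  also have "\<dots> \<le> (\<alpha> + \<gamma>) * (1 / 2 - 1 / p) + (\<beta> + \<gamma>) * (1 / 2 - 1 / p)"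
    using nonneg t p by (intro add_mono mult_left_mono half_square_minus_powr_le) auto
  also have "\<dots> = (\<alpha> + 2 * \<gamma> + \<beta>) / 2 - ((\<alpha> + \<gamma>) + (\<beta> + \<gamma>)) / p"
    by (simp add: add_divide_distrib diff_divide_distrib algebra_simps)
  finally show ?thesis .
qed

context nonlocal_problem
begin

text \<open>
  The two-parameter fibre through \<open>u\<close> on which the nodal Nehari set requires a maximum at \<open>(1, 1)\<close>.
\<close>

definition comb :: "('a \<Rightarrow> real) \<Rightarrow> real \<Rightarrow> real \<Rightarrow> 'a \<Rightarrow> real" where
  "comb u t \<tau> = (\<lambda>x. t * pos_part u x + \<tau> * neg_part u x)"

lemma comb_X: "u \<in> X \<Longrightarrow> comb u t \<tau> \<in> X"
  unfolding comb_def by (intro X_scale_add pos_part_X neg_part_X)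

lemma comb_1: "comb u 1 1 = u"
  by (auto simp: comb_def pos_part_def neg_part_def)

lemma pos_part_comb: "t > 0 \<Longrightarrow> \<tau> > 0 \<Longrightarrow> pos_part (comb u t \<tau>) = (\<lambda>x. t * pos_part u x)"
  by (auto simp: comb_def pos_part_def neg_part_def max_def min_def fun_eq_iff mult_le_0_iff zero_le_mult_iff)

lemma neg_part_comb: "t > 0 \<Longrightarrow> \<tau> > 0 \<Longrightarrow> neg_part (comb u t \<tau>) = (\<lambda>x. \<tau> * neg_part u x)"
  by (auto simp: comb_def pos_part_def neg_part_def max_def min_def fun_eq_iff mult_le_0_iff zero_le_mult_iff)

text \<open>
  The nonlocal interaction of the two parts has a sign, since \<open>max _ 0\<close> and \<open>min _ 0\<close> are both
  increasing; the potential sees no interaction because the supports are disjoint.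
\<close>

lemma a_pos_neg_nonneg:
  assumes u: "u \<in> X"
  shows "a (pos_part u) (neg_part u) \<ge> 0"
proof -
  have "kin (pos_part u) (neg_part u) z \<ge> 0" for z
  proof (cases "fst z = snd z")
    case False
    have "(max s 0 - max t 0) * (min s 0 - min t 0) \<ge> 0" for s t :: real
      by (auto simp: max_def min_def mult_nonneg_nonneg mult_nonpos_nonpos mult_le_0_iff)
    from mult_nonneg_nonneg[OF this, of "K (fst z - snd z)"] show ?thesis
      using K_pos[of "fst z - snd z"] False by (simp add: kin_def pos_part_def neg_part_def)
  qed (simp add: kin_def)
  then have "B (pos_part u) (neg_part u) \<ge> 0" unfolding B_def by (intro integral_nonneg_AE) simp
  moreover have "(\<integral>x. W x * (pos_part u x * neg_part u x) \<partial>lebesgue) = (\<integral>x. 0 \<partial>(lebesgue :: 'a measure))"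
    by (rule Bochner_Integration.integral_cong) (auto simp: pos_part_def neg_part_def max_def min_def)
  ultimately show ?thesis by (simp add: a_def)
qed

lemma P_scale: "c \<ge> 0 \<Longrightarrow> P (\<lambda>x. c * u x) = c powr p * P u"
  unfolding P_def by (simp add: abs_mult powr_mult)

lemma P_comb:
  assumes u: "u \<in> X" and t: "t \<ge> 0" "\<tau> \<ge> 0"
  shows "P (comb u t \<tau>) = t powr p * P (pos_part u) + \<tau> powr p * P (neg_part u)"
proof -
  have "\<bar>comb u t \<tau> x\<bar> powr p = t powr p * \<bar>pos_part u x\<bar> powr p + \<tau> powr p * \<bar>neg_part u x\<bar> powr p" for x
    using t powr_mult[of \<tau> "- u x" p]
    by (cases "u x \<ge> 0") (auto simp: comb_def pos_part_def neg_part_def abs_mult powr_mult max_def min_def)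
  then show ?thesis
    unfolding P_def using X_Lp[OF pos_part_X[OF u]] X_Lp[OF neg_part_X[OF u]] by simp
qed

lemma P_split: "u \<in> X \<Longrightarrow> P u = P (pos_part u) + P (neg_part u)"
  using P_comb[of u 1 1] by (simp add: comb_1)

lemma a_comb_pos: "u \<in> X \<Longrightarrow> a (comb u t \<tau>) (pos_part u) = t * a (pos_part u) (pos_part u) + \<tau> * a (pos_part u) (neg_part u)"
  unfolding comb_def by (subst a_linear) (auto intro: pos_part_X neg_part_X simp: a_sym[of "neg_part u"])

lemma a_comb_neg: "u \<in> X \<Longrightarrow> a (comb u t \<tau>) (neg_part u) = t * a (pos_part u) (neg_part u) + \<tau> * a (neg_part u) (neg_part u)"
  unfolding comb_def by (subst a_linear) (auto intro: pos_part_X neg_part_X)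

lemma E_comb:
  assumes u: "u \<in> X" and t: "t \<ge> 0" "\<tau> \<ge> 0"
  shows "E (comb u t \<tau>) = (t\<^sup>2 * a (pos_part u) (pos_part u) + 2 * t * \<tau> * a (pos_part u) (neg_part u) + \<tau>\<^sup>2 * a (neg_part u) (neg_part u)) / 2
    - (t powr p * P (pos_part u) + \<tau> powr p * P (neg_part u)) / p"
  unfolding E_def P_comb[OF assms]
  unfolding comb_def a_square[OF pos_part_X[OF u] neg_part_X[OF u]] ..

lemma P_pos:
  assumes u: "u \<in> X" "\<not> ae_zero u"
  shows "P u > 0"
proof (rule ccontr)
  assume "\<not> P u > 0"
  then have "P u = 0" using P_nonneg[of u] by linarith
  then have "AE x in lebesgue. \<bar>u x\<bar> powr p = 0"
    unfolding P_def using integral_nonneg_eq_0_iff_AE[OF X_Lp[OF u(1)]] by simp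
  then have "ae_zero u" unfolding ae_zero_def by eventually_elim simp
  with u(2) show False by simp
qed

text \<open>
  The nodal Nehari set described by equations: the derivative of the energy at \<open>u\<close> vanishes in the
  directions of the two parts of \<open>u\<close>.
\<close>

definition Nehari :: "('a \<Rightarrow> real) \<Rightarrow> bool" where
  "Nehari u \<longleftrightarrow> u \<in> X \<and> sign_changing u \<and> a u (pos_part u) = P (pos_part u) \<and> a u (neg_part u) = P (neg_part u)"

lemma Nehari_E_comb_le:
  assumes u: "Nehari u" and t: "t \<ge> 0" "\<tau> \<ge> 0"
  shows "E (comb u t \<tau>) \<le> E u"
proof -
  have uX: "u \<in> X" and eq: "a u (pos_part u) = P (pos_part u)" "a u (neg_part u) = P (neg_part u)"
    using u by (auto simp: Nehari_def)
  have Pp: "P (pos_part u) = a (pos_part u) (pos_part u) + a (pos_part u) (neg_part u)"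
    using eq(1) a_comb_pos[OF uX, of 1 1] by (simp add: comb_1)
  have Pn: "P (neg_part u) = a (neg_part u) (neg_part u) + a (pos_part u) (neg_part u)"
    using eq(2) a_comb_neg[OF uX, of 1 1] by (simp add: comb_1)
  have "E (comb u t \<tau>) \<le> E (comb u 1 1)"
    unfolding E_comb[OF uX t] E_comb[OF uX zero_le_one zero_le_one] Pp Pn
    using fibre_maximum[OF a_pos_neg_nonneg[OF uX] _ _ t p_gt, of "a (pos_part u) (pos_part u)" "a (neg_part u) (neg_part u)"]
      a_pos_neg_nonneg[OF uX] a_nonneg[OF pos_part_X[OF uX]] a_nonneg[OF neg_part_X[OF uX]] by simp
  then show ?thesis by (simp add: comb_1)
qed

text \<open>
  At an interior maximum of the fibre both partial derivatives vanish. The two cases are the same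
  one-variable computation, with the roles of the parts exchanged.
\<close>

lemma Nehari_if_maximum:
  assumes u: "u \<in> X" "sign_changing u"
    and max: "\<And>t \<tau>. t > 0 \<Longrightarrow> \<tau> > 0 \<Longrightarrow> E (comb u t \<tau>) \<le> E u"
  shows "Nehari u"
proof -
  define \<alpha> where "\<alpha> = a (pos_part u) (pos_part u)"
  define \<beta> where "\<beta> = a (neg_part u) (neg_part u)"
  define \<gamma> where "\<gamma> = a (pos_part u) (neg_part u)"
  have crit: "c + \<gamma> - D = 0"
    if le: "\<And>t. t > 0 \<Longrightarrow> (t\<^sup>2 * c + 2 * t * \<gamma> + d) / 2 - (t powr p * D + e) / p \<le> (c + 2 * \<gamma> + d) / 2 - (D + e) / p" for c d D e
  proof (rule DERIV_local_max)
    show "((\<lambda>t. (t\<^sup>2 * c + 2 * t * \<gamma> + d) / 2 - (t powr p * D + e) / p) has_real_derivative c + \<gamma> - D) (at 1)"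
      using p_gt by (auto intro!: derivative_eq_intros)
    show "\<forall>y. \<bar>1 - y\<bar> < 1 \<longrightarrow> (y\<^sup>2 * c + 2 * y * \<gamma> + d) / 2 - (y powr p * D + e) / p \<le> (1\<^sup>2 * c + 2 * 1 * \<gamma> + d) / 2 - (1 powr p * D + e) / p"
      using le by (auto simp: abs_less_iff)
  qed simp
  have fib: "(t\<^sup>2 * \<alpha> + 2 * t * \<tau> * \<gamma> + \<tau>\<^sup>2 * \<beta>) / 2 - (t powr p * P (pos_part u) + \<tau> powr p * P (neg_part u)) / p
     \<le> (\<alpha> + 2 * \<gamma> + \<beta>) / 2 - (P (pos_part u) + P (neg_part u)) / p" if "t > 0" "\<tau> > 0" for t \<tau>
  proof -
    have t: "0 \<le> t" "0 \<le> \<tau>" using that by auto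
    show ?thesis
      using max[OF that] E_comb[OF u(1) t] E_comb[OF u(1) zero_le_one zero_le_one] by (simp add: comb_1 \<alpha>_def \<beta>_def \<gamma>_def)
  qed
  have "\<alpha> + \<gamma> - P (pos_part u) = 0"
    by (rule crit[of _ \<beta> _ "P (neg_part u)"]) (use fib[of _ 1] in simp)
  moreover have "\<beta> + \<gamma> - P (neg_part u) = 0"
    by (rule crit[of _ \<alpha> _ "P (pos_part u)"]) (use fib[of 1] in \<open>simp add: algebra_simps\<close>)
  ultimately show ?thesis
    using u a_comb_pos[OF u(1), of 1 1] a_comb_neg[OF u(1), of 1 1]
    by (simp add: Nehari_def comb_1 \<alpha>_def \<beta>_def \<gamma>_def)
qed

lemma nodal_Nehari_iff: "u \<in> nodal_Nehari \<Omega> K V p \<longleftrightarrow> Nehari u"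
proof -
  have az: "\<not> ae_zero u" if "sign_changing u"
  proof
    assume "ae_zero u"
    then have "ae_zero (pos_part u)" unfolding ae_zero_def by eventually_elim (simp add: pos_part_def)
    with that show False by (simp add: sign_changing_def)
  qed
  have mx: "is_maximum {energy \<Omega> K V p (\<lambda>x. t * pos_part u x + t' * neg_part u x) | t t'. t > 0 \<and> t' > 0} (energy \<Omega> K V p u)
    \<longleftrightarrow> (\<forall>t>0. \<forall>\<tau>>0. E (comb u t \<tau>) \<le> E u)" if u: "u \<in> X"
  proof -
    have e: "energy \<Omega> K V p (\<lambda>x. t * pos_part u x + t' * neg_part u x) = E (comb u t t')" for t t'
      using energy_eq[OF comb_X[OF u]] by (simp add: comb_def)
    have "\<exists>t t'. E u = E (comb u t t') \<and> t > 0 \<and> t' > 0"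
      by (rule exI[of _ 1], rule exI[of _ 1]) (simp add: comb_1)
    then show ?thesis unfolding e energy_eq[OF u] is_maximum_def by auto
  qed
  show ?thesis
  proof
    assume "u \<in> nodal_Nehari \<Omega> K V p"
    then show "Nehari u" using mx unfolding nodal_Nehari_def
      by (intro Nehari_if_maximum) (auto simp: sign_changing_def)
  next
    assume N: "Nehari u"
    then have "u \<in> X" "sign_changing u" by (auto simp: Nehari_def)
    with mx az Nehari_E_comb_le[OF N] show "u \<in> nodal_Nehari \<Omega> K V p"
      by (auto simp: nodal_Nehari_def sign_changing_def)
  qed
qed

lemma weak_solution_Nehari:
  assumes w: "weak_solution \<Omega> K V p u" and sc: "sign_changing u"
  shows "Nehari u"
proof -
  have u: "u \<in> X" and eq: "\<And>\<phi>. \<phi> \<in> X \<Longrightarrow> a u \<phi> = N u \<phi>" using w by (auto simp: weak_solution_iff)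
  have pw: "\<bar>t\<bar> powr (p - 2) * t * t = \<bar>t\<bar> powr p" for t :: real
  proof (cases "t = 0")
    case False
    have sq: "t * t = \<bar>t\<bar> powr 2" using False by (simp add: power2_eq_square)
    have "\<bar>t\<bar> powr (p - 2) * t * t = \<bar>t\<bar> powr (p - 2) * \<bar>t\<bar> powr 2"
      by (simp only: mult.assoc sq)
    also have "\<dots> = \<bar>t\<bar> powr p" unfolding powr_add[symmetric] by simp
    finally show ?thesis .
  qed simp
  have "\<bar>u x\<bar> powr (p - 2) * u x * pos_part u x = \<bar>pos_part u x\<bar> powr p" for x
    using pw[of "u x"] by (auto simp: pos_part_def max_def)
  then have "N u (pos_part u) = P (pos_part u)" by (simp add: N_def P_def)
  moreover have "\<bar>u x\<bar> powr (p - 2) * u x * neg_part u x = \<bar>neg_part u x\<bar> powr p" for x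
    using pw[of "u x"] by (auto simp: neg_part_def min_def)
  then have "N u (neg_part u) = P (neg_part u)" by (simp add: N_def P_def)
  ultimately show ?thesis using u sc eq[OF pos_part_X[OF u]] eq[OF neg_part_X[OF u]] by (simp add: Nehari_def)
qed

lemma Nehari_projection:
  assumes u: "u \<in> X" "sign_changing u"
  shows "\<exists>t>0. \<exists>\<tau>>0. Nehari (comb u t \<tau>)"
proof -
  have nz: "\<not> ae_zero (pos_part u)" "\<not> ae_zero (neg_part u)" using u(2) by (auto simp: sign_changing_def)
  define \<alpha> where "\<alpha> = a (pos_part u) (pos_part u)"
  define \<beta> where "\<beta> = a (neg_part u) (neg_part u)"
  define \<gamma> where "\<gamma> = a (pos_part u) (neg_part u)"
  have "\<exists>t>0. \<exists>\<tau>>0. \<alpha> * t + \<gamma> * \<tau> = P (pos_part u) * t powr (p - 1) \<and> \<beta> * \<tau> + \<gamma> * t = P (neg_part u) * \<tau> powr (p - 1)"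
    unfolding \<alpha>_def \<beta>_def \<gamma>_def using nz u(1)
    by (intro fibre_critical_point p_gt P_pos a_pos a_pos_neg_nonneg pos_part_X neg_part_X)
  then obtain t \<tau> where t: "t > 0" "\<tau> > 0" "\<alpha> * t + \<gamma> * \<tau> = P (pos_part u) * t powr (p - 1)"
    "\<beta> * \<tau> + \<gamma> * t = P (neg_part u) * \<tau> powr (p - 1)" by blast
  have nz': "\<not> ae_zero (\<lambda>x. c * f x)" if "c > 0" "\<not> ae_zero f" for c and f :: "'a \<Rightarrow> real"
    using that by (simp add: ae_zero_def)
  have sp: "x * x powr (p - 1) = x powr p" if "x > 0" for x
    using that powr_add[of x 1 "p - 1"] by simp
  have "a (comb u t \<tau>) (\<lambda>x. t * pos_part u x) = t * (t * \<alpha> + \<tau> * \<gamma>)"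
    using a_scale[OF pos_part_X[OF u(1)] comb_X[OF u(1)], of t t \<tau>] a_comb_pos[OF u(1), of t \<tau>]
    by (simp add: a_sym[of "comb u t \<tau>"] \<alpha>_def \<gamma>_def)
  also have "\<dots> = P (\<lambda>x. t * pos_part u x)"
    using t(3) sp[OF t(1)] t(1) by (simp add: P_scale mult_ac)
  finally have 1: "a (comb u t \<tau>) (\<lambda>x. t * pos_part u x) = P (\<lambda>x. t * pos_part u x)" .
  have "a (comb u t \<tau>) (\<lambda>x. \<tau> * neg_part u x) = \<tau> * (t * \<gamma> + \<tau> * \<beta>)"
    using a_scale[OF neg_part_X[OF u(1)] comb_X[OF u(1)], of \<tau> t \<tau>] a_comb_neg[OF u(1), of t \<tau>]
    by (simp add: a_sym[of "comb u t \<tau>"] \<beta>_def \<gamma>_def)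
  also have "\<dots> = P (\<lambda>x. \<tau> * neg_part u x)"
    using t(4) sp[OF t(2)] t(2) by (simp add: P_scale mult_ac add.commute)
  finally have 2: "a (comb u t \<tau>) (\<lambda>x. \<tau> * neg_part u x) = P (\<lambda>x. \<tau> * neg_part u x)" .
  show ?thesis
    using t(1,2) 1 2 comb_X[OF u(1)] nz'[OF t(1) nz(1)] nz'[OF t(2) nz(2)]
    by (intro exI[of _ t] exI[of _ \<tau>] conjI) (auto simp: Nehari_def sign_changing_def pos_part_comb neg_part_comb)
qed

lemma Nehari_energy:
  assumes "Nehari u"
  shows "E u = (1 / 2 - 1 / p) * a u u" "a u u = P u"
proof -
  have u: "u \<in> X" and eq: "a u (pos_part u) = P (pos_part u)" "a u (neg_part u) = P (neg_part u)"
    using assms by (auto simp: Nehari_def)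
  have "a u (comb u 1 1) = a u (pos_part u) + a u (neg_part u)"
    unfolding comb_def using a_linear_right[OF pos_part_X[OF u] neg_part_X[OF u] u, of 1 1] by simp
  then show au: "a u u = P u" using eq P_split[OF u] by (simp add: comb_1)
  show "E u = (1 / 2 - 1 / p) * a u u"
    unfolding E_def au[symmetric] by (simp add: algebra_simps)
qed

text \<open>
  By the Sobolev inequality and coercivity \<open>P v\<close> is at most a multiple of \<open>(a v v) powr (p / 2)\<close>, and
  \<open>p / 2 > 1\<close>. This keeps both parts of a minimizing sequence away from zero.
\<close>

lemma Lp_lower_bound:
  "\<exists>\<kappa>>0. \<forall>v\<in>X. \<not> ae_zero v \<longrightarrow> a v v \<le> P v \<longrightarrow> \<kappa> \<le> P v"
proof -
  obtain c where c: "c > 0" "\<And>u. u \<in> X \<Longrightarrow> B u u \<le> c * a u u" using coercive by blast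
  obtain C where C: "C > 0" "\<And>u. u \<in> X \<Longrightarrow> B u u \<le> 1 \<Longrightarrow> P u \<le> C" using P_bounded by blast
  define D where "D = C * c powr (p / 2)"
  have D: "D > 0" using c C by (simp add: D_def)
  show ?thesis
  proof (intro exI[of _ "(1 / D) powr (1 / (p / 2 - 1))"] conjI ballI impI)
    show "(1 / D) powr (1 / (p / 2 - 1)) > 0" using D by simp
    fix v assume v: "v \<in> X" "\<not> ae_zero v" "a v v \<le> P v"
    define y where "y = P v"
    have y: "y > 0" unfolding y_def by (rule P_pos[OF v(1,2)])
    \<comment> \<open>scaling by \<open>t\<close> brings \<open>v\<close> into the unit ball of \<open>H\<close>\<close>
    define t where "t = 1 / sqrt (c * y)"
    have t: "t > 0" "t\<^sup>2 = 1 / (c * y)" using c y by (auto simp: t_def power_divide)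
    have "B (\<lambda>x. t * v x) (\<lambda>x. t * v x) = t\<^sup>2 * B v v" by (rule B_scale[OF v(1)])
    also have "\<dots> \<le> t\<^sup>2 * (c * y)"
      using mult_left_mono[OF v(3), of c] c(1)
      by (intro mult_left_mono order_trans[OF c(2)[OF v(1)]]) (auto simp: y_def)
    also have "\<dots> = 1" using t c y by simp
    finally have "P (\<lambda>x. t * v x) \<le> C" by (intro C(2) scale_X v(1))
    then have le: "t powr p * y \<le> C" using t by (simp add: P_scale y_def)
    have "t powr p = (t\<^sup>2) powr (p / 2)"
    proof -
      have "t\<^sup>2 = t powr 2" using t by simp
      then show ?thesis by (simp add: powr_powr)
    qed
    also have "\<dots> = 1 / (c powr (p / 2) * y powr (p / 2))"
      unfolding t(2) using c y by (simp add: powr_divide powr_mult)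
    finally have "y / (c powr (p / 2) * y powr (p / 2)) \<le> C" using le by simp
    then have "y \<le> D * y powr (p / 2)"
      using c y by (simp add: D_def field_simps)
    also have "y powr (p / 2) = y * y powr (p / 2 - 1)"
      using y powr_add[of y 1 "p / 2 - 1"] by simp
    finally have "y * 1 \<le> y * (D * y powr (p / 2 - 1))" by (simp add: mult_ac)
    then have "1 \<le> D * y powr (p / 2 - 1)" using y by (simp only: mult_le_cancel_left_pos)
    then have "1 / D \<le> y powr (p / 2 - 1)" using D by (simp add: field_simps)
    then have "(1 / D) powr (1 / (p / 2 - 1)) \<le> (y powr (p / 2 - 1)) powr (1 / (p / 2 - 1))"
      using D p_gt by (intro powr_mono2) auto
    also have "\<dots> = y" using y p_gt by (simp add: powr_powr)
    finally show "(1 / D) powr (1 / (p / 2 - 1)) \<le> P v" by (simp add: y_def)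
  qed
qed

end

section \<open>A minimizer on the nodal Nehari set\<close>

definition tent :: "'a::euclidean_space \<Rightarrow> real \<Rightarrow> 'a \<Rightarrow> real" where
  "tent z r x = max 0 (r - norm (x - z))"

lemma tent_eq_0_iff: "tent z r x = 0 \<longleftrightarrow> x \<notin> ball z r"
  by (auto simp: tent_def dist_norm norm_minus_commute)

lemma tent_Lipschitz: "\<bar>tent z r x - tent z r y\<bar> \<le> norm (x - y)"
proof -
  have "\<bar>norm (x - z) - norm (y - z)\<bar> \<le> norm (x - y)"
    using norm_triangle_ineq3[of "x - z" "y - z"] by simp
  then show ?thesis unfolding tent_def by (simp add: max_def abs_le_iff)
qed

lemma tent_nonneg: "0 \<le> tent z r x"
  by (simp add: tent_def)

lemma tent_le: "r \<ge> 0 \<Longrightarrow> tent z r x \<le> r"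
  by (simp add: tent_def)

lemma not_ae_zero_if_nonzero_on_open:
  assumes "open S" "S \<noteq> {}" "\<And>x. x \<in> S \<Longrightarrow> f x \<noteq> 0"
  shows "\<not> ae_zero f"
proof
  assume "ae_zero f"
  then have "AE x in lebesgue. x \<notin> S" unfolding ae_zero_def by eventually_elim (use assms(3) in blast)
  then have "S \<in> null_sets lebesgue" by (simp add: completion.AE_iff_null_sets)
  then have "negligible S" by (simp add: negligible_iff_null_sets)
  with assms(1,2) show False using open_not_negligible by blast
qed

context nonlocal_problem
begin

text \<open>
  For Lipschitz functions with compact support the squared difference is bounded by a multiple of
  \<open>min (norm (x - y))\<^sup>2 1\<close>, which is exactly what the integrability of the kernel absorbs; one of the
  points may be confined to the support.
\<close>

lemma tent_X:
  assumes r: "r > 0" and sub: "ball z r \<subseteq> \<Omega>"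
  shows "tent z r \<in> X"
proof -
  have cont: "continuous_on UNIV (tent z r)" unfolding tent_def by (intro continuous_intros)
  then have tb[measurable]: "tent z r \<in> borel_measurable borel" by (rule borel_measurable_continuous_onI)
  have tl: "tent z r \<in> borel_measurable lebesgue" by (intro measurable_completion) simp
  have ball_fin: "emeasure lborel (ball z r) < \<infinity>" by (rule emeasure_bounded_finite) simp
  have "integrable lborel (\<lambda>x. (tent z r x)\<^sup>2)"
  proof (rule Bochner_Integration.integrable_bound)
    show "integrable lborel (\<lambda>x. r\<^sup>2 * indicator (ball z r) x :: real)"
      using ball_fin by (intro integrable_mult_right integrable_real_indicator) auto
    have "(tent z r x)\<^sup>2 \<le> r\<^sup>2 * indicator (ball z r) x" for x
    proof (cases "x \<in> ball z r")
      case True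
      then show ?thesis using tent_nonneg[of z r x] tent_le[of r z x] r by (auto intro!: power_mono)
    next
      case False
      then have "tent z r x = 0" by (simp only: tent_eq_0_iff) simp
      then show ?thesis by simp
    qed
    then show "AE x in lborel. norm ((tent z r x)\<^sup>2) \<le> norm (r\<^sup>2 * indicator (ball z r) x)"
      by (intro AE_I2) (auto intro: order_trans[OF _ abs_ge_self])
  qed measurable
  then have L2: "integrable lebesgue (\<lambda>x. (tent z r x)\<^sup>2)" by (subst integrable_completion) simp_all
  define m where "m x = min ((norm x)\<^sup>2) 1 * K x" for x
  have m0: "m x \<ge> 0" for x using K_pos[of x] by (cases "x = 0") (auto simp: m_def)
  have m_int: "integrable lebesgue m" using K_int by (simp add: m_def[abs_def])
  obtain m' where m'[measurable]: "m' \<in> borel_measurable lborel" and m'_ae: "AE x in lborel. m x = m' x"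
    using completion_ex_borel_measurable_real[OF borel_measurable_integrable[OF m_int]] by blast
  have "(\<integral>\<^sup>+ x. ennreal (m' x) \<partial>lborel) = (\<integral>\<^sup>+ x. ennreal (m x) \<partial>lebesgue)"
    using m'_ae by (subst nn_integral_completion) (auto intro!: nn_integral_cong_AE elim: eventually_mono)
  also have "\<dots> < \<infinity>" using m_int m0 by (simp add: integrable_iff_bounded)
  finally have m'_fin: "(\<integral>\<^sup>+ x. ennreal (m' x) \<partial>lborel) < \<infinity>" .
  define f1 where "f1 = (\<lambda>w :: 'a \<times> 'a. ennreal (m' (fst w - snd w)) * indicator (ball z r) (fst w))"
  define f2 where "f2 = (\<lambda>w :: 'a \<times> 'a. ennreal (m' (fst w - snd w)) * indicator (ball z r) (snd w))"
  have f[measurable]: "f1 \<in> borel_measurable (lborel \<Otimes>\<^sub>M lborel)" "f2 \<in> borel_measurable (lborel \<Otimes>\<^sub>M lborel)"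
  proof -
    have ind: "(indicator (ball z r) :: 'a \<Rightarrow> ennreal) \<in> borel_measurable lborel"
      by (rule borel_measurable_indicator) simp
    have m: "(\<lambda>w. ennreal (m' (fst w - snd w))) \<in> borel_measurable (lborel \<Otimes>\<^sub>M lborel)" by measurable
    show "f1 \<in> borel_measurable (lborel \<Otimes>\<^sub>M lborel)" "f2 \<in> borel_measurable (lborel \<Otimes>\<^sub>M lborel)"
      unfolding f1_def f2_def
      by (intro borel_measurable_times_ennreal m measurable_compose[OF measurable_fst ind] measurable_compose[OF measurable_snd ind])+
  qed
  have I1: "(\<integral>\<^sup>+ w. f1 w \<partial>lebesgue) = emeasure lborel (ball z r) * (\<integral>\<^sup>+ x. ennreal (m' x) \<partial>lborel)"
  proof -
    have "(\<integral>\<^sup>+ w. f1 w \<partial>lebesgue) = (\<integral>\<^sup>+ x. \<integral>\<^sup>+ y. f1 (x, y) \<partial>lborel \<partial>lborel)"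
      unfolding lborel.nn_integral_fst[OF f(1)] by (simp add: lborel_prod nn_integral_completion)
    also have "\<dots> = (\<integral>\<^sup>+ x. (\<integral>\<^sup>+ y. ennreal (m' y) \<partial>lborel) * indicator (ball z r) x \<partial>lborel)"
      unfolding f1_def using nn_integral_lborel_reflect[of "\<lambda>y. ennreal (m' y)"]
      by (simp add: nn_integral_multc)
    also have "\<dots> = (\<integral>\<^sup>+ y. ennreal (m' y) \<partial>lborel) * emeasure lborel (ball z r)"
      by (rule nn_integral_cmult_indicator) simp
    finally show ?thesis by (simp only: mult.commute)
  qed
  have I2: "(\<integral>\<^sup>+ w. f2 w \<partial>lebesgue) = emeasure lborel (ball z r) * (\<integral>\<^sup>+ x. ennreal (m' x) \<partial>lborel)"
  proof -
    have "(\<integral>\<^sup>+ w. f2 w \<partial>lebesgue) = (\<integral>\<^sup>+ y. \<integral>\<^sup>+ x. f2 (x, y) \<partial>lborel \<partial>lborel)"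
      unfolding lborel_pair.nn_integral_snd[OF f(2)] by (simp add: lborel_prod nn_integral_completion)
    also have "\<dots> = (\<integral>\<^sup>+ x. (\<integral>\<^sup>+ y. ennreal (m' y) \<partial>lborel) * indicator (ball z r) x \<partial>lborel)"
      unfolding f2_def using nn_integral_lborel_translate[of "\<lambda>y. ennreal (m' y)"]
      by (simp add: nn_integral_multc)
    also have "\<dots> = (\<integral>\<^sup>+ y. ennreal (m' y) \<partial>lborel) * emeasure lborel (ball z r)"
      by (rule nn_integral_cmult_indicator) simp
    finally show ?thesis by (simp only: mult.commute)
  qed
  define C where "C = 1 + r\<^sup>2"
  have kin_le: "kin (tent z r) (tent z r) w \<le> C * m (fst w - snd w) * (indicator (ball z r) (fst w) + indicator (ball z r) (snd w))" for w
  proof (cases "fst w = snd w")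
    case False
    define x y where "x = fst w" and "y = snd w"
    have Kp: "K (x - y) > 0" using K_pos[of "x - y"] False by (simp add: x_def y_def)
    let ?d = "(tent z r x - tent z r y)\<^sup>2"
    show ?thesis
    proof (cases "x \<in> ball z r \<or> y \<in> ball z r")
      case True
      have "?d \<le> (norm (x - y))\<^sup>2" using tent_Lipschitz[of z r x y] by (metis abs_le_square_iff abs_norm_cancel)
      moreover have "?d \<le> r\<^sup>2"
      proof -
        have "\<bar>tent z r x - tent z r y\<bar> \<le> \<bar>r\<bar>" using tent_nonneg[of z r x] tent_nonneg[of z r y] tent_le[of r z x] tent_le[of r z y] r by linarith
        then show ?thesis by (simp only: abs_le_square_iff)
      qed
      moreover have "(norm (x - y))\<^sup>2 \<le> C * (norm (x - y))\<^sup>2" by (simp add: C_def algebra_simps)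
      ultimately have "?d \<le> C * min ((norm (x - y))\<^sup>2) 1" by (auto simp: min_def C_def)
      then have 1: "?d * K (x - y) \<le> C * min ((norm (x - y))\<^sup>2) 1 * K (x - y)" using Kp by (intro mult_right_mono) auto
      have "kin (tent z r) (tent z r) w \<le> C * m (x - y)"
      proof -
        have "kin (tent z r) (tent z r) w = ?d * K (x - y)" by (simp add: kin_def x_def y_def power2_eq_square)
        then show ?thesis using 1 by (simp add: m_def mult.assoc)
      qed
      also have "\<dots> \<le> C * m (x - y) * (indicator (ball z r) x + indicator (ball z r) y)"
        using True m0[of "x - y"] mult_left_mono[of 1 "indicator (ball z r) x + indicator (ball z r) y" "C * m (x - y)"]
        by (auto simp: C_def)
      finally show ?thesis by (simp add: x_def y_def)
    next
      case False
      then have "tent z r x = 0" "tent z r y = 0" by (simp_all only: tent_eq_0_iff) simp_all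
      then have "kin (tent z r) (tent z r) w = 0" by (simp add: kin_def x_def y_def)
      moreover have "C * m (fst w - snd w) * (indicator (ball z r) (fst w) + indicator (ball z r) (snd w)) \<ge> 0"
        using m0 by (intro mult_nonneg_nonneg add_nonneg_nonneg) (auto simp: C_def)
      ultimately show ?thesis by simp
    qed
  qed (simp add: kin_def m_def)
  have ae: "AE w in lebesgue. m (fst w - snd w) = m' (fst w - snd w)"
    by (rule AE_lebesgue_diff) (use m'_ae in \<open>simp add: AE_completion_iff\<close>)
  have "integrable lebesgue (kin (tent z r) (tent z r))"
  proof (rule integrableI_bounded)
    show "kin (tent z r) (tent z r) \<in> borel_measurable lebesgue" by (intro kin_measurable tl)
    have "(\<integral>\<^sup>+ w. ennreal (norm (kin (tent z r) (tent z r) w)) \<partial>lebesgue)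
      \<le> (\<integral>\<^sup>+ w. ennreal C * (f1 w + f2 w) \<partial>lebesgue)"
    proof (rule nn_integral_mono_AE, use ae in eventually_elim)
      case (elim w)
      have "ennreal (norm (kin (tent z r) (tent z r) w)) \<le> ennreal (C * m (fst w - snd w) * (indicator (ball z r) (fst w) + indicator (ball z r) (snd w)))"
        using kin_le[of w] kin_nonneg[of "tent z r" w] by (intro ennreal_leI) simp
      also have "\<dots> = ennreal C * (f1 w + f2 w)"
        unfolding f1_def f2_def elim[symmetric] using m0[of "fst w - snd w"]
        by (auto simp: indicator_def C_def ennreal_mult mult_ac simp flip: ennreal_plus)
      finally show ?case .
    qed
    also have "\<dots> = ennreal C * ((\<integral>\<^sup>+ w. f1 w \<partial>lebesgue) + (\<integral>\<^sup>+ w. f2 w \<partial>lebesgue))"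
    proof -
      have "f1 \<in> borel_measurable lebesgue" "f2 \<in> borel_measurable lebesgue"
        using f by (auto intro!: measurable_completion simp: lborel_prod)
      then show ?thesis by (simp add: nn_integral_cmult nn_integral_add)
    qed
    also have "\<dots> < \<infinity>"
      unfolding I1 I2 using ball_fin m'_fin by (simp add: ennreal_mult_less_top)
    finally show "(\<integral>\<^sup>+ w. ennreal (norm (kin (tent z r) (tent z r) w)) \<partial>lebesgue) < \<infinity>" .
  qed
  moreover have "x \<notin> \<Omega> \<Longrightarrow> tent z r x = 0" for x
    using sub by (simp only: tent_eq_0_iff) blast
  ultimately show ?thesis using tl L2 by (auto simp: X_iff intro!: AE_I2)
qed

lemma sign_changing_exists: "\<exists>u\<in>X. sign_changing u"
proof -
  obtain z where "z \<in> \<Omega>" using dom_ne by blast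
  then obtain \<rho> where \<rho>: "\<rho> > 0" "ball z \<rho> \<subseteq> \<Omega>" using open_dom open_contains_ball by blast
  obtain b :: 'a where b: "b \<in> Basis" using nonempty_Basis by blast
  define r where "r = \<rho> / 4"
  define z' where "z' = z + (\<rho> / 2) *\<^sub>R b"
  have r: "r > 0" using \<rho> by (simp add: r_def)
  have dz: "dist z z' = \<rho> / 2" using \<rho> b by (simp add: z'_def dist_norm)
  have sub: "ball z r \<subseteq> \<Omega>" "ball z' r \<subseteq> \<Omega>"
  proof -
    have "ball z r \<subseteq> ball z \<rho>" using \<rho> by (intro subset_ball) (simp add: r_def)
    then show "ball z r \<subseteq> \<Omega>" using \<rho>(2) by blast
    have "ball z' r \<subseteq> ball z \<rho>"
    proof
      fix x assume "x \<in> ball z' r"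
      then show "x \<in> ball z \<rho>" using dist_triangle[of z x z'] dz \<rho>(1) by (simp add: r_def)
    qed
    then show "ball z' r \<subseteq> \<Omega>" using \<rho>(2) by blast
  qed
  have disj: "ball z r \<inter> ball z' r = {}"
    using dz \<rho>(1) by (intro disjoint_ballI) (simp add: r_def)
  define u where "u x = tent z r x - tent z' r x" for x
  have uX: "u \<in> X" unfolding u_def by (intro diff_X tent_X r sub)
  have "pos_part u x \<noteq> 0" if "x \<in> ball z r" for x
  proof -
    have "tent z' r x = 0" using that disj by (simp only: tent_eq_0_iff) blast
    moreover have "tent z r x \<noteq> 0" using that tent_eq_0_iff by blast
    ultimately show ?thesis using tent_nonneg[of z r x] by (simp add: pos_part_def u_def)
  qed
  then have "\<not> ae_zero (pos_part u)" using r by (intro not_ae_zero_if_nonzero_on_open[of "ball z r"]) auto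
  moreover have "neg_part u x \<noteq> 0" if "x \<in> ball z' r" for x
  proof -
    have "tent z r x = 0" using that disj by (simp only: tent_eq_0_iff) blast
    moreover have "tent z' r x \<noteq> 0" using that tent_eq_0_iff by blast
    ultimately show ?thesis using tent_nonneg[of z' r x] by (simp add: neg_part_def u_def)
  qed
  then have "\<not> ae_zero (neg_part u)" using r by (intro not_ae_zero_if_nonzero_on_open[of "ball z' r"]) auto
  ultimately show ?thesis using uX by (auto simp: sign_changing_def)
qed

text \<open>
  A minimizing sequence is bounded since the energy on the Nehari set is a positive multiple of the
  form \<open>a\<close>. Its limit \<open>v\<close> is sign-changing but need not satisfy the Nehari equations, so it is projected to
  \<open>comb v t \<tau>\<close>. The same combination of the parts of the sequence has no more energy than the
  sequence itself, by fibre maximality, and lower semicontinuity concludes.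
\<close>

lemma Nehari_minimizer: "\<exists>u. Nehari u \<and> (\<forall>v. Nehari v \<longrightarrow> E u \<le> E v)"
proof -
  have k0: "1 / 2 - 1 / p > 0" using p_gt by (simp add: field_simps)
  have E0: "E u \<ge> 0" if "Nehari u" for u
    using Nehari_energy[OF that] P_nonneg[of u] k0 by simp
  define S where "S = E ` {u. Nehari u}"
  have "S \<noteq> {}"
    using sign_changing_exists Nehari_projection unfolding S_def by blast
  have bdd: "bdd_below S" unfolding S_def using E0 by (intro bdd_belowI[of _ 0]) auto
  define m where "m = Inf S"
  have m_le: "m \<le> E v" if "Nehari v" for v
    unfolding m_def using that bdd by (intro cInf_lower) (auto simp: S_def)
  have "\<forall>n. \<exists>u. Nehari u \<and> E u < m + 1 / real (Suc n)"
  proof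
    fix n
    have "Inf S < m + 1 / real (Suc n)" by (simp add: m_def)
    then obtain y where "y \<in> S" "y < m + 1 / real (Suc n)" using cInf_lessD[OF \<open>S \<noteq> {}\<close>] by blast
    then show "\<exists>u. Nehari u \<and> E u < m + 1 / real (Suc n)" by (auto simp: S_def)
  qed
  from choice[OF this] obtain u where u: "\<And>n. Nehari (u n)" "\<And>n. E (u n) < m + 1 / real (Suc n)" by blast
  have uX: "u n \<in> X" for n using u(1)[of n] by (simp add: Nehari_def)
  obtain c where c: "c > 0" "\<And>u. u \<in> X \<Longrightarrow> B u u \<le> c * a u u" using coercive by blast
  have "B (u n) (u n) \<le> c * ((m + 1) / (1 / 2 - 1 / p))" for n
  proof -
    have "(1 / 2 - 1 / p) * a (u n) (u n) \<le> m + 1"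
    proof -
      have "1 / real (Suc n) \<le> 1" by simp
      then show ?thesis using Nehari_energy(1)[OF u(1)[of n]] u(2)[of n] by linarith
    qed
    then have "a (u n) (u n) \<le> (m + 1) / (1 / 2 - 1 / p)" using k0 by (simp only: pos_le_divide_eq mult.commute)
    then show ?thesis using c(1) by (intro order_trans[OF c(2)[OF uX]] mult_left_mono) auto
  qed
  from compactness[of u, OF uX this] obtain r v g where r: "strict_mono (r :: nat \<Rightarrow> nat)" "v \<in> X" "integrable lebesgue g"
    "AE x in lebesgue. (\<lambda>n. u (r n) x) \<longlonglongrightarrow> v x"
    "AE x in lebesgue. \<forall>n. (u (r n) x)\<^sup>2 \<le> g x \<and> \<bar>u (r n) x\<bar> powr p \<le> g x"
    by blast
  obtain \<kappa> where \<kappa>: "\<kappa> > 0" "\<And>v. v \<in> X \<Longrightarrow> \<not> ae_zero v \<Longrightarrow> a v v \<le> P v \<Longrightarrow> \<kappa> \<le> P v"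
    using Lp_lower_bound by blast
  have low: "\<kappa> \<le> P (pos_part (u n))" "\<kappa> \<le> P (neg_part (u n))" for n
  proof -
    have N: "a (u n) (pos_part (u n)) = P (pos_part (u n))" "a (u n) (neg_part (u n)) = P (neg_part (u n))"
      "\<not> ae_zero (pos_part (u n))" "\<not> ae_zero (neg_part (u n))"
      using u(1)[of n] by (auto simp: Nehari_def sign_changing_def)
    show "\<kappa> \<le> P (pos_part (u n))"
      using a_comb_pos[OF uX[of n], of 1 1] a_pos_neg_nonneg[OF uX[of n]] N
      by (intro \<kappa>(2) pos_part_X uX) (auto simp: comb_1)
    show "\<kappa> \<le> P (neg_part (u n))"
      using a_comb_neg[OF uX[of n], of 1 1] a_pos_neg_nonneg[OF uX[of n]] N
      by (intro \<kappa>(2) neg_part_X uX) (auto simp: comb_1)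
  qed
  have limp: "AE x in lebesgue. (\<lambda>n. pos_part (u (r n)) x) \<longlonglongrightarrow> pos_part v x"
    and limn: "AE x in lebesgue. (\<lambda>n. neg_part (u (r n)) x) \<longlonglongrightarrow> neg_part v x"
  proof -
    show "AE x in lebesgue. (\<lambda>n. pos_part (u (r n)) x) \<longlonglongrightarrow> pos_part v x"
      unfolding pos_part_def using r(4) by eventually_elim (intro tendsto_intros)
    show "AE x in lebesgue. (\<lambda>n. neg_part (u (r n)) x) \<longlonglongrightarrow> neg_part v x"
      unfolding neg_part_def using r(4) by eventually_elim (intro tendsto_intros)
  qed
  have part: "\<bar>pos_part f x\<bar> powr p \<le> \<bar>f x\<bar> powr p" "\<bar>neg_part f x\<bar> powr p \<le> \<bar>f x\<bar> powr p" for f and x :: 'a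
    using p_gt by (auto intro!: powr_mono2 simp: pos_part_def neg_part_def)
  have domp: "AE x in lebesgue. \<forall>n. \<bar>pos_part (u (r n)) x\<bar> powr p \<le> g x"
    and domn: "AE x in lebesgue. \<forall>n. \<bar>neg_part (u (r n)) x\<bar> powr p \<le> g x"
  proof -
    show "AE x in lebesgue. \<forall>n. \<bar>pos_part (u (r n)) x\<bar> powr p \<le> g x"
      using r(5) by eventually_elim (blast intro: order_trans[OF part(1)])
    show "AE x in lebesgue. \<forall>n. \<bar>neg_part (u (r n)) x\<bar> powr p \<le> g x"
      using r(5) by eventually_elim (blast intro: order_trans[OF part(2)])
  qed
  have Pp: "(\<lambda>n. P (pos_part (u (r n)))) \<longlonglongrightarrow> P (pos_part v)"
    by (intro P_tendsto[OF _ _ r(3) limp domp] X_measurable pos_part_X uX r(2))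
  have Pn: "(\<lambda>n. P (neg_part (u (r n)))) \<longlonglongrightarrow> P (neg_part v)"
    by (intro P_tendsto[OF _ _ r(3) limn domn] X_measurable neg_part_X uX r(2))
  have "P (pos_part v) \<ge> \<kappa>" using LIMSEQ_le_const[OF Pp] low by blast
  moreover have "P (neg_part v) \<ge> \<kappa>" using LIMSEQ_le_const[OF Pn] low by blast
  ultimately have "sign_changing v" using \<kappa>(1) P_ae_zero unfolding sign_changing_def by force
  then obtain t \<tau> where t: "t > 0" "\<tau> > 0" and w: "Nehari (comb v t \<tau>)"
    using Nehari_projection[OF r(2)] by blast
  have t': "0 \<le> t" "0 \<le> \<tau>" using t by auto
  \<comment> \<open>lower semicontinuity is applied to this sequence, not to \<open>u\<close>\<close>
  define q where "q n = comb (u (r n)) t \<tau>" for n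
  have limq: "AE x in lebesgue. (\<lambda>n. q n x) \<longlonglongrightarrow> comb v t \<tau> x"
    using limp limn unfolding q_def comb_def by eventually_elim (intro tendsto_intros)
  have domq: "AE x in lebesgue. \<forall>n. (q n x)\<^sup>2 \<le> (t + \<tau>)\<^sup>2 * g x"
    using r(5)
  proof eventually_elim
    case (elim x)
    show ?case
    proof
      fix n
      have "\<bar>q n x\<bar> \<le> \<bar>(t + \<tau>) * u (r n) x\<bar>"
      proof (cases "u (r n) x \<ge> 0")
        case True
        then show ?thesis using t by (simp add: q_def comb_def pos_part_def neg_part_def abs_mult mult_right_mono)
      next
        case False
        then have "\<bar>q n x\<bar> = \<tau> * \<bar>u (r n) x\<bar>"
          using t by (simp add: q_def comb_def pos_part_def neg_part_def abs_mult)
        also have "\<dots> \<le> \<bar>(t + \<tau>) * u (r n) x\<bar>" using t by (simp add: abs_mult mult_right_mono)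
        finally show ?thesis .
      qed
      then have "(q n x)\<^sup>2 \<le> ((t + \<tau>) * u (r n) x)\<^sup>2" by (simp only: abs_le_square_iff)
      also have "\<dots> \<le> (t + \<tau>)\<^sup>2 * g x" using elim by (auto simp: power_mult_distrib intro!: mult_left_mono)
      finally show "(q n x)\<^sup>2 \<le> (t + \<tau>)\<^sup>2 * g x" .
    qed
  qed
  have qX: "q n \<in> X" for n unfolding q_def by (intro comb_X uX)
  have Pq: "(\<lambda>n. P (q n)) \<longlonglongrightarrow> P (comb v t \<tau>)"
    unfolding q_def P_comb[OF uX t'] P_comb[OF r(2) t'] by (intro tendsto_intros Pp Pn)
  have aq: "a (q n) (q n) \<le> 2 * (m + 1 / real (Suc (r n))) + 2 / p * P (q n)" for n
    using Nehari_E_comb_le[OF u(1)[of "r n"] t'] u(2)[of "r n"] unfolding q_def[symmetric]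
    by (simp add: E_def)
  have "(\<lambda>n. 1 / real (Suc (r n))) \<longlonglongrightarrow> 0"
    using LIMSEQ_subseq_LIMSEQ[OF LIMSEQ_Suc[OF lim_1_over_n] r(1)] by (simp add: o_def)
  then have "(\<lambda>n. 2 * (m + 1 / real (Suc (r n))) + 2 / p * P (q n)) \<longlonglongrightarrow> 2 * (m + 0) + 2 / p * P (comb v t \<tau>)"
    by (intro tendsto_intros Pq)
  from a_lsc[OF qX comb_X[OF r(2)] _ limq domq aq this] r(3)
  have "a (comb v t \<tau>) (comb v t \<tau>) \<le> 2 * m + 2 / p * P (comb v t \<tau>)" by simp
  then have "E (comb v t \<tau>) \<le> m" by (simp add: E_def)
  with w m_le show ?thesis by (intro exI[of _ "comb v t \<tau>"]) (auto intro: order_trans)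
qed

end

section \<open>The minimizer is a solution\<close>

text \<open>
  The tangent inequality of the convex function \<open>\<bar>x\<bar> powr p\<close>, from Young's inequality. It bounds the energy
  of a perturbation from above without differentiating under the integral.
\<close>

lemma powr_tangent:
  fixes x h p :: real
  assumes p: "p > 1"
  shows "\<bar>x\<bar> powr p + p * (\<bar>x\<bar> powr (p - 2) * x * h) \<le> \<bar>x + h\<bar> powr p"
proof (cases "x = 0")
  case False
  define q where "q = p / (p - 1)"
  have "\<bar>x\<bar> powr (p - 1) * \<bar>x + h\<bar> \<le> (\<bar>x\<bar> powr (p - 1)) powr q / q + \<bar>x + h\<bar> powr p / p"
    using p by (intro Youngs_inequality) (auto simp: q_def field_simps)
  also have "(\<bar>x\<bar> powr (p - 1)) powr q = \<bar>x\<bar> powr p" using p by (simp add: powr_powr q_def)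
  also have "\<bar>x\<bar> powr p / q = \<bar>x\<bar> powr p - \<bar>x\<bar> powr p / p" using p by (simp add: q_def field_simps)
  finally have 1: "p * (\<bar>x\<bar> powr (p - 1) * \<bar>x + h\<bar>) \<le> p * (\<bar>x\<bar> powr p - \<bar>x\<bar> powr p / p + \<bar>x + h\<bar> powr p / p)"
    using p by (intro mult_left_mono) auto
  have e1: "\<bar>x\<bar> powr (p - 2) * \<bar>x\<bar> = \<bar>x\<bar> powr (p - 1)"
    using False powr_add[of "\<bar>x\<bar>" "p - 2" 1] by simp
  have e2: "\<bar>x\<bar> powr (p - 1) * \<bar>x\<bar> = \<bar>x\<bar> powr p"
    using False powr_add[of "\<bar>x\<bar>" "p - 1" 1] by simp
  have "\<bar>x\<bar> powr (p - 2) * (x * (x + h)) \<le> \<bar>x\<bar> powr (p - 2) * (\<bar>x\<bar> * \<bar>x + h\<bar>)"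
    by (intro mult_left_mono) (auto simp flip: abs_mult)
  also have "\<dots> = \<bar>x\<bar> powr (p - 1) * \<bar>x + h\<bar>" unfolding e1[symmetric] by (simp only: mult.assoc)
  finally have 2: "\<bar>x\<bar> powr (p - 2) * (x * (x + h)) \<le> \<bar>x\<bar> powr (p - 1) * \<bar>x + h\<bar>" .
  have "\<bar>x\<bar> powr (p - 2) * (x * x) = \<bar>x\<bar> powr p"
  proof -
    have "x * x = \<bar>x\<bar> * \<bar>x\<bar>" by simp
    then have "\<bar>x\<bar> powr (p - 2) * (x * x) = \<bar>x\<bar> powr (p - 2) * \<bar>x\<bar> * \<bar>x\<bar>" by (simp only: mult.assoc)
    then show ?thesis unfolding e1 e2 .
  qed
  then have 3: "\<bar>x\<bar> powr (p - 2) * x * h = \<bar>x\<bar> powr (p - 2) * (x * (x + h)) - \<bar>x\<bar> powr p"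
    by (simp add: algebra_simps)
  have "p * (\<bar>x\<bar> powr (p - 2) * x * h) \<le> p * (\<bar>x\<bar> powr (p - 1) * \<bar>x + h\<bar>) - p * \<bar>x\<bar> powr p"
    using mult_left_mono[OF 2, of p] p unfolding 3 by (simp add: right_diff_distrib)
  also have "\<dots> \<le> \<bar>x + h\<bar> powr p - \<bar>x\<bar> powr p"
    using 1 p by (simp add: algebra_simps)
  finally show ?thesis by simp
qed (use p in simp)

lemma powr_mixed_le:
  fixes x h p :: real
  assumes p: "p > 2"
  shows "\<bar>\<bar>x\<bar> powr (p - 2) * x * h\<bar> \<le> \<bar>x\<bar> powr p + \<bar>h\<bar> powr p"
proof (cases "x = 0")
  case False
  define m where "m = max \<bar>x\<bar> \<bar>h\<bar>"
  have m: "m > 0" using False by (simp add: m_def)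
  have "\<bar>\<bar>x\<bar> powr (p - 2) * x * h\<bar> = \<bar>x\<bar> powr (p - 2) * (\<bar>x\<bar> * \<bar>h\<bar>)" by (simp add: abs_mult mult.assoc)
  also have "\<dots> \<le> m powr (p - 2) * (m * m)"
    using p by (intro mult_mono powr_mono2) (auto simp: m_def)
  also have "\<dots> = m powr p"
    using m powr_add[of m "p - 2" 2] by (simp add: power2_eq_square)
  also have "\<dots> \<le> \<bar>x\<bar> powr p + \<bar>h\<bar> powr p" by (auto simp: m_def max_def)
  finally show ?thesis .
qed simp

text \<open>
  By sequential compactness of \<open>A\<close>: a strict sign on the slice survives a small change of the
  parameter, uniformly on the slice.
\<close>

lemma positive_near_slice:
  fixes F :: "'a::metric_space \<times> real \<Rightarrow> real"
  assumes cont: "continuous_on UNIV F" and A: "compact A" and pos: "\<And>z. z \<in> A \<Longrightarrow> F (z, 0) > 0"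
  shows "\<forall>\<^sub>F \<epsilon> in at_right 0. \<forall>z\<in>A. F (z, \<epsilon>) > 0"
proof -
  have "\<exists>d>0. \<forall>\<epsilon>. 0 < \<epsilon> \<and> \<epsilon> < d \<longrightarrow> (\<forall>z\<in>A. F (z, \<epsilon>) > 0)"
  proof (rule ccontr)
    assume neg: "\<not> ?thesis"
    have "\<forall>n. \<exists>y. fst y \<in> A \<and> 0 < snd y \<and> snd y < 1 / real (Suc n) \<and> F y \<le> 0"
    proof
      fix n
      have "1 / real (Suc n) > 0" by simp
      with neg obtain \<epsilon> z where "0 < \<epsilon>" "\<epsilon> < 1 / real (Suc n)" "z \<in> A" "\<not> F (z, \<epsilon>) > 0" by blast
      then show "\<exists>y. fst y \<in> A \<and> 0 < snd y \<and> snd y < 1 / real (Suc n) \<and> F y \<le> 0"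
        by (intro exI[of _ "(z, \<epsilon>)"]) auto
    qed
    from choice[OF this] obtain y where y: "\<And>n. fst (y n) \<in> A" "\<And>n. 0 < snd (y n)"
      "\<And>n. snd (y n) < 1 / real (Suc n)" "\<And>n. F (y n) \<le> 0" by blast
    obtain z r where z: "z \<in> A" "strict_mono (r :: nat \<Rightarrow> nat)" "(\<lambda>n. fst (y (r n))) \<longlonglongrightarrow> z"
      using A[unfolded compact_def, rule_format, of "\<lambda>n. fst (y n)"] y(1) by (auto simp: o_def)
    have "(\<lambda>n. snd (y n)) \<longlonglongrightarrow> 0"
    proof (rule tendsto_sandwich[of "\<lambda>_. 0" _ _ "\<lambda>n. 1 / real (Suc n)"])
      show "(\<lambda>n. 1 / real (Suc n)) \<longlonglongrightarrow> 0" by (rule LIMSEQ_Suc[OF lim_1_over_n])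
      show "\<forall>\<^sub>F n in sequentially. 0 \<le> snd (y n)" using y(2) by (intro always_eventually allI less_imp_le)
      show "\<forall>\<^sub>F n in sequentially. snd (y n) \<le> 1 / real (Suc n)" using y(3) by (intro always_eventually allI less_imp_le)
    qed simp
    from LIMSEQ_subseq_LIMSEQ[OF this z(2)] have "(\<lambda>n. snd (y (r n))) \<longlonglongrightarrow> 0" by (simp add: o_def)
    from tendsto_Pair[OF z(3) this] have "(\<lambda>n. y (r n)) \<longlonglongrightarrow> (z, 0)" by simp
    moreover have "isCont F (z, 0)" using cont by (simp add: continuous_on_eq_continuous_at)
    ultimately have "(\<lambda>n. F (y (r n))) \<longlonglongrightarrow> F (z, 0)" by (rule isCont_tendsto_compose[rotated])
    then have "F (z, 0) \<le> 0" by (rule LIMSEQ_le_const2) (use y(4) in auto)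
    with pos[OF z(1)] show False by simp
  qed
  then show ?thesis unfolding eventually_at_right_field by blast
qed

context nonlocal_problem
begin

lemma N_integrable:
  assumes w: "w \<in> X" and \<phi>: "\<phi> \<in> X"
  shows "integrable lebesgue (\<lambda>x. \<bar>w x\<bar> powr (p - 2) * w x * \<phi> x)"
proof (rule Bochner_Integration.integrable_bound)
  note [measurable] = X_measurable[OF w] X_measurable[OF \<phi>]
  show "integrable lebesgue (\<lambda>x. \<bar>w x\<bar> powr p + \<bar>\<phi> x\<bar> powr p)"
    using X_Lp[OF w] X_Lp[OF \<phi>] by (rule Bochner_Integration.integrable_add)
  show "(\<lambda>x. \<bar>w x\<bar> powr (p - 2) * w x * \<phi> x) \<in> borel_measurable lebesgue" by measurable
  show "AE x in lebesgue. norm (\<bar>w x\<bar> powr (p - 2) * w x * \<phi> x) \<le> norm (\<bar>w x\<bar> powr p + \<bar>\<phi> x\<bar> powr p)"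
    using powr_mixed_le[OF p_gt] by (auto intro!: AE_I2 intro: order_trans[OF _ abs_ge_self])
qed

lemma E_perturb_le:
  assumes w: "w \<in> X" and \<phi>: "\<phi> \<in> X"
  shows "E (\<lambda>x. w x + \<epsilon> * \<phi> x) \<le> E w + \<epsilon> * (a w \<phi> - N w \<phi>) + \<epsilon>\<^sup>2 / 2 * a \<phi> \<phi>"
proof -
  have wX: "(\<lambda>x. w x + \<epsilon> * \<phi> x) \<in> X" using X_scale_add[OF w \<phi>, of 1 \<epsilon>] by simp
  have "P w + p * \<epsilon> * N w \<phi> = (\<integral>x. \<bar>w x\<bar> powr p + p * \<epsilon> * (\<bar>w x\<bar> powr (p - 2) * w x * \<phi> x) \<partial>lebesgue)"
    using X_Lp[OF w] N_integrable[OF w \<phi>] by (simp add: P_def N_def)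
  also have "\<dots> \<le> P (\<lambda>x. w x + \<epsilon> * \<phi> x)"
    unfolding P_def
  proof (rule integral_mono[OF _ X_Lp[OF wX]])
    show "integrable lebesgue (\<lambda>x. \<bar>w x\<bar> powr p + p * \<epsilon> * (\<bar>w x\<bar> powr (p - 2) * w x * \<phi> x))"
      using X_Lp[OF w] N_integrable[OF w \<phi>] by (intro Bochner_Integration.integrable_add integrable_mult_right)
    show "\<bar>w x\<bar> powr p + p * \<epsilon> * (\<bar>w x\<bar> powr (p - 2) * w x * \<phi> x) \<le> \<bar>w x + \<epsilon> * \<phi> x\<bar> powr p" for x
      using powr_tangent[of p "w x" "\<epsilon> * \<phi> x"] p_gt by (simp add: mult_ac)
  qed
  finally have "P w + p * \<epsilon> * N w \<phi> \<le> P (\<lambda>x. w x + \<epsilon> * \<phi> x)" .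
  then have "(P w + p * \<epsilon> * N w \<phi>) / p \<le> P (\<lambda>x. w x + \<epsilon> * \<phi> x) / p" using p_gt by (intro divide_right_mono) auto
  then have 1: "P w / p + \<epsilon> * N w \<phi> \<le> P (\<lambda>x. w x + \<epsilon> * \<phi> x) / p" using p_gt by (simp add: add_divide_distrib)
  have 2: "a (\<lambda>x. w x + \<epsilon> * \<phi> x) (\<lambda>x. w x + \<epsilon> * \<phi> x) = a w w + 2 * \<epsilon> * a w \<phi> + \<epsilon>\<^sup>2 * a \<phi> \<phi>"
    using a_square[OF w \<phi>, of 1 \<epsilon>] by simp
  show ?thesis unfolding E_def 2 using 1 by (simp add: algebra_simps add_divide_distrib)
qed

lemma N_comb:
  assumes u: "u \<in> X" and \<phi>: "\<phi> \<in> X" and t: "t > 0" "\<tau> > 0"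
  shows "N (comb u t \<tau>) \<phi> = t powr (p - 1) * N (pos_part u) \<phi> + \<tau> powr (p - 1) * N (neg_part u) \<phi>"
proof -
  have e: "\<bar>c * y\<bar> powr (p - 2) * (c * y) = c powr (p - 1) * (\<bar>y\<bar> powr (p - 2) * y)" if "c > 0" for c y :: real
    using that powr_add[of c "p - 2" 1] by (simp add: abs_mult powr_mult)
  have "\<bar>comb u t \<tau> x\<bar> powr (p - 2) * comb u t \<tau> x * \<phi> x
    = t powr (p - 1) * (\<bar>pos_part u x\<bar> powr (p - 2) * pos_part u x * \<phi> x)
      + \<tau> powr (p - 1) * (\<bar>neg_part u x\<bar> powr (p - 2) * neg_part u x * \<phi> x)" for x
  proof (cases "u x \<ge> 0")
    case True
    then have "comb u t \<tau> x = t * u x" "pos_part u x = u x" "neg_part u x = 0"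
      by (auto simp: comb_def pos_part_def neg_part_def)
    then show ?thesis by (simp only: e[OF t(1)], (simp add: mult_ac)?)
  next
    case False
    then have "comb u t \<tau> x = \<tau> * u x" "pos_part u x = 0" "neg_part u x = u x"
      by (auto simp: comb_def pos_part_def neg_part_def)
    then show ?thesis by (simp only: e[OF t(2)], (simp add: mult_ac)?)
  qed
  then show ?thesis
    unfolding N_def using N_integrable[OF pos_part_X[OF u] \<phi>] N_integrable[OF neg_part_X[OF u] \<phi>] by simp
qed

text \<open>
  Taking positive or negative parts is not differentiable in \<open>H\<close>; only continuity along dominated
  pointwise limits is available, and it is enough for the topological argument below.
\<close>

lemma form_tendsto:
  assumes w: "\<And>n. w n \<in> X" "v \<in> X" and h: "h \<in> X"
    and lim: "\<And>x. (\<lambda>n. w n x) \<longlonglongrightarrow> v x"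
    and dom: "\<And>n x. \<bar>w n x\<bar> \<le> \<bar>h x\<bar>"
    and kdom: "\<And>n z. kin (w n) (w n) z \<le> \<kappa> z" "integrable lebesgue \<kappa>"
    and F: "F 0 = 0" "\<And>a b :: real. \<bar>F a - F b\<bar> \<le> \<bar>a - b\<bar>"
  shows "(\<lambda>n. a (w n) (\<lambda>x. F (w n x))) \<longlonglongrightarrow> a v (\<lambda>x. F (v x))"
    and "(\<lambda>n. P (\<lambda>x. F (w n x))) \<longlonglongrightarrow> P (\<lambda>x. F (v x))"
proof -
  have FX: "(\<lambda>x. F (w n x)) \<in> X" "(\<lambda>x. F (v x)) \<in> X" for n
    by (rule X_contraction[OF w(1) F], rule X_contraction[OF w(2) F])
  have Flim: "(\<lambda>n. F (w n x)) \<longlonglongrightarrow> F (v x)" for x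
    by (rule isCont_tendsto_compose[OF contraction_isCont[OF F(2)] lim])
  have Fle: "\<bar>F b\<bar> \<le> \<bar>b\<bar>" for b using F(2)[of b 0] F(1) by simp
  have "(\<lambda>n. B (w n) (\<lambda>x. F (w n x))) \<longlonglongrightarrow> B v (\<lambda>x. F (v x))"
    unfolding B_def
  proof (rule integral_dominated_convergence)
    show "kin v (\<lambda>x. F (v x)) \<in> borel_measurable lebesgue"
      by (rule kin_measurable[OF X_measurable[OF w(2)] X_measurable[OF FX(2)]])
    show "kin (w n) (\<lambda>x. F (w n x)) \<in> borel_measurable lebesgue" for n
      by (rule kin_measurable[OF X_measurable[OF w(1)] X_measurable[OF FX(1)]])
    show "integrable lebesgue (\<lambda>z. 2 * \<kappa> z)" using kdom(2) by simp
    show "AE z in lebesgue. (\<lambda>n. kin (w n) (\<lambda>x. F (w n x)) z) \<longlonglongrightarrow> kin v (\<lambda>x. F (v x)) z"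
      unfolding kin_def by (rule AE_I2) (intro tendsto_mult tendsto_diff tendsto_const lim Flim)
    show "AE z in lebesgue. norm (kin (w n) (\<lambda>x. F (w n x)) z) \<le> 2 * \<kappa> z" for n
    proof (rule AE_I2)
      fix z
      show "norm (kin (w n) (\<lambda>x. F (w n x)) z) \<le> 2 * \<kappa> z"
        using kin_abs_le[of "w n" "\<lambda>x. F (w n x)" z] kin_contraction_le[of F "w n" z, OF F(2)] kdom(1)[of n z]
        unfolding real_norm_def by linarith
    qed
  qed
  moreover have "(\<lambda>n. \<integral>x. W x * (w n x * F (w n x)) \<partial>lebesgue) \<longlonglongrightarrow> (\<integral>x. W x * (v x * F (v x)) \<partial>lebesgue)"
  proof -
    obtain C where C: "AE x in lebesgue. \<bar>W x\<bar> \<le> C" "C > 0" using W_bounded by blast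
    note [measurable] = X_measurable[OF w(1)] X_measurable[OF w(2)] X_measurable[OF FX(1)] X_measurable[OF FX(2)]
    show ?thesis
    proof (rule integral_dominated_convergence)
      show "integrable lebesgue (\<lambda>x. C * (h x)\<^sup>2)" using X_L2[OF h] by simp
      show "AE x in lebesgue. (\<lambda>n. W x * (w n x * F (w n x))) \<longlonglongrightarrow> W x * (v x * F (v x))"
        by (rule AE_I2) (intro tendsto_mult tendsto_const lim Flim)
      show "AE x in lebesgue. norm (W x * (w n x * F (w n x))) \<le> C * (h x)\<^sup>2" for n
        using C(1)
      proof eventually_elim
        case (elim x)
        have "\<bar>w n x\<bar> * \<bar>F (w n x)\<bar> \<le> \<bar>h x\<bar> * \<bar>h x\<bar>"
          using dom[of n x] Fle[of "w n x"] by (intro mult_mono) auto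
        from mult_mono[OF elim this] have "\<bar>W x\<bar> * (\<bar>w n x\<bar> * \<bar>F (w n x)\<bar>) \<le> C * (\<bar>h x\<bar> * \<bar>h x\<bar>)"
          using C(2) by simp
        then show ?case by (simp add: abs_mult power2_eq_square)
      qed
    qed measurable
  qed
  ultimately show "(\<lambda>n. a (w n) (\<lambda>x. F (w n x))) \<longlonglongrightarrow> a v (\<lambda>x. F (v x))"
    unfolding a_def by (rule tendsto_add)
  show "(\<lambda>n. P (\<lambda>x. F (w n x))) \<longlonglongrightarrow> P (\<lambda>x. F (v x))"
  proof (rule P_tendsto[OF _ _ X_Lp[OF h]])
    show "AE x in lebesgue. \<forall>n. \<bar>F (w n x)\<bar> powr p \<le> \<bar>h x\<bar> powr p"
      using p_gt by (intro AE_I2 allI powr_mono2 order_trans[OF Fle dom]) auto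
    show "AE x in lebesgue. (\<lambda>n. F (w n x)) \<longlonglongrightarrow> F (v x)" by (rule AE_I2[OF Flim])
  qed (rule X_measurable[OF FX(1)], rule X_measurable[OF FX(2)])
qed

text \<open>
  The parameters are nested as \<open>((t, \<tau>), \<epsilon>)\<close>, so that \<open>\<epsilon> = 0\<close> is the slice formed by the fibre of \<open>u\<close>.
\<close>

definition pert :: "('a \<Rightarrow> real) \<Rightarrow> ('a \<Rightarrow> real) \<Rightarrow> (real \<times> real) \<times> real \<Rightarrow> 'a \<Rightarrow> real" where
  "pert u \<phi> y = (\<lambda>x. comb u (fst (fst y)) (snd (fst y)) x + snd y * \<phi> x)"

lemma pert_X: "u \<in> X \<Longrightarrow> \<phi> \<in> X \<Longrightarrow> pert u \<phi> y \<in> X"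
  using X_scale_add[of "comb u (fst (fst y)) (snd (fst y))" \<phi> 1 "snd y"] by (simp add: pert_def comb_X)

lemma pert_continuous:
  assumes u: "u \<in> X" and \<phi>: "\<phi> \<in> X"
    and F: "F 0 = 0" "\<And>a b :: real. \<bar>F a - F b\<bar> \<le> \<bar>a - b\<bar>"
  shows "continuous_on UNIV (\<lambda>y. a (pert u \<phi> y) (\<lambda>x. F (pert u \<phi> y x)))"
    and "continuous_on UNIV (\<lambda>y. P (\<lambda>x. F (pert u \<phi> y x)))"
proof -
  have main: "(\<lambda>n. a (pert u \<phi> (y n)) (\<lambda>x. F (pert u \<phi> (y n) x))) \<longlonglongrightarrow> a (pert u \<phi> l) (\<lambda>x. F (pert u \<phi> l x)) \<and>
    (\<lambda>n. P (\<lambda>x. F (pert u \<phi> (y n) x))) \<longlonglongrightarrow> P (\<lambda>x. F (pert u \<phi> l x))" if y: "y \<longlonglongrightarrow> l" for y l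
  proof -
    have lim: "(\<lambda>n. pert u \<phi> (y n) x) \<longlonglongrightarrow> pert u \<phi> l x" for x
      unfolding pert_def comb_def by (intro tendsto_intros y)
    have "Bseq y" by (rule convergent_imp_Bseq[OF convergentI[OF y]])
    then obtain R where R: "R > 0" "\<And>n. norm (y n) \<le> R" by (auto elim: BseqE)
    have b: "\<bar>fst (fst (y n))\<bar> \<le> R" "\<bar>snd (fst (y n))\<bar> \<le> R" "\<bar>snd (y n)\<bar> \<le> R" for n
      using norm_fst_le[of "fst (fst (y n))" "snd (fst (y n))"] norm_snd_le[of "snd (fst (y n))" "fst (fst (y n))"]
        norm_fst_le[of "fst (y n)" "snd (y n)"] norm_snd_le[of "snd (y n)" "fst (y n)"] R(2)[of n] by auto
    define h where "h = (\<lambda>x. R * \<bar>u x\<bar> + R * \<bar>\<phi> x\<bar>)"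
    have absX: "(\<lambda>x. \<bar>f x\<bar>) \<in> X" if "f \<in> X" for f by (rule X_contraction[OF that]) auto
    have hX: "h \<in> X" unfolding h_def by (intro X_scale_add absX u \<phi>)
    have dom: "\<bar>pert u \<phi> (y n) x\<bar> \<le> \<bar>h x\<bar>" for n x
    proof -
      have "\<bar>comb u (fst (fst (y n))) (snd (fst (y n))) x\<bar> \<le> R * \<bar>u x\<bar>"
        using b[of n] by (cases "u x \<ge> 0") (auto simp: comb_def pos_part_def neg_part_def abs_mult max_def min_def intro!: mult_right_mono)
      moreover have "\<bar>snd (y n) * \<phi> x\<bar> \<le> R * \<bar>\<phi> x\<bar>"
        using b[of n] by (simp add: abs_mult mult_right_mono)
      ultimately have "\<bar>pert u \<phi> (y n) x\<bar> \<le> h x" unfolding pert_def h_def by linarith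
      then show ?thesis by linarith
    qed
    define \<kappa> where "\<kappa> z = 3 * R\<^sup>2 * (kin (pos_part u) (pos_part u) z + kin (neg_part u) (neg_part u) z + kin \<phi> \<phi> z)" for z
    have \<kappa>_int: "integrable lebesgue \<kappa>"
      unfolding \<kappa>_def by (intro integrable_mult_right Bochner_Integration.integrable_add X_kin pos_part_X neg_part_X u \<phi>)
    have kdom: "kin (pert u \<phi> (y n)) (pert u \<phi> (y n)) z \<le> \<kappa> z" for n z
    proof (cases "fst z = snd z")
      case False
      have sq: "(t * i + \<tau> * j + e * k) * (t * i + \<tau> * j + e * k) \<le> 3 * R\<^sup>2 * (i * i + j * j + k * k)"
        if "\<bar>t\<bar> \<le> R" "\<bar>\<tau>\<bar> \<le> R" "\<bar>e\<bar> \<le> R" for t \<tau> e i j k :: real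
      proof -
        have "(A + B + C) * (A + B + C) \<le> 3 * (A\<^sup>2 + B\<^sup>2 + C\<^sup>2)" for A B C :: real
        proof -
          have "0 \<le> (A - B)\<^sup>2 + (B - C)\<^sup>2 + (A - C)\<^sup>2" by simp
          then show ?thesis by (simp add: power2_eq_square algebra_simps)
        qed
        also have "3 * ((t * i)\<^sup>2 + (\<tau> * j)\<^sup>2 + (e * k)\<^sup>2) \<le> 3 * (R\<^sup>2 * i\<^sup>2 + R\<^sup>2 * j\<^sup>2 + R\<^sup>2 * k\<^sup>2)"
        proof -
          have sqR: "c\<^sup>2 \<le> R\<^sup>2" if "\<bar>c\<bar> \<le> R" for c using power_mono[OF that, of 2] by simp
          show ?thesis unfolding power_mult_distrib
            by (intro mult_left_mono add_mono mult_right_mono sqR that) auto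
        qed
        also have "\<dots> = 3 * R\<^sup>2 * (i * i + j * j + k * k)" by (simp add: power2_eq_square algebra_simps)
        finally show ?thesis .
      qed
      show ?thesis
        using mult_right_mono[OF sq[OF b[of n], of "pos_part u (fst z) - pos_part u (snd z)" "neg_part u (fst z) - neg_part u (snd z)" "\<phi> (fst z) - \<phi> (snd z)"], of "K (fst z - snd z)"]
          K_pos[of "fst z - snd z"] False
        by (simp add: kin_def \<kappa>_def pert_def comb_def algebra_simps)
    qed (simp add: kin_def \<kappa>_def)
    show ?thesis
      using form_tendsto[of "\<lambda>n. pert u \<phi> (y n)" "pert u \<phi> l" h \<kappa> F, OF pert_X[OF u \<phi>] pert_X[OF u \<phi>] hX lim dom kdom \<kappa>_int F] by blast
  qed
  show "continuous_on UNIV (\<lambda>y. a (pert u \<phi> y) (\<lambda>x. F (pert u \<phi> y x)))"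
    "continuous_on UNIV (\<lambda>y. P (\<lambda>x. F (pert u \<phi> y x)))"
    unfolding continuous_on_sequentially using main by (auto simp: o_def)
qed

text \<open>
  Suppose the energy decreases at unit rate along \<open>\<phi>\<close>. On a small square around \<open>(1, 1)\<close> it still
  decreases at rate \<open>1 / 2\<close> from each point of the fibre, so every \<open>comb u t \<tau> + \<epsilon> * \<phi>\<close> has less energy
  than \<open>u\<close> for small \<open>\<epsilon> > 0\<close>. On the other hand, the defects \<open>F\<close> and \<open>G\<close> of the two Nehari equations
  have strict signs on the faces of the square for \<open>\<epsilon> = 0\<close>, hence for small \<open>\<epsilon>\<close>, and Poincare-Miranda
  finds a point of the Nehari set among these functions.
\<close>

lemma Nehari_minimizer_no_descent:
  assumes u: "Nehari u" and min: "\<And>v. Nehari v \<Longrightarrow> E u \<le> E v" and \<phi>: "\<phi> \<in> X"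
  shows "a u \<phi> - N u \<phi> \<noteq> -1"
proof
  assume descent: "a u \<phi> - N u \<phi> = -1"
  have uX: "u \<in> X" and nz: "\<not> ae_zero (pos_part u)" "\<not> ae_zero (neg_part u)"
    and eq: "a u (pos_part u) = P (pos_part u)" "a u (neg_part u) = P (neg_part u)"
    using u by (auto simp: Nehari_def sign_changing_def)
  define \<alpha> where "\<alpha> = a (pos_part u) (pos_part u)"
  define \<beta> where "\<beta> = a (neg_part u) (neg_part u)"
  define \<gamma> where "\<gamma> = a (pos_part u) (neg_part u)"
  have g: "\<gamma> \<ge> 0" unfolding \<gamma>_def by (rule a_pos_neg_nonneg[OF uX])
  have Pp: "P (pos_part u) = \<alpha> + \<gamma>" "\<alpha> + \<gamma> > 0"
    using eq(1) a_comb_pos[OF uX, of 1 1] P_pos[OF pos_part_X[OF uX] nz(1)] by (simp_all add: comb_1 \<alpha>_def \<gamma>_def)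
  have Pn: "P (neg_part u) = \<beta> + \<gamma>" "\<beta> + \<gamma> > 0"
    using eq(2) a_comb_neg[OF uX, of 1 1] P_pos[OF neg_part_X[OF uX] nz(2)] by (simp_all add: comb_1 \<beta>_def \<gamma>_def)
  define \<Lambda> where "\<Lambda> z = fst z * a (pos_part u) \<phi> + snd z * a (neg_part u) \<phi>
    - (fst z powr (p - 1) * N (pos_part u) \<phi> + snd z powr (p - 1) * N (neg_part u) \<phi>)" for z :: "real \<times> real"
  have \<Lambda>_eq: "a (comb u t \<tau>) \<phi> - N (comb u t \<tau>) \<phi> = \<Lambda> (t, \<tau>)" if "t > 0" "\<tau> > 0" for t \<tau>
    unfolding N_comb[OF uX \<phi> that] \<Lambda>_def
    unfolding comb_def using a_linear[OF pos_part_X[OF uX] neg_part_X[OF uX] \<phi>, of t \<tau>] by simp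
  have "isCont \<Lambda> (1, 1)" unfolding \<Lambda>_def by (intro continuous_intros) auto
  moreover have "\<Lambda> (1, 1) < - 1 / 2" using \<Lambda>_eq[of 1 1] descent by (simp add: comb_1)
  ultimately have "\<forall>\<^sub>F z in at (1, 1). \<Lambda> z < - 1 / 2"
    unfolding isCont_def by (rule order_tendstoD(2))
  then obtain d where d: "d > 0" "\<And>z. z \<noteq> (1, 1) \<Longrightarrow> dist z (1, 1) < d \<Longrightarrow> \<Lambda> z < - 1 / 2"
    by (auto simp: eventually_at)
  have d': "\<Lambda> z < - 1 / 2" if "dist z (1, 1) < d" for z
    using d(2)[OF _ that] \<open>\<Lambda> (1, 1) < - 1 / 2\<close> by (cases "z = (1, 1)") auto
  \<comment> \<open>the square of half-side \<open>\<delta>\<close> lies in the positive quadrant and in the ball of radius \<open>d\<close>\<close>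
  define \<delta> where "\<delta> = min (1 / 2) (d / 3)"
  have \<delta>: "0 < \<delta>" "\<delta> < 1" using d(1) by (auto simp: \<delta>_def)
  define r where "r = 1 - \<delta>"
  define R where "R = 1 + \<delta>"
  have rR: "0 < r" "r < 1" "1 < R" "r \<le> R" using \<delta> by (auto simp: r_def R_def)
  define S where "S = {r..R} \<times> {r..R}"
  have \<Lambda>_neg: "\<Lambda> (t, \<tau>) < - 1 / 2" if "t \<in> {r..R}" "\<tau> \<in> {r..R}" for t \<tau>
  proof (rule d')
    have "dist (t, \<tau>) (1, 1) \<le> \<bar>t - 1\<bar> + \<bar>\<tau> - 1\<bar>"
      unfolding dist_Pair_Pair by (rule order_trans[OF sqrt_sum_squares_le_sum_abs]) (simp add: dist_real_def)
    also have "\<dots> \<le> \<delta> + \<delta>" using that by (intro add_mono) (auto simp: r_def R_def)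
    also have "\<dots> < d" using d(1) by (simp add: \<delta>_def min_def)
    finally show "dist (t, \<tau>) (1, 1) < d" .
  qed
  let ?w = "pert u \<phi>"
  define F where "F y = a (?w y) (pos_part (?w y)) - P (pos_part (?w y))" for y
  define G where "G y = a (?w y) (neg_part (?w y)) - P (neg_part (?w y))" for y
  have Fp: "max 0 0 = (0::real)" "\<bar>max a 0 - max b 0\<bar> \<le> \<bar>a - b\<bar>" for a b :: real by (auto simp: max_def)
  have Fn: "min 0 0 = (0::real)" "\<bar>min a 0 - min b 0\<bar> \<le> \<bar>a - b\<bar>" for a b :: real by (auto simp: min_def)
  have contP: "continuous_on UNIV (\<lambda>y. P (pos_part (?w y)))" "continuous_on UNIV (\<lambda>y. P (neg_part (?w y)))"
    using pert_continuous(2)[OF uX \<phi>, of "\<lambda>b. max b 0", OF Fp] pert_continuous(2)[OF uX \<phi>, of "\<lambda>b. min b 0", OF Fn]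
    by (simp_all add: pos_part_def[abs_def] neg_part_def[abs_def])
  have cont: "continuous_on UNIV F" "continuous_on UNIV G"
    unfolding F_def G_def
    using pert_continuous(1)[OF uX \<phi>, of "\<lambda>b. max b 0", OF Fp] pert_continuous(1)[OF uX \<phi>, of "\<lambda>b. min b 0", OF Fn] contP
    by (auto simp: pos_part_def[abs_def] neg_part_def[abs_def] intro!: continuous_intros)
  have w0: "?w ((t, \<tau>), 0) = comb u t \<tau>" for t \<tau> by (simp add: pert_def)
  have split: "t powr p = t * t powr (p - 1)" "t powr (p - 1) = t * t powr (p - 2)" if "t > 0" for t
    using that powr_add[of t 1 "p - 1"] powr_add[of t 1 "p - 2"] by simp_all
  have F0: "F ((t, \<tau>), 0) = t * (t * \<alpha> + \<tau> * \<gamma> - t * t powr (p - 2) * (\<alpha> + \<gamma>))" if "t > 0" "\<tau> > 0" for t \<tau>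
    using a_scale[OF pos_part_X[OF uX] comb_X[OF uX], of t t \<tau>] a_comb_pos[OF uX, of t \<tau>] that
    by (simp add: F_def w0 pos_part_comb a_sym[of "comb u t \<tau>"] P_scale Pp(1) split \<alpha>_def \<gamma>_def algebra_simps)
  have G0: "G ((t, \<tau>), 0) = \<tau> * (\<tau> * \<beta> + t * \<gamma> - \<tau> * \<tau> powr (p - 2) * (\<beta> + \<gamma>))" if "t > 0" "\<tau> > 0" for t \<tau>
    using a_scale[OF neg_part_X[OF uX] comb_X[OF uX], of \<tau> t \<tau>] a_comb_neg[OF uX, of t \<tau>] that
    by (simp add: G_def w0 neg_part_comb a_sym[of "comb u t \<tau>"] P_scale Pn(1) split \<beta>_def \<gamma>_def algebra_simps)
  have low: "0 < r * (r * c + x * \<gamma> - r * r powr (p - 2) * (c + \<gamma>))" if "c + \<gamma> > 0" "x \<ge> r" for c x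
  proof -
    have "r powr (p - 2) < r powr 0" using rR p_gt by (intro powr_less_mono') auto
    then have "r powr (p - 2) * (c + \<gamma>) < 1 * (c + \<gamma>)" using that rR by (intro mult_strict_right_mono) auto
    then have "r * (r powr (p - 2) * (c + \<gamma>)) < r * (1 * (c + \<gamma>))" using rR by (intro mult_strict_left_mono) auto
    moreover have "r * \<gamma> \<le> x * \<gamma>" using that g by (intro mult_right_mono) auto
    ultimately have "0 < r * c + x * \<gamma> - r * r powr (p - 2) * (c + \<gamma>)" by (simp add: algebra_simps)
    then show ?thesis using rR by (intro mult_pos_pos)
  qed
  have high: "0 < - (R * (R * c + x * \<gamma> - R * R powr (p - 2) * (c + \<gamma>)))" if "c + \<gamma> > 0" "x \<le> R" for c x
  proof -
    have R0: "R > 0" using rR by simp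
    have "R powr 0 < R powr (p - 2)" using rR p_gt by (intro powr_less_mono) auto
    then have "1 * (c + \<gamma>) < R powr (p - 2) * (c + \<gamma>)" using that rR by (intro mult_strict_right_mono) auto
    then have "R * (1 * (c + \<gamma>)) < R * (R powr (p - 2) * (c + \<gamma>))" using R0 by (intro mult_strict_left_mono) auto
    moreover have "x * \<gamma> \<le> R * \<gamma>" using that g by (intro mult_right_mono) auto
    ultimately have "R * c + x * \<gamma> - R * R powr (p - 2) * (c + \<gamma>) < 0" by (simp add: algebra_simps)
    then show ?thesis using R0 by (simp add: mult_less_0_iff)
  qed
  have "\<forall>\<^sub>F \<epsilon> in at_right 0. \<forall>z\<in>{r} \<times> {r..R}. F (z, \<epsilon>) > 0"
    using rR Pp by (intro positive_near_slice cont compact_Times) (auto simp: F0 intro!: low)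
  moreover have "\<forall>\<^sub>F \<epsilon> in at_right 0. \<forall>z\<in>{R} \<times> {r..R}. - F (z, \<epsilon>) > 0"
    using rR Pp high[of \<alpha>] by (intro positive_near_slice continuous_on_minus cont compact_Times) (auto simp: F0 simp del: neg_0_less_iff_less)
  moreover have "\<forall>\<^sub>F \<epsilon> in at_right 0. \<forall>z\<in>{r..R} \<times> {r}. G (z, \<epsilon>) > 0"
    using rR Pn by (intro positive_near_slice cont compact_Times) (auto simp: G0 intro!: low)
  moreover have "\<forall>\<^sub>F \<epsilon> in at_right 0. \<forall>z\<in>{r..R} \<times> {R}. - G (z, \<epsilon>) > 0"
    using rR Pn high[of \<beta>] by (intro positive_near_slice continuous_on_minus cont compact_Times) (auto simp: G0 simp del: neg_0_less_iff_less)
  moreover have "\<forall>\<^sub>F \<epsilon> in at_right 0. \<forall>z\<in>S. P (pos_part (?w (z, \<epsilon>))) > 0"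
    unfolding S_def using rR Pp by (intro positive_near_slice contP compact_Times)
      (auto simp: w0 pos_part_comb P_scale intro!: mult_pos_pos)
  moreover have "\<forall>\<^sub>F \<epsilon> in at_right 0. \<forall>z\<in>S. P (neg_part (?w (z, \<epsilon>))) > 0"
    unfolding S_def using rR Pn by (intro positive_near_slice contP compact_Times)
      (auto simp: w0 neg_part_comb P_scale intro!: mult_pos_pos)
  moreover have "\<forall>\<^sub>F \<epsilon> in at_right 0. \<epsilon> * a \<phi> \<phi> < 1"
  proof -
    have "((\<lambda>\<epsilon>. \<epsilon> * a \<phi> \<phi>) \<longlongrightarrow> 0 * a \<phi> \<phi>) (at_right 0)" by (intro tendsto_intros)
    then show ?thesis by (intro order_tendstoD) auto
  qed
  moreover have "\<forall>\<^sub>F \<epsilon> in at_right 0. \<epsilon> > (0::real)" by (rule eventually_at_right_less)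
  ultimately have "\<forall>\<^sub>F \<epsilon> in at_right 0. \<epsilon> > 0 \<and> \<epsilon> * a \<phi> \<phi> < 1
    \<and> (\<forall>z\<in>{r} \<times> {r..R}. F (z, \<epsilon>) > 0) \<and> (\<forall>z\<in>{R} \<times> {r..R}. - F (z, \<epsilon>) > 0)
    \<and> (\<forall>z\<in>{r..R} \<times> {r}. G (z, \<epsilon>) > 0) \<and> (\<forall>z\<in>{r..R} \<times> {R}. - G (z, \<epsilon>) > 0)
    \<and> (\<forall>z\<in>S. P (pos_part (?w (z, \<epsilon>))) > 0) \<and> (\<forall>z\<in>S. P (neg_part (?w (z, \<epsilon>))) > 0)"
    by eventually_elim (intro conjI; assumption)
  then have "\<exists>\<epsilon>. \<epsilon> > 0 \<and> \<epsilon> * a \<phi> \<phi> < 1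
    \<and> (\<forall>z\<in>{r} \<times> {r..R}. F (z, \<epsilon>) > 0) \<and> (\<forall>z\<in>{R} \<times> {r..R}. - F (z, \<epsilon>) > 0)
    \<and> (\<forall>z\<in>{r..R} \<times> {r}. G (z, \<epsilon>) > 0) \<and> (\<forall>z\<in>{r..R} \<times> {R}. - G (z, \<epsilon>) > 0)
    \<and> (\<forall>z\<in>S. P (pos_part (?w (z, \<epsilon>))) > 0) \<and> (\<forall>z\<in>S. P (neg_part (?w (z, \<epsilon>))) > 0)"
    by (rule eventually_happens'[OF trivial_limit_at_right_real])
  then obtain \<epsilon> where \<epsilon>: "\<epsilon> > 0" "\<epsilon> * a \<phi> \<phi> < 1"
    and faces: "\<forall>z\<in>{r} \<times> {r..R}. F (z, \<epsilon>) > 0" "\<forall>z\<in>{R} \<times> {r..R}. - F (z, \<epsilon>) > 0"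
      "\<forall>z\<in>{r..R} \<times> {r}. G (z, \<epsilon>) > 0" "\<forall>z\<in>{r..R} \<times> {R}. - G (z, \<epsilon>) > 0"
    and nonzero: "\<forall>z\<in>S. P (pos_part (?w (z, \<epsilon>))) > 0" "\<forall>z\<in>S. P (neg_part (?w (z, \<epsilon>))) > 0"
    by (elim exE conjE) (rule that; assumption)
  have "\<exists>t\<in>{r..R}. \<exists>\<tau>\<in>{r..R}. F ((t, \<tau>), \<epsilon>) = 0 \<and> G ((t, \<tau>), \<epsilon>) = 0"
  proof (rule miranda_square[OF rR(4)])
    show "continuous_on ({r..R} \<times> {r..R}) (\<lambda>z. F (z, \<epsilon>))" "continuous_on ({r..R} \<times> {r..R}) (\<lambda>z. G (z, \<epsilon>))"
      by (rule continuous_on_compose2[OF cont(1)] continuous_on_compose2[OF cont(2)]; auto intro!: continuous_intros)+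
  qed (use faces in \<open>auto simp: less_imp_le\<close>)
  then obtain t \<tau> where t: "t \<in> {r..R}" "\<tau> \<in> {r..R}" and FG: "F ((t, \<tau>), \<epsilon>) = 0" "G ((t, \<tau>), \<epsilon>) = 0" by blast
  define v where "v = ?w ((t, \<tau>), \<epsilon>)"
  have tpos: "t > 0" "\<tau> > 0" using t rR(1) by auto
  have "(t, \<tau>) \<in> S" using t by (simp add: S_def)
  then have "P (pos_part v) > 0" "P (neg_part v) > 0"
    using nonzero[THEN bspec, of "(t, \<tau>)"] by (simp_all add: v_def)
  then have "\<not> ae_zero (pos_part v)" "\<not> ae_zero (neg_part v)" using P_ae_zero by fastforce+
  then have "sign_changing v" by (simp add: sign_changing_def)
  then have "Nehari v" using FG pert_X[OF uX \<phi>] by (simp add: Nehari_def v_def F_def G_def)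
  then have "E u \<le> E v" by (rule min)
  also have "E v \<le> E (comb u t \<tau>) + \<epsilon> * \<Lambda> (t, \<tau>) + \<epsilon>\<^sup>2 / 2 * a \<phi> \<phi>"
    using E_perturb_le[OF comb_X[OF uX] \<phi>, of t \<tau> \<epsilon>] unfolding \<Lambda>_eq[OF tpos] by (simp add: v_def pert_def)
  also have "\<dots> < E u"
  proof -
    have "\<epsilon> * \<Lambda> (t, \<tau>) < \<epsilon> * (- 1 / 2)" using \<Lambda>_neg[OF t] \<epsilon>(1) by (intro mult_strict_left_mono)
    moreover have "\<epsilon>\<^sup>2 / 2 * a \<phi> \<phi> = \<epsilon> / 2 * (\<epsilon> * a \<phi> \<phi>)" by (simp add: power2_eq_square)
    moreover have "\<epsilon> / 2 * (\<epsilon> * a \<phi> \<phi>) \<le> \<epsilon> / 2 * 1" using \<epsilon> by (intro mult_left_mono) auto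
    moreover have "E (comb u t \<tau>) \<le> E u" using tpos by (intro Nehari_E_comb_le[OF u]) auto
    ultimately show ?thesis by linarith
  qed
  finally show False by simp
qed

lemma Nehari_minimizer_critical:
  assumes u: "Nehari u" and min: "\<And>v. Nehari v \<Longrightarrow> E u \<le> E v" and \<phi>: "\<phi> \<in> X"
  shows "a u \<phi> = N u \<phi>"
proof (rule ccontr)
  assume ne: "a u \<phi> \<noteq> N u \<phi>"
  \<comment> \<open>rescale \<open>\<phi>\<close> to unit rate of descent; a negative \<open>c\<close> reverses the direction\<close>
  define c where "c = - 1 / (a u \<phi> - N u \<phi>)"
  have uX: "u \<in> X" using u by (simp add: Nehari_def)
  have "a u (\<lambda>x. c * \<phi> x) = c * a u \<phi>" using a_scale[OF \<phi> uX, of c] by (simp add: a_sym[of u])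
  moreover have "N u (\<lambda>x. c * \<phi> x) = c * N u \<phi>"
  proof -
    have "N u (\<lambda>x. c * \<phi> x) = (\<integral>x. c * (\<bar>u x\<bar> powr (p - 2) * u x * \<phi> x) \<partial>lebesgue)"
      by (simp add: N_def mult_ac)
    then show ?thesis by (simp add: N_def)
  qed
  ultimately have "a u (\<lambda>x. c * \<phi> x) - N u (\<lambda>x. c * \<phi> x) = c * (a u \<phi> - N u \<phi>)" by (simp add: right_diff_distrib)
  also have "\<dots> = -1" using ne by (simp add: c_def)
  finally show False using Nehari_minimizer_no_descent[OF u min scale_X[OF \<phi>]] by blast
qed

lemma least_energy_nodal_solution:
  "\<exists>u. weak_solution \<Omega> K V p u \<and> sign_changing u \<and>
    (\<forall>v. weak_solution \<Omega> K V p v \<and> sign_changing v \<longrightarrow> energy \<Omega> K V p u \<le> energy \<Omega> K V p v) \<and>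
    u \<in> nodal_Nehari \<Omega> K V p \<and>
    (\<forall>v \<in> nodal_Nehari \<Omega> K V p. energy \<Omega> K V p u \<le> energy \<Omega> K V p v)"
proof -
  obtain u where u: "Nehari u" "\<And>v. Nehari v \<Longrightarrow> E u \<le> E v" using Nehari_minimizer by blast
  have en: "energy \<Omega> K V p v = E v" if "Nehari v" for v using that by (simp add: Nehari_def energy_eq)
  have "weak_solution \<Omega> K V p u"
    unfolding weak_solution_iff using u Nehari_minimizer_critical[OF u] by (simp add: Nehari_def)
  moreover have "sign_changing u" using u(1) by (simp add: Nehari_def)
  moreover have "energy \<Omega> K V p u \<le> energy \<Omega> K V p v" if "Nehari v" for v
    using that u by (simp add: en)
  ultimately show ?thesis
    unfolding nodal_Nehari_iff Ball_def using u(1) weak_solution_Nehari by blast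
qed

end

theorem theorem2p5:
  fixes \<Omega> :: "(real ^ 'n) set" and V K :: "real ^ 'n \<Rightarrow> real" and s p :: real
  assumes "CARD('n) \<ge> 2"
    and "0 < s" and "s < 1"
    and "open \<Omega>" and "connected \<Omega>" and "\<Omega> \<noteq> {}" and "bounded \<Omega>" and "lipschitz_boundary \<Omega>"
    and "Linf_on \<Omega> V"
    and "\<And>x. x \<noteq> 0 \<Longrightarrow> K x > 0"
    and "\<And>x. x \<noteq> 0 \<Longrightarrow> K x = K (- x)"
    and "integrable lebesgue (\<lambda>x. min ((norm x)\<^sup>2) 1 * K x)"
    and "\<exists>\<theta> > 0. \<forall>x. x \<noteq> 0 \<longrightarrow> K x \<ge> \<theta> * norm x powr (- (real CARD('n) + 2 * s))"
    and "positive_definite_op \<Omega> K V"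
    and "2 < p" and "p < 2 * real CARD('n) / (real CARD('n) - 2 * s)"
  shows "\<exists>u. weak_solution \<Omega> K V p u \<and> sign_changing u \<and>
    (\<forall>v. weak_solution \<Omega> K V p v \<and> sign_changing v \<longrightarrow> energy \<Omega> K V p u \<le> energy \<Omega> K V p v) \<and>
    u \<in> nodal_Nehari \<Omega> K V p \<and>
    (\<forall>v \<in> nodal_Nehari \<Omega> K V p. energy \<Omega> K V p u \<le> energy \<Omega> K V p v)"
proof -
  have dim: "real DIM(real ^ 'n) = real CARD('n)" by simp
  have sub: "2 * s < real DIM(real ^ 'n)" unfolding dim using assms(1,3) by linarith
  have "nonlocal_problem \<Omega> V K s p"
    by (rule nonlocal_problem.intro[OF assms(2) sub assms(4,6,7,9,10,12) assms(13)[folded dim]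
          assms(14,15) assms(16)[folded dim]])
  then show ?thesis by (rule nonlocal_problem.least_energy_nodal_solution)
qed

end
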